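(* Let $\{B(t)\}_{t\ge 0}$ be a standard Brownian motion, $S(t):=\max_{0\le u\le t}B(u)$, and $\mathcal A:=\int_0^1 S(t)\,\mathrm dt$. Let $\mathcal M$ be a positive random variable with distribution given by $$\mathbb P(\mathcal M>x)=\mathbb E\,e^{-x^{3/2}\mathcal A},\qquad x>0.$$ Then for all complex $s$ with $-3/2<\operatorname{Re}s<3/2$, \begin{align*} \mathbb E\,\mathcal M^s &=\frac{\Gamma(1+2s/3)\,\Gamma(2/3-2s/3)\,\Gamma(1-2s/3)}{\Gamma(2/3)\,\Gamma(1-s)}\Bigl(\frac{2}{3^{2/3}}\Bigr)^s\\ &=\frac{2\,\Gamma(1/3)}{3\sqrt\pi}\cdot\frac{\Gamma(1+2s/3)\,\Gamma(3/2-s)}{\Gamma(4/3-2s/3)}\Bigl(\frac{3^{4/3}}{2}\Bigr)^s\\ &=\frac{\Gamma(1/3)}{2^{1/3}\pi}\cdot\frac{\Gamma(1+2s/3)\,\Gamma(1/2-s/3)\,\Gamma(5/6-s/3)}{\Gamma(2/3-s/3)}\Bigl(\frac32\Bigr)^{s/3}\\ &=\frac{\Gamma(1/3)}{2^{1/3}\pi^{3/2}}\cdot\frac{\Gamma(1/2+s/3)\,\Gamma(1+s/3)\,\Gamma(1/2-s/3)\,\Gamma(5/6-s/3)}{\Gamma(2/3-s/3)}\,6^{s/3}. \end{align*} Further, $\mathbb E\,\mathcal M^s=\infty$ for real $s\le-3/2$ or $s\ge3/2$.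
   Context: Each right-hand side is a meromorphic function of $s$; at removable singularities (e.g. $s=1$ in the first formula) its value is defined by continuity. *)

theory Defs
  imports "HOL-Probability.Probability" "HOL-Complex_Analysis.Complex_Analysis"
begin

text \<open>
  Paths are only required to be continuous almost surely, as is \<open>B 0 = 0\<close>.
  \<open>B t\<close> is irrelevant for \<open>t < 0\<close>.
\<close>

locale standard_brownian_motion = prob_space M
  for M :: "'a measure" and B :: "real \<Rightarrow> 'a \<Rightarrow> real" +
  assumes random_variable_B: "\<And>t. 0 \<le> t \<Longrightarrow> random_variable borel (B t)"
    and start_zero: "AE \<omega> in M. B 0 \<omega> = 0"
    and continuous_paths: "AE \<omega> in M. continuous_on {0..} (\<lambda>t. B t \<omega>)"
    and normal_increments: "\<And>s t. 0 \<le> s \<Longrightarrow> s < t \<Longrightarrow>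
          distributed M lborel (\<lambda>\<omega>. B t \<omega> - B s \<omega>) (normal_density 0 (sqrt (t - s)))"
    and indep_increments: "\<And>(n::nat) t. 0 \<le> t 0 \<Longrightarrow> (\<And>i. i < n \<Longrightarrow> t i \<le> t (Suc i)) \<Longrightarrow>
          indep_vars (\<lambda>_. borel) (\<lambda>i \<omega>. B (t (Suc i)) \<omega> - B (t i) \<omega>) {..<n}"

text \<open>For a continuous path the supremum is attained, so it is the maximum over \<open>[0, t]\<close>.\<close>

definition running_max :: "(real \<Rightarrow> 'a \<Rightarrow> real) \<Rightarrow> real \<Rightarrow> 'a \<Rightarrow> real" where
  "running_max B t \<omega> = (SUP u\<in>{0..t}. B u \<omega>)"

definition running_max_area :: "(real \<Rightarrow> 'a \<Rightarrow> real) \<Rightarrow> 'a \<Rightarrow> real" where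
  "running_max_area B \<omega> = (LBINT t:{0..1}. running_max B t \<omega>)"

text \<open>
  Below, a meromorphic function written as an expression is evaluated through
  \<^const>\<open>remove_sings\<close>, which takes the limit at a removable singularity.  This matters because
  \<^const>\<open>Gamma\<close> is totalised by \<open>0\<close> at its poles.
\<close>

definition moment1 :: "complex \<Rightarrow> complex" where
  "moment1 = remove_sings (\<lambda>s.
     Gamma (1 + 2 * s / 3) * Gamma (2 / 3 - 2 * s / 3) * Gamma (1 - 2 * s / 3)
       / (Gamma (2 / 3) * Gamma (1 - s)) * (2 / 3 powr (2 / 3)) powr s)"

definition moment2 :: "complex \<Rightarrow> complex" where
  "moment2 = remove_sings (\<lambda>s.
     2 * Gamma (1 / 3) / (3 * of_real (sqrt pi))
       * (Gamma (1 + 2 * s / 3) * Gamma (3 / 2 - s) / Gamma (4 / 3 - 2 * s / 3))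
       * (3 powr (4 / 3) / 2) powr s)"

definition moment3 :: "complex \<Rightarrow> complex" where
  "moment3 = remove_sings (\<lambda>s.
     Gamma (1 / 3) / (2 powr (1 / 3) * of_real pi)
       * (Gamma (1 + 2 * s / 3) * Gamma (1 / 2 - s / 3) * Gamma (5 / 6 - s / 3)
            / Gamma (2 / 3 - s / 3))
       * (3 / 2) powr (s / 3))"

definition moment4 :: "complex \<Rightarrow> complex" where
  "moment4 = remove_sings (\<lambda>s.
     Gamma (1 / 3) / (2 powr (1 / 3) * of_real pi powr (3 / 2))
       * (Gamma (1 / 2 + s / 3) * Gamma (1 + s / 3) * Gamma (1 / 2 - s / 3) * Gamma (5 / 6 - s / 3)
            / Gamma (2 / 3 - s / 3))
       * 6 powr (s / 3))"

end

theory Submission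
  imports Defs "HOL-Real_Asymp.Real_Asymp"
begin

text \<open>
  For \<open>l > 0\<close> let \<open>\<theta> m = sqrt (2 * (l + m))\<close> and let \<open>\<Theta>\<close> be its primitive vanishing at \<open>0\<close>.
  Writing \<open>A t\<close> for the integral of \<open>S\<close> over \<open>[0, t]\<close>, the process
  \<open>exp (\<Theta> (S t) - \<theta> (S t) * (S t - B t) - l * t - A t)\<close> is a local martingale, so the hitting time
  \<open>\<tau>\<close> of a level \<open>a\<close> satisfies \<open>E (exp (- l * \<tau> - A \<tau>)) = exp (- \<Theta> a)\<close>.  Integrating this against
  \<open>da / (l + a)\<^sup>2\<close> yields the Laplace transform of \<open>t \<mapsto> E (exp (- A t))\<close>, which is the tail of \<open>X\<close>
  by Brownian scaling.  Integrating the Laplace transform of \<open>X\<close> against powers of \<open>l\<close> gives Beta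
  integrals for the moments of order in \<open>(-3/2, 0)\<close>, and its behaviour at \<open>l = 0\<close> gives a tail of
  order \<open>t powr (-3/2)\<close>.  Hence \<open>s \<mapsto> E (X powr s)\<close> is holomorphic on the strip, and the
  formulas extend by the identity theorem; the moments of the boundary orders are infinite because
  the formulas blow up there.
\<close>

section \<open>Running maximum and area of a continuous path\<close>

text \<open>Stochastic calculus enters only through grids. The maximum grows only when the path is
  at its maximum, so summation by parts turns the integral of \<open>\<theta>\<close> along the path
  into an explicit functional of the path, and the martingale identity becomes a limit of Gaussian
  identities. The choice of \<open>\<theta>\<close> makes half its square equal to the killing rate
  \<open>l + S t\<close>. The hitting time is never integrated as a random variable:
  \<open>exp (- l * \<tau> - A \<tau>)\<close> is the integral of
  \<open>(l + S t) * exp (- l * t - A t)\<close> over \<open>t \<ge> \<tau>\<close>, that is, over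
  the times with \<open>a \<le> S t\<close>. If the level \<open>a\<close> is integrated out first,
  the weight \<open>1 / (l + a)^2\<close> gives \<open>S t / (l * (l + S t))\<close>, which removes
  the killing rate; this is the reason for the weight. In the continuation, numerator and
  denominator of the first formula share a pole at \<open>s = 1\<close>, so the identity theorem is
  applied on the strip without that point, with the computed moments of negative order as the set of
  agreement.\<close>

primrec prefix_max :: "(nat \<Rightarrow> real) \<Rightarrow> nat \<Rightarrow> real" where
  "prefix_max x 0 = x 0"
| "prefix_max x (Suc i) = max (prefix_max x i) (x (Suc i))"

lemma prefix_max_ge: "j \<le> i \<Longrightarrow> x j \<le> prefix_max x i"
  by (induction i) (auto simp: le_Suc_eq max_def)

lemma prefix_max_attained: "\<exists>j\<le>i. prefix_max x i = x j"
proof (induction i)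
  case (Suc i)
  then obtain j where "j \<le> i" "prefix_max x i = x j" by blast
  then show ?case
    by (cases "prefix_max x i \<le> x (Suc i)") (simp_all add: max_def, blast, metis le_SucI)
qed auto

lemma prefix_max_cong: "(\<And>j. j \<le> i \<Longrightarrow> x j = y j) \<Longrightarrow> prefix_max x i = prefix_max y i"
  by (induction i) auto

lemma prefix_max_scale: "0 \<le> c \<Longrightarrow> prefix_max (\<lambda>j. c * x j) i = c * prefix_max x i"
  by (induction i) (auto simp: max_mult_distrib_left)

lemma prefix_max_measurable [measurable]:
  "(\<And>j. j \<le> i \<Longrightarrow> (\<lambda>\<omega>. x \<omega> j) \<in> borel_measurable M) \<Longrightarrow> (\<lambda>\<omega>. prefix_max (x \<omega>) i) \<in> borel_measurable M"
  by (induction i) auto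

text \<open>Summation by parts: whenever the maximum increases, its distance to the path is \<open>0\<close>.\<close>

lemma prefix_max_abel_sum:
  assumes "f = prefix_max x"
  shows "(\<Sum>i<n. \<theta> (f i) * (x (Suc i) - x i))
    = (\<Sum>i<n. \<theta> (f i) * (f (Suc i) - f i)) - \<theta> (f n) * (f n - x n)"
proof (induction n)
  case (Suc n)
  have "f (Suc n) = f n \<or> f (Suc n) = x (Suc n)" by (auto simp: assms max_def)
  with Suc show ?case by (auto simp: algebra_simps)
qed (simp add: assms)

text \<open>The clamp \<open>max 0 t\<close> keeps the index interval nonempty for every real
  \<open>t\<close>, so that for a continuous path \<open>smax w\<close> is monotone and continuous
  on the whole line.\<close>

definition smax :: "(real \<Rightarrow> real) \<Rightarrow> real \<Rightarrow> real" where
  "smax w t = (SUP u\<in>{0..max 0 t}. w u)"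

text \<open>Since \<open>smax w\<close> vanishes on \<open>t \<le> 0\<close>, the lower limit \<open>-1\<close> gives the same value as \<open>0\<close>,
  but makes \<open>area w\<close> differentiable at \<open>0\<close> from both sides.\<close>

definition area :: "(real \<Rightarrow> real) \<Rightarrow> real \<Rightarrow> real" where
  "area w t = integral {-1..t} (smax w)"

locale continuous_path =
  fixes w :: "real \<Rightarrow> real"
  assumes cont: "continuous_on UNIV w" and zero: "w 0 = 0"
begin

lemma smax_attained: "\<exists>u\<in>{0..max 0 t}. smax w t = w u \<and> (\<forall>v\<in>{0..max 0 t}. w v \<le> w u)"
proof -
  have "\<exists>x\<in>{0..max 0 t}. \<forall>y\<in>{0..max 0 t}. w y \<le> w x"
    by (rule continuous_attains_sup) (auto intro: continuous_on_subset[OF cont])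
  then obtain u where u: "u \<in> {0..max 0 t}" "\<forall>y\<in>{0..max 0 t}. w y \<le> w u" by blast
  have "smax w t = w u" unfolding smax_def
    using u by (intro cSup_eq_maximum) auto
  with u show ?thesis by blast
qed

lemma smax_ge: "0 \<le> u \<Longrightarrow> u \<le> t \<Longrightarrow> w u \<le> smax w t"
  using smax_attained[of t] by auto

lemma smax_nonpos: "t \<le> 0 \<Longrightarrow> smax w t = 0"
  by (simp add: smax_def zero max_def)

lemma smax_nonneg: "0 \<le> smax w t"
  using smax_attained[of t] zero by (auto dest!: bspec[of _ _ 0])

lemma smax_mono: "s \<le> t \<Longrightarrow> smax w s \<le> smax w t"
  using smax_attained[of s] smax_attained[of t] by (smt (verit) atLeastAtMost_iff)

text \<open>Passing from \<open>s\<close> to a later \<open>r\<close>, either the maximum was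
  already attained by time \<open>s\<close>, or it is attained close to \<open>t\<close>, where the
  path itself has barely moved.\<close>

lemma smax_continuous: "continuous_on A (smax w)"
proof -
  have *: "\<exists>d>0. \<forall>s. dist s t < d \<longrightarrow> dist (smax w s) (smax w t) < 2 * e" if e: "e > 0" for e t
  proof -
    let ?v = "\<lambda>s. w (max 0 s)"
    have "continuous_on UNIV ?v"
      by (intro continuous_on_compose2[OF cont]) (auto intro!: continuous_intros)
    then obtain d where d: "d > 0" "\<And>s. dist s t < d \<Longrightarrow> dist (?v s) (?v t) < e / 2"
      using e unfolding continuous_on_iff by (metis UNIV_I half_gt_zero)
    have *: "smax w r \<le> smax w s + e / 2 + e / 2" 
      if rs: "s \<le> r" "dist s t < d" "dist r t < d" "s = t \<or> r = t" for r s
    proof -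
      obtain u where u: "u \<in> {0..max 0 r}" "smax w r = w u" using smax_attained[of r] by blast
      show ?thesis
      proof (cases "u \<le> max 0 s")
        case True
        then show ?thesis using u e smax_attained[of s] by force
      next
        case False
        then have "dist u t < d" using u rs by (auto simp: dist_real_def)
        then have "w u < w (max 0 t) + e / 2" using d(2)[of u] False by (auto simp: dist_real_def abs_if split: if_splits)
        moreover have "w (max 0 t) < w (max 0 s) + e / 2" using d(2)[OF rs(2)] by (auto simp: dist_real_def abs_if split: if_splits)
        moreover have "w (max 0 s) \<le> smax w s" using smax_attained[of s] by auto
        ultimately show ?thesis using u by linarith
      qed
    qed
    have "dist (smax w s) (smax w t) < 2 * e" if "dist s t < d" for s
      using *[of s t] *[of t s] that smax_mono[of s t] smax_mono[of t s] d(1) e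
      by (cases "s \<le> t") (auto simp: dist_real_def)
    then show ?thesis using d(1) by (intro exI[of _ d]) auto
  qed
  then have "\<exists>d>0. \<forall>s. dist s t < d \<longrightarrow> dist (smax w s) (smax w t) < e" if "e > 0" for e t
    using that *[of "e/2"] by simp
  then show ?thesis unfolding continuous_on_iff by blast
qed

lemma area_deriv:
  assumes "-1 < t" shows "(area w has_real_derivative smax w t) (at t)"
proof -
  have "((\<lambda>u. integral {-1..u} (smax w)) has_real_derivative smax w t) (at t within {-1..t+1})"
    by (rule integral_has_real_derivative[OF smax_continuous]) (use assms in auto)
  moreover have "at t within {-1..t+1} = at t"
    by (rule at_within_Icc_at) (use assms in auto)
  ultimately show ?thesis by (simp add: area_def[abs_def])
qed

lemma area_nonpos: "t \<le> 0 \<Longrightarrow> area w t = 0"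
  unfolding area_def by (rule integral_unique, rule has_integral_eq[OF _ has_integral_0])
    (auto simp: smax_nonpos)

lemma area_0: "area w 0 = 0"
  by (simp add: area_nonpos)

lemma area_nonneg: "0 \<le> area w t"
  unfolding area_def by (rule integral_nonneg) (auto intro: integrable_continuous_real smax_continuous smax_nonneg)

lemma area_mono: "s \<le> t \<Longrightarrow> area w s \<le> area w t"
  unfolding area_def
  by (rule integral_subset_le) (auto intro: integrable_continuous_real smax_continuous smax_nonneg)

lemma area_continuous: "continuous_on UNIV (area w)"
proof -
  have "continuous_on {0..} (area w)"
  proof (intro continuous_at_imp_continuous_on ballI)
    fix t :: real assume "t \<in> {0..}"
    then show "isCont (area w) t" using area_deriv[of t] by (intro DERIV_isCont) auto
  qed
  moreover have "continuous_on {..0} (area w)"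
    by (rule continuous_on_eq[OF continuous_on_const[of _ 0]]) (simp add: area_nonpos)
  moreover have "{..0} \<union> {0..} = (UNIV :: real set)" by auto
  ultimately show ?thesis by (metis closed_atLeast closed_atMost continuous_on_closed_Un)
qed

lemma integral_smax_0: "0 \<le> t \<Longrightarrow> integral {0..t} (smax w) = area w t"
  using Henstock_Kurzweil_Integration.integral_combine[of "-1" 0 t "smax w",
      OF _ _ integrable_continuous_real[OF smax_continuous]] area_0
  unfolding area_def by linarith

lemma prefix_max_le_smax:
  assumes "0 \<le> h" shows "prefix_max (\<lambda>j. w (real j * h)) i \<le> smax w (real i * h)"
proof -
  obtain j where "j \<le> i" "prefix_max (\<lambda>j. w (real j * h)) i = w (real j * h)"
    using prefix_max_attained by blast
  then show ?thesis using smax_ge[of "j * h" "i * h"] assms by (auto simp: mult_right_mono)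
qed

text \<open>A maximiser of the path on \<open>[0, u]\<close> has a grid point of index at most
  \<open>i\<close> no further than \<open>h\<close> to its left. This works up to the end of the
  cell that follows grid point \<open>i\<close>, hence \<open>Suc i\<close>: the discrete maximum at
  the left end of a cell controls the running maximum on the whole cell.\<close>

lemma smax_le_prefix_max:
  fixes h T e u :: real
  assumes h: "0 < h" and osc: "\<And>u v. 0 \<le> u \<Longrightarrow> u \<le> v \<Longrightarrow> v \<le> u + h \<Longrightarrow> v \<le> T \<Longrightarrow> \<bar>w u - w v\<bar> \<le> e"
    and u: "u \<le> real (Suc i) * h" "u \<le> T"  and T: "0 \<le> T"
  shows "smax w u \<le> prefix_max (\<lambda>j. w (real j * h)) i + e"
proof -
  obtain v where v: "v \<in> {0..max 0 u}" "smax w u = w v" using smax_attained[of u] by blast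
  \<comment> \<open>The grid index just below the maximiser. The cap at \<open>i\<close> takes
    effect only at the right end of the last admissible cell.\<close>
  define j where "j = min i (nat \<lfloor>v / h\<rfloor>)"
  have "real j * h \<le> v"
  proof -
    have "real j \<le> v / h" unfolding j_def using v h
      by (smt (verit, del_insts) atLeastAtMost_iff divide_nonneg_pos min.cobounded2 of_nat_floor of_nat_le_iff)
    then show ?thesis using h by (simp add: field_simps)
  qed
  moreover have "v \<le> real j * h + h"
  proof (cases "nat \<lfloor>v / h\<rfloor> \<le> i")
    case True
    then have "v / h \<le> real j + 1" unfolding j_def using v h by (simp add: min_def)
    then show ?thesis using h by (simp add: field_simps)
  next
    case False
    then have "j = i" by (simp add: j_def)
    then show ?thesis using v u h by (auto simp: algebra_simps max_def split: if_splits)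
  qed
  ultimately have "\<bar>w (real j * h) - w v\<bar> \<le> e" using v u T h by (intro osc) auto
  moreover have "w (real j * h) \<le> prefix_max (\<lambda>j. w (real j * h)) i"
    by (rule prefix_max_ge[of j i "\<lambda>j. w (real j * h)"]) (simp add: j_def)
  ultimately show ?thesis using v by linarith
qed

text \<open>The times with \<open>a \<le> smax w t\<close> form a closed set that is bounded below,
  and by monotonicity it is the half-line starting at its infimum. The form of an equivalence lets
  integrals over this set be written as integrals from \<open>\<tau>\<close> on.\<close>

lemma smax_hitting_time:
  assumes "0 < a" "a \<le> smax w T"
  obtains \<tau> where "0 < \<tau>" "\<tau> \<le> T" "\<And>t. a \<le> smax w t \<longleftrightarrow> \<tau> \<le> t"
proof -
  let ?A = "{t. a \<le> smax w t}"
  have pos: "0 < t" if "a \<le> smax w t" for t using that smax_nonpos[of t] assms by linarith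
  have bdd: "bdd_below ?A" by (rule bdd_belowI[of _ 0]) (use pos in force)
  have "closed ?A"
    by (rule closed_Collect_le[OF continuous_on_const smax_continuous])
  then have "Inf ?A \<in> ?A" using assms(2) bdd by (intro closed_contains_Inf) auto
  then have Inf: "a \<le> smax w (Inf ?A)" by simp
  have iff: "a \<le> smax w t \<longleftrightarrow> Inf ?A \<le> t" for t
  proof
    show "Inf ?A \<le> t" if "a \<le> smax w t" using that by (intro cInf_lower bdd) simp
    show "a \<le> smax w t" if "Inf ?A \<le> t" using Inf smax_mono[OF that] by linarith
  qed
  show ?thesis by (rule that[OF pos[OF Inf] _ iff]) (use iff assms(2) in blast)
qed

text \<open>\<open>l + smax w t\<close> is the derivative of the exponent
  \<open>l * t + area w t\<close>. The integrand is thus the density of a killing time with this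
  rate, and its mass from \<open>s\<close> on is the survival factor at \<open>s\<close>.\<close>

lemma killed_hitting_integral:
  assumes "0 < l" "0 \<le> s"
  shows "(\<integral>\<^sup>+t. ennreal ((l + smax w t) * exp (- (l * t) - area w t)) * indicator {s..} t \<partial>lborel)
    = ennreal (exp (- (l * s) - area w s))"
proof -
  have "(\<integral>\<^sup>+t. ennreal ((l + smax w t) * exp (- (l * t) - area w t)) * indicator {s..} t \<partial>lborel)
    = ennreal (0 - (- exp (- (l * s) - area w s)))"
  proof (rule nn_integral_FTC_atLeast)
    show "(\<lambda>t. (l + smax w t) * exp (- (l * t) - area w t)) \<in> borel_measurable borel"
      by (intro borel_measurable_continuous_onI continuous_intros smax_continuous area_continuous)
    show "((\<lambda>t. - exp (- (l * t) - area w t)) has_real_derivative (l + smax w x) * exp (- (l * x) - area w x)) (at x)"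
      if "s \<le> x" for x
      using that assms by (auto intro!: derivative_eq_intros area_deriv simp: algebra_simps)
    show "0 \<le> (l + smax w x) * exp (- (l * x) - area w x)" if "s \<le> x" for x
      using assms smax_nonneg[of x] by simp
    have "((\<lambda>t. - exp (- (l * t))) \<longlongrightarrow> 0) at_top" using assms by real_asymp
    then show "((\<lambda>t. - exp (- (l * t) - area w t)) \<longlongrightarrow> 0) at_top"
      by (rule tendsto_sandwich[rotated 2, OF _ tendsto_const]) (simp_all add: area_nonneg)
  qed
  then show ?thesis by simp
qed

lemma oscillation:
  assumes "0 < e" "0 < T"
  shows "\<forall>\<^sub>F n in sequentially. \<forall>u v. 0 \<le> u \<longrightarrow> u \<le> v \<longrightarrow> v \<le> u + T / n \<longrightarrow> v \<le> T \<longrightarrow> \<bar>w u - w v\<bar> \<le> e"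
proof -
  have "uniformly_continuous_on {0..T} w"
    by (intro compact_uniformly_continuous continuous_on_subset[OF cont]) auto
  then obtain d where d: "d > 0" "\<And>x y. x \<in> {0..T} \<Longrightarrow> y \<in> {0..T} \<Longrightarrow> dist y x < d \<Longrightarrow> dist (w y) (w x) < e"
    using \<open>0 < e\<close> unfolding uniformly_continuous_on_def by metis
  have "(\<lambda>n. T / real n) \<longlonglongrightarrow> 0" by real_asymp
  then have "\<forall>\<^sub>F n in sequentially. T / real n < d" using d(1) by (rule order_tendstoD)
  then show ?thesis
  proof eventually_elim
    case (elim n)
    show ?case
    proof (intro allI impI)
      fix u v assume "0 \<le> u" "u \<le> v" "v \<le> u + T / n" "v \<le> T"
      then show "\<bar>w u - w v\<bar> \<le> e"
        using d(2)[of v u] elim by (auto simp: dist_real_def)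
    qed
  qed
qed

end

section \<open>Grid sums along the running maximum\<close>

lemma lipschitz_continuous_on:
  fixes f :: "real \<Rightarrow> real"
  assumes "\<And>x y. \<bar>f x - f y\<bar> \<le> L * \<bar>x - y\<bar>"
  shows "continuous_on A f"
proof -
  have "lipschitz_on L A f"
    using assms assms[of 0 1] by (auto intro!: lipschitz_onI simp: dist_real_def)
  then show ?thesis by (rule lipschitz_on_continuous_on)
qed

lemma integral_increment:
  fixes f :: "real \<Rightarrow> real"
  assumes "continuous_on UNIV f" "a \<le> b" "b \<le> c"
  shows "integral {a..c} f = integral {a..b} f + integral {b..c} f"
  using Henstock_Kurzweil_Integration.integral_combine[OF assms(2,3) integrable_continuous_real]
    continuous_on_subset[OF assms(1)] by (metis top_greatest)

lemma integral_close_to_rectangle: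
  fixes f :: "real \<Rightarrow> real"
  assumes "continuous_on {a..b} f" "a \<le> b" "\<And>u. u \<in> {a..b} \<Longrightarrow> \<bar>f u - c\<bar> \<le> d"
  shows "\<bar>integral {a..b} f - (b - a) * c\<bar> \<le> d * (b - a)"
proof -
  have "integral {a..b} f - (b - a) * c = integral {a..b} (\<lambda>u. f u - c)"
    using assms by (subst Henstock_Kurzweil_Integration.integral_diff)
      (auto intro: integrable_continuous_real)
  moreover have "norm (integral {a..b} (\<lambda>u. f u - c)) \<le> d * (b - a)"
    using assms by (intro integral_bound) (auto intro!: continuous_intros)
  ultimately show ?thesis by simp
qed

context continuous_path
begin

text \<open>On each cell the discrete maximum at the left end is below the running maximum by at
  most the oscillation \<open>e\<close>, so a Lipschitz \<open>f\<close> contributes an error of at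
  most \<open>L * e * h\<close> per cell.\<close>

lemma riemann_sum_prefix_max:
  fixes f :: "real \<Rightarrow> real"
  assumes f: "\<And>x y. \<bar>f x - f y\<bar> \<le> L * \<bar>x - y\<bar>" and T: "0 < T"
  shows "(\<lambda>n. (\<Sum>i<n. f (prefix_max (\<lambda>j. w (real j * (T / real n))) i)) * (T / real n))
    \<longlonglongrightarrow> integral {0..T} (\<lambda>u. f (smax w u))"
proof (rule tendstoI)
  fix r :: real assume "r > 0"
  have L: "0 \<le> L" using f[of 0 1] by simp
  define e where "e = r / (2 * T * (L + 1))"
  have e: "e > 0" using \<open>r > 0\<close> T L by (simp add: e_def)
  have cf: "continuous_on A f" for A using f by (rule lipschitz_continuous_on)
  have cfs: "continuous_on A (\<lambda>u. f (smax w u))" for A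
    by (rule continuous_on_compose2[OF cf smax_continuous]) auto
  have "\<forall>\<^sub>F n::nat in sequentially. n > 0" by (rule eventually_gt_at_top)
  with oscillation[OF e T]
  show "\<forall>\<^sub>F n in sequentially. dist ((\<Sum>i<n. f (prefix_max (\<lambda>j. w (real j * (T / real n))) i)) * (T / real n))
     (integral {0..T} (\<lambda>u. f (smax w u))) < r"
  proof eventually_elim
    case (elim n)
    define h where "h = T / real n"
    have h: "h > 0" and nh: "real n * h = T" using elim T by (simp_all add: h_def)
    have osc: "\<bar>w u - w v\<bar> \<le> e" if "0 \<le> u" "u \<le> v" "v \<le> u + h" "v \<le> T" for u v
      using elim that by (auto simp: h_def)
    have "\<bar>(\<Sum>i<m. f (prefix_max (\<lambda>j. w (real j * h)) i)) * h - integral {0..real m * h} (\<lambda>u. f (smax w u))\<bar>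
        \<le> L * e * (real m * h)" if "m \<le> n" for m
      using that
    proof (induction m)
      case (Suc m)
      let ?M = "prefix_max (\<lambda>j. w (real j * h)) m"
      have mT: "real (Suc m) * h \<le> T" unfolding nh[symmetric] using Suc h by (intro mult_right_mono) auto
      have "\<bar>f (smax w u) - f ?M\<bar> \<le> L * e" if u: "u \<in> {real m * h..real (Suc m) * h}" for u
      proof -
        have "?M \<le> smax w u"
          using prefix_max_le_smax[of h m] smax_mono[of "real m * h" u] u h by auto
        moreover have "smax w u \<le> ?M + e"
          by (rule smax_le_prefix_max[OF h osc]) (use u mT T in auto)
        ultimately show ?thesis
          using f[of "smax w u" ?M] L by (smt (verit) mult_left_mono)
      qed
      then have "\<bar>integral {real m * h..real (Suc m) * h} (\<lambda>u. f (smax w u)) - (real (Suc m) * h - real m * h) * f ?M\<bar>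
          \<le> L * e * (real (Suc m) * h - real m * h)"
        using h by (intro integral_close_to_rectangle cfs) (auto simp: algebra_simps)
      moreover have "integral {0..real (Suc m) * h} (\<lambda>u. f (smax w u))
          = integral {0..real m * h} (\<lambda>u. f (smax w u)) + integral {real m * h..real (Suc m) * h} (\<lambda>u. f (smax w u))"
        using h by (intro integral_increment cfs) (auto simp: algebra_simps)
      moreover have "real (Suc m) * h - real m * h = h" by (simp add: algebra_simps)
      ultimately show ?case using Suc by (simp add: algebra_simps)
    qed simp
    from this[of n] have "\<bar>(\<Sum>i<n. f (prefix_max (\<lambda>j. w (real j * h)) i)) * h - integral {0..T} (\<lambda>u. f (smax w u))\<bar>
        \<le> L * e * T" by (simp add: nh)
    also have "\<dots> \<le> (L + 1) * e * T" using e T by (intro mult_right_mono) auto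
    also have "\<dots> < r" using \<open>r > 0\<close> T L by (simp add: e_def field_simps add_pos_nonneg)
    finally show ?case by (simp add: dist_real_def h_def)
  qed
qed

text \<open>After \<open>prefix_max_abel_sum\<close> the sum runs over increments of the
  nondecreasing discrete maximum. It is then a Riemann sum for the integral of
  \<open>\<theta>\<close> in the level variable, with mesh at most \<open>e\<close>, and no
  quadratic variation term survives.\<close>

lemma stochastic_sum_limit:
  assumes \<theta>: "\<And>x y. \<bar>\<theta> x - \<theta> y\<bar> \<le> L * \<bar>x - y\<bar>" and T: "0 < T"
    and bound: "\<And>x. \<bar>\<theta> x\<bar> \<le> C"
  shows "(\<lambda>n. \<Sum>i<n. \<theta> (prefix_max (\<lambda>j. w (real j * (T / real n))) i)
        * (w (real (Suc i) * (T / real n)) - w (real i * (T / real n))))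
    \<longlonglongrightarrow> integral {0..smax w T} \<theta> - \<theta> (smax w T) * (smax w T - w T)"
proof (rule tendstoI)
  fix r :: real assume "r > 0"
  have L: "0 \<le> L" using \<theta>[of 0 1] by simp
  have C: "0 \<le> C" using bound[of 0] by simp
  define S where "S = smax w T"
  have S: "0 \<le> S" "w T \<le> S" using smax_nonneg smax_ge[of T T] T by (auto simp: S_def)
  \<comment> \<open>One summand for each error, in units of \<open>e\<close>: the Riemann sum up to
    \<open>f n\<close>, the missing piece of the integral between \<open>f n\<close> and
    \<open>S\<close>, the change of \<open>\<theta>\<close> between these levels, and the shift of
    the boundary term. The final 1 makes the estimate strict.\<close>
  define Q where "Q = L * S + C + L * (S - w T) + C + 1"
  have Q: "Q > 0" using L C S by (auto simp: Q_def intro!: add_nonneg_pos add_nonneg_nonneg)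
  define e where "e = r / (2 * Q)"
  have e: "e > 0" using \<open>r > 0\<close> Q by (simp add: e_def)
  have c\<theta>: "continuous_on A \<theta>" for A using \<theta> by (rule lipschitz_continuous_on)
  have "\<forall>\<^sub>F n::nat in sequentially. n > 0" by (rule eventually_gt_at_top)
  with oscillation[OF e T]
  show "\<forall>\<^sub>F n in sequentially. dist (\<Sum>i<n. \<theta> (prefix_max (\<lambda>j. w (real j * (T / real n))) i)
        * (w (real (Suc i) * (T / real n)) - w (real i * (T / real n))))
     (integral {0..smax w T} \<theta> - \<theta> (smax w T) * (smax w T - w T)) < r"
  proof eventually_elim
    case (elim n)
    define h where "h = T / real n"
    have h: "h > 0" and nh: "real n * h = T" using elim T by (simp_all add: h_def)
    have osc: "\<bar>w u - w v\<bar> \<le> e" if "0 \<le> u" "u \<le> v" "v \<le> u + h" "v \<le> T" for u v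
      using elim that by (auto simp: h_def)
    define x where "x = (\<lambda>j. w (real j * h))"
    define f where "f = prefix_max x"
    have f0: "f 0 = 0" by (simp add: f_def x_def zero)
    have fmono: "f i \<le> f (Suc i)" for i by (simp add: f_def)
    have fpos: "0 \<le> f i" for i by (induction i) (use f0 fmono order_trans in auto)
    have fle: "f i \<le> S" if "i \<le> n" for i
    proof -
      have "real i * h \<le> real n * h" using that h by (intro mult_right_mono) auto
      then show ?thesis
        using prefix_max_le_smax[of h i] smax_mono[of "real i * h" T] h nh 
        unfolding f_def x_def S_def by linarith
    qed
    have iT: "real (Suc i) * h \<le> T" if "i < n" for i 
      unfolding nh[symmetric] using that h by (intro mult_right_mono) auto
    have step: "f (Suc i) \<le> f i + e" if "i < n" for i
    proof -
      have "smax w (real (Suc i) * h) \<le> f i + e"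
        unfolding f_def x_def by (rule smax_le_prefix_max[OF h osc]) (use iT[OF that] T in auto)
      then show ?thesis using prefix_max_le_smax[of h "Suc i"] h unfolding f_def x_def by linarith
    qed
    have fn: "S \<le> f n + e"
    proof -
      have "S \<le> f n + e" unfolding f_def x_def S_def
        by (rule smax_le_prefix_max[OF h osc]) (use nh T h in \<open>auto simp: algebra_simps\<close>)
      then show ?thesis .
    qed
    have "\<bar>(\<Sum>i<m. \<theta> (f i) * (f (Suc i) - f i)) - integral {0..f m} \<theta>\<bar> \<le> L * e * f m" if "m \<le> n" for m
      using that
    proof (induction m)
      case (Suc m)
      have "\<bar>integral {f m..f (Suc m)} \<theta> - (f (Suc m) - f m) * \<theta> (f m)\<bar> \<le> L * e * (f (Suc m) - f m)"
      proof (intro integral_close_to_rectangle c\<theta> fmono)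
        fix u assume "u \<in> {f m..f (Suc m)}"
        then have "\<bar>u - f m\<bar> \<le> e" using step[of m] Suc by auto
        then show "\<bar>\<theta> u - \<theta> (f m)\<bar> \<le> L * e" using \<theta>[of u "f m"] L by (smt (verit) mult_left_mono)
      qed
      moreover have "integral {0..f (Suc m)} \<theta> = integral {0..f m} \<theta> + integral {f m..f (Suc m)} \<theta>"
        by (intro integral_increment c\<theta> fpos fmono)
      ultimately show ?case using Suc by (simp add: algebra_simps)
    qed (simp add: f0)
    from this[of n] have 1: "\<bar>(\<Sum>i<n. \<theta> (f i) * (f (Suc i) - f i)) - integral {0..f n} \<theta>\<bar> \<le> L * e * f n"
      by simp
    have "L * e * f n \<le> L * e * S" using fle[of n] L e by (intro mult_left_mono) auto
    note 1 = order_trans[OF 1 this]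
    have "\<bar>integral {f n..S} \<theta> - (S - f n) * 0\<bar> \<le> C * (S - f n)"
      using fle[of n] bound by (intro integral_close_to_rectangle c\<theta>) auto
    also have "\<dots> \<le> C * e" using fn C by (intro mult_left_mono) auto
    finally have 2: "\<bar>integral {f n..S} \<theta>\<bar> \<le> C * e" by simp
    have 3: "integral {0..S} \<theta> = integral {0..f n} \<theta> + integral {f n..S} \<theta>"
      by (intro integral_increment c\<theta> fpos fle) simp
    have xn: "x n = w T" by (simp add: x_def nh)
    have "\<bar>\<theta> S - \<theta> (f n)\<bar> \<le> L * e" 
      using \<theta>[of S "f n"] fn fle[of n] L mult_left_mono[of "S - f n" e L] by simp
    then have 4: "\<bar>(\<theta> S - \<theta> (f n)) * (S - w T)\<bar> \<le> L * e * (S - w T)"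
      using S by (auto simp: abs_mult intro: mult_right_mono)
    have "\<bar>\<theta> (f n) * (S - f n)\<bar> \<le> C * e"
      using bound[of "f n"] fn fle[of n] by (auto simp: abs_mult intro!: mult_mono)
    moreover have "\<theta> S * (S - w T) = (\<theta> S - \<theta> (f n)) * (S - w T) + \<theta> (f n) * (S - f n) + \<theta> (f n) * (f n - x n)"
      by (simp add: algebra_simps xn)
    ultimately have "\<bar>(\<Sum>i<n. \<theta> (f i) * (x (Suc i) - x i)) - (integral {0..S} \<theta> - \<theta> S * (S - w T))\<bar>
       \<le> L * e * S + C * e + L * e * (S - w T) + C * e"
      using 1 2 3 4 unfolding prefix_max_abel_sum[OF f_def] by linarith
    also have "\<dots> = (Q - 1) * e" by (simp add: Q_def algebra_simps)
    also have "\<dots> < Q * e" using e by simp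
    also have "\<dots> < r" using \<open>r > 0\<close> Q by (simp add: e_def)
    finally show ?case by (simp add: dist_real_def h_def x_def f_def S_def)
  qed
qed

end

section \<open>An exponential martingale\<close>

abbreviation std_gauss :: "real measure" where
  "std_gauss \<equiv> density lborel std_normal_density"

lemma prob_space_std_gauss: "prob_space std_gauss"
  by (rule prob_space_normal_density) simp

lemma product_prob_space_std_gauss: "product_prob_space (\<lambda>_. std_gauss)"
  by (intro product_prob_spaceI prob_space_std_gauss)

text \<open>Completing the square: the tilt turns the standard normal density into the normal
  density with mean \<open>a\<close>.\<close>

lemma std_gauss_exponential_moment:
  "(\<integral>\<^sup>+y. ennreal (exp (a * y - a\<^sup>2 / 2)) \<partial>std_gauss) = 1"
proof -
  have "std_normal_density y * exp (a * y - a\<^sup>2 / 2) = normal_density a 1 y" for y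
    by (simp add: normal_density_def mult_exp_exp power2_eq_square field_simps)
  then have "(\<integral>\<^sup>+y. ennreal (exp (a * y - a\<^sup>2 / 2)) \<partial>std_gauss) = (\<integral>\<^sup>+y. ennreal (normal_density a 1 y) \<partial>lborel)"
    by (subst nn_integral_density) (auto simp: ennreal_mult'[symmetric])
  also have "\<dots> = emeasure (density lborel (normal_density a 1)) (space (density lborel (normal_density a 1)))"
    by (simp add: emeasure_density)
  also have "\<dots> = 1"
    by (intro prob_space.emeasure_space_1 prob_space_normal_density) simp
  finally show ?thesis .
qed

text \<open>Under the product of standard normal laws this has the joint law of Brownian motion at
  the times \<open>j * h\<close>.\<close>

definition gauss_walk :: "real \<Rightarrow> (nat \<Rightarrow> real) \<Rightarrow> nat \<Rightarrow> real" where
  "gauss_walk h \<xi> j = sqrt h * (\<Sum>k<j. \<xi> k)"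

lemma gauss_coordinate_measurable:
  assumes "k < n" shows "(\<lambda>\<xi>. \<xi> k) \<in> borel_measurable (PiM {..<n} (\<lambda>_. std_gauss))"
  using measurable_component_singleton[of k "{..<n}" "\<lambda>_. std_gauss"] assms
  by (subst measurable_cong_sets[of _ _ borel std_gauss]) auto

lemma gauss_walk_measurable:
  "j \<le> n \<Longrightarrow> (\<lambda>\<xi>. gauss_walk h \<xi> j) \<in> borel_measurable (PiM {..<n} (\<lambda>_. std_gauss))"
  unfolding gauss_walk_def
  by (intro borel_measurable_times borel_measurable_sum measurable_const gauss_coordinate_measurable) auto

lemma gauss_walk_prefix_max_measurable:
  "j \<le> n \<Longrightarrow> (\<lambda>\<xi>. prefix_max (gauss_walk h \<xi>) j) \<in> borel_measurable (PiM {..<n} (\<lambda>_. std_gauss))"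
  by (intro prefix_max_measurable gauss_walk_measurable) auto

text \<open>The discrete stochastic exponential. The slope for step \<open>i\<close> is evaluated at
  the maximum up to index \<open>i\<close>, before the increment from \<open>i\<close> to
  \<open>Suc i\<close>, and is therefore predictable.\<close>

definition exp_functional :: "(real \<Rightarrow> real) \<Rightarrow> real \<Rightarrow> nat \<Rightarrow> (nat \<Rightarrow> real) \<Rightarrow> real" where
  "exp_functional \<theta> h n x = exp (\<Sum>i<n. \<theta> (prefix_max x i) * (x (Suc i) - x i) - h / 2 * (\<theta> (prefix_max x i))\<^sup>2)"

lemma exp_functional_cong:
  assumes "\<And>j. j \<le> n \<Longrightarrow> x j = y j" shows "exp_functional \<theta> h n x = exp_functional \<theta> h n y"
proof -
  have "prefix_max x i = prefix_max y i" if "i < n" for i using that assms by (intro prefix_max_cong) auto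
  then show ?thesis using assms by (simp add: exp_functional_def)
qed

lemma exp_functional_measurable:
  assumes [measurable]: "\<theta> \<in> borel_measurable borel"
  shows "(\<lambda>\<xi>. exp_functional \<theta> h n (gauss_walk h \<xi>)) \<in> borel_measurable (PiM {..<n} (\<lambda>_. std_gauss))"
  unfolding exp_functional_def
  by (intro borel_measurable_exp[THEN measurable_compose[rotated]] borel_measurable_sum borel_measurable_diff borel_measurable_times
      borel_measurable_power measurable_const measurable_compose[OF _ assms] gauss_walk_prefix_max_measurable gauss_walk_measurable)
    auto

text \<open>Given the first \<open>n\<close> coordinates, the last slope is a constant and the last
  factor is an exponential tilt of one standard normal variable, with mean 1.\<close>

lemma exp_functional_martingale:
  assumes \<theta>: "\<theta> \<in> borel_measurable borel" and h: "0 \<le> h"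
  shows "(\<integral>\<^sup>+\<xi>. ennreal (exp_functional \<theta> h n (gauss_walk h \<xi>)) \<partial>PiM {..<n} (\<lambda>_. std_gauss)) = 1"
proof -
  interpret product_prob_space "\<lambda>_::nat. std_gauss" by (rule product_prob_space_std_gauss)
  show ?thesis
  proof (induction n)
    case 0
    interpret P0: prob_space "PiM {..<0::nat} (\<lambda>_. std_gauss)" by (rule prob_space_PiM) (rule prob_space_std_gauss)
    show ?case using P0.emeasure_space_1 by (simp add: exp_functional_def)
  next
    case (Suc n)
    \<comment> \<open>The walk at index \<open>j\<close> sums only coordinates below
      \<open>j\<close>, so changing coordinate \<open>n\<close> leaves all maxima up to index
      \<open>n\<close> unchanged.\<close>
    have upd: "prefix_max (gauss_walk h (\<xi>(n := y))) i = prefix_max (gauss_walk h \<xi>) i" if "i \<le> n" for \<xi> y i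
      using that by (intro prefix_max_cong) (auto simp: gauss_walk_def)
    have step: "exp_functional \<theta> h (Suc n) (gauss_walk h (\<xi>(n := y)))
      = exp_functional \<theta> h n (gauss_walk h \<xi>)
        * exp ((\<theta> (prefix_max (gauss_walk h \<xi>) n) * sqrt h) * y - (\<theta> (prefix_max (gauss_walk h \<xi>) n) * sqrt h)\<^sup>2 / 2)"
      for \<xi> y
    proof -
      have "exp_functional \<theta> h (Suc n) (gauss_walk h (\<xi>(n := y))) =
        exp_functional \<theta> h n (gauss_walk h (\<xi>(n := y)))
        * exp (\<theta> (prefix_max (gauss_walk h (\<xi>(n := y))) n) * (gauss_walk h (\<xi>(n := y)) (Suc n) - gauss_walk h (\<xi>(n := y)) n)
           - h / 2 * (\<theta> (prefix_max (gauss_walk h (\<xi>(n := y))) n))\<^sup>2)"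
        by (simp add: exp_functional_def exp_add[symmetric])
      also have "exp_functional \<theta> h n (gauss_walk h (\<xi>(n := y))) = exp_functional \<theta> h n (gauss_walk h \<xi>)"
        by (rule exp_functional_cong) (simp add: gauss_walk_def)
      also have "gauss_walk h (\<xi>(n := y)) (Suc n) - gauss_walk h (\<xi>(n := y)) n = sqrt h * y"
        by (simp add: gauss_walk_def algebra_simps)
      finally show ?thesis using h unfolding upd[OF order_refl]
        by (simp add: power_mult_distrib mult_ac del: fun_upd_apply)
    qed
    have "(\<integral>\<^sup>+\<xi>. ennreal (exp_functional \<theta> h (Suc n) (gauss_walk h \<xi>)) \<partial>PiM {..<Suc n} (\<lambda>_. std_gauss))
      = (\<integral>\<^sup>+\<xi>. (\<integral>\<^sup>+y. ennreal (exp_functional \<theta> h (Suc n) (gauss_walk h (\<xi>(n := y)))) \<partial>std_gauss) \<partial>PiM {..<n} (\<lambda>_. std_gauss))"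
      unfolding lessThan_Suc
      by (rule product_nn_integral_insert)
        (use exp_functional_measurable[OF \<theta>, of h "Suc n"] in \<open>auto simp: lessThan_Suc\<close>)
    also have "\<dots> = (\<integral>\<^sup>+\<xi>. ennreal (exp_functional \<theta> h n (gauss_walk h \<xi>)) \<partial>PiM {..<n} (\<lambda>_. std_gauss))"
    proof (rule nn_integral_cong)
      fix \<xi>
      let ?a = "\<theta> (prefix_max (gauss_walk h \<xi>) n) * sqrt h" and ?c = "exp_functional \<theta> h n (gauss_walk h \<xi>)"
      have "(\<integral>\<^sup>+y. ennreal (exp_functional \<theta> h (Suc n) (gauss_walk h (\<xi>(n := y)))) \<partial>std_gauss)
        = (\<integral>\<^sup>+y. ennreal ?c * ennreal (exp (?a * y - ?a\<^sup>2 / 2)) \<partial>std_gauss)"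
        unfolding step by (simp only: ennreal_mult' exp_functional_def exp_ge_zero)
      also have "\<dots> = ennreal ?c * (\<integral>\<^sup>+y. ennreal (exp (?a * y - ?a\<^sup>2 / 2)) \<partial>std_gauss)"
        by (rule nn_integral_cmult) simp
      finally show "(\<integral>\<^sup>+y. ennreal (exp_functional \<theta> h (Suc n) (gauss_walk h (\<xi>(n := y)))) \<partial>std_gauss) = ennreal ?c"
        by (simp add: std_gauss_exponential_moment)
    qed
    finally show ?case using Suc by simp
  qed
qed

text \<open>Squaring doubles the compensator, whereas doubling the slope quadruples it. The gap is
  \<open>h\<close> times the sum of the squared slopes, at most \<open>C^2\<close> times the elapsed
  time. With the martingale for the slope \<open>2 * \<theta>\<close> this bounds second moments
  uniformly in the mesh.\<close>

lemma exp_functional_second_moment: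
  assumes bound: "\<And>x. \<bar>\<theta> x\<bar> \<le> C" and h: "0 \<le> h"
  shows "(exp_functional \<theta> h n x)\<^sup>2 \<le> exp (C\<^sup>2 * (h * n)) * exp_functional (\<lambda>y. 2 * \<theta> y) h n x"
proof -
  have sq: "(\<theta> y)\<^sup>2 \<le> C\<^sup>2" for y using bound[of y] by (metis abs_ge_zero power2_abs power_mono)
  have "2 * (\<Sum>i<n. \<theta> (prefix_max x i) * (x (Suc i) - x i) - h / 2 * (\<theta> (prefix_max x i))\<^sup>2)
    = (\<Sum>i<n. h * (\<theta> (prefix_max x i))\<^sup>2) + (\<Sum>i<n. (2 * \<theta> (prefix_max x i)) * (x (Suc i) - x i) - h / 2 * (2 * \<theta> (prefix_max x i))\<^sup>2)"
    unfolding sum.distrib[symmetric] sum_distrib_left by (intro sum.cong) (auto simp: algebra_simps power2_eq_square)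
  also have "(\<Sum>i<n. h * (\<theta> (prefix_max x i))\<^sup>2) \<le> (\<Sum>i<n. h * C\<^sup>2)"
    by (intro sum_mono mult_left_mono sq h)
  finally show ?thesis
    unfolding exp_functional_def exp_double[symmetric] mult_exp_exp by (simp add: mult_ac)
qed

text \<open>Every path, not just almost every one, is continuous and starts at 0, and
  \<open>W t\<close> is measurable for negative \<open>t\<close> too. The pathwise lemmas then apply
  to each \<open>\<omega>\<close> without null sets; \<open>continuous_modification\<close> supplies
  such a process.\<close>

locale continuous_brownian_motion = standard_brownian_motion P W
  for P :: "'a measure" and W :: "real \<Rightarrow> 'a \<Rightarrow> real" +
  assumes paths: "\<And>\<omega>. continuous_path (\<lambda>t. W t \<omega>)"
    and measurable_W [measurable]: "\<And>t. W t \<in> borel_measurable P"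
begin

lemma W_0: "W 0 \<omega> = 0"
  using paths[of \<omega>] by (simp add: continuous_path_def)

definition normalised_increments :: "nat \<Rightarrow> real \<Rightarrow> 'a \<Rightarrow> nat \<Rightarrow> real" where
  "normalised_increments n h \<omega> = (\<lambda>i\<in>{..<n}. (W (real (Suc i) * h) \<omega> - W (real i * h) \<omega>) / sqrt h)"

lemma gauss_walk_normalised_increments:
  assumes "0 < h" "j \<le> n"
  shows "gauss_walk h (normalised_increments n h \<omega>) j = W (real j * h) \<omega>"
  using assms(2)
proof (induction j)
  case (Suc j)
  have "gauss_walk h (normalised_increments n h \<omega>) (Suc j)
    = gauss_walk h (normalised_increments n h \<omega>) j + sqrt h * normalised_increments n h \<omega> j"
    by (simp add: gauss_walk_def algebra_simps)
  moreover have "normalised_increments n h \<omega> j = (W (real (Suc j) * h) \<omega> - W (real j * h) \<omega>) / sqrt h"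
    using Suc.prems by (simp add: normalised_increments_def)
  ultimately show ?case using Suc assms(1) by simp
qed (simp add: gauss_walk_def W_0)

text \<open>Increments over disjoint steps are independent, and division by \<open>sqrt h\<close>
  makes each of them standard normal. Positive \<open>n\<close> keeps the index set nonempty for the
  characterisation of independence by product laws.\<close>

lemma normalised_increments_distr:
  assumes h: "0 < h" and n: "0 < n"
  shows "distr P (PiM {..<n} (\<lambda>_. borel)) (normalised_increments n h) = PiM {..<n} (\<lambda>_. std_gauss)"
proof -
  let ?Z = "\<lambda>i \<omega>. (W (real (Suc i) * h) \<omega> - W (real i * h) \<omega>) / sqrt h"
  have "indep_vars (\<lambda>_. borel) (\<lambda>i \<omega>. W (real (Suc i) * h) \<omega> - W (real i * h) \<omega>) {..<n}"
    by (rule indep_increments[of "\<lambda>i. real i * h"]) (use h in \<open>auto intro: mult_right_mono\<close>)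
  then have "indep_vars (\<lambda>_. borel) (\<lambda>i. (\<lambda>x. x / sqrt h) \<circ> (\<lambda>\<omega>. W (real (Suc i) * h) \<omega> - W (real i * h) \<omega>)) {..<n}"
    by (rule indep_vars_compose) auto
  then have "indep_vars (\<lambda>_. borel) ?Z {..<n}" by (simp add: comp_def)
  then have "distr P (PiM {..<n} (\<lambda>_. borel)) (\<lambda>\<omega>. \<lambda>i\<in>{..<n}. ?Z i \<omega>) = PiM {..<n} (\<lambda>i. distr P borel (?Z i))"
    using n by (subst (asm) indep_vars_iff_distr_eq_PiM') auto
  also have "\<dots> = PiM {..<n} (\<lambda>_. std_gauss)"
  proof (rule PiM_cong)
    fix i
    have "distributed P lborel (\<lambda>\<omega>. W (real (Suc i) * h) \<omega> - W (real i * h) \<omega>) (normal_density 0 (sqrt h))"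
      using normal_increments[of "real i * h" "real (Suc i) * h"] h by (simp add: algebra_simps)
    from normal_density_affine[OF this, of "1 / sqrt h" 0]
    have "distributed P lborel (?Z i) std_normal_density" using h by (simp add: divide_inverse mult.commute)
    then have "distr P lborel (?Z i) = std_gauss" by (simp add: distributed_def)
    then show "distr P borel (?Z i) = std_gauss" by (simp cong: distr_cong)
  qed simp
  finally show ?thesis by (simp add: normalised_increments_def[abs_def])
qed

text \<open>The path at the grid points is a function of the normalised increments. This recovers
  its values only up to index \<open>n\<close>, hence the condition that \<open>G\<close> ignores
  later entries.\<close>

lemma grid_expectation:
  fixes G :: "(nat \<Rightarrow> real) \<Rightarrow> ennreal"
  assumes h: "0 < h" and n: "0 < n"
    and G: "(\<lambda>\<xi>. G (gauss_walk h \<xi>)) \<in> borel_measurable (PiM {..<n} (\<lambda>_. std_gauss))"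
    and cong: "\<And>x y. (\<And>j. j \<le> n \<Longrightarrow> x j = y j) \<Longrightarrow> G x = G y"
  shows "(\<integral>\<^sup>+\<omega>. G (\<lambda>j. W (real j * h) \<omega>) \<partial>P) = (\<integral>\<^sup>+\<xi>. G (gauss_walk h \<xi>) \<partial>PiM {..<n} (\<lambda>_. std_gauss))"
proof -
  have "(\<integral>\<^sup>+\<omega>. G (\<lambda>j. W (real j * h) \<omega>) \<partial>P) = (\<integral>\<^sup>+\<omega>. G (gauss_walk h (normalised_increments n h \<omega>)) \<partial>P)"
    by (intro nn_integral_cong cong) (simp add: gauss_walk_normalised_increments h)
  also have "\<dots> = (\<integral>\<^sup>+\<xi>. G (gauss_walk h \<xi>) \<partial>distr P (PiM {..<n} (\<lambda>_. borel)) (normalised_increments n h))"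
  proof (rule nn_integral_distr[symmetric])
    show "normalised_increments n h \<in> measurable P (PiM {..<n} (\<lambda>_. borel))"
      unfolding normalised_increments_def[abs_def] by (rule measurable_restrict) simp
    have "sets (PiM {..<n} (\<lambda>_. borel :: real measure)) = sets (PiM {..<n} (\<lambda>_. std_gauss))"
      by (rule sets_PiM_cong) auto
    then show "(\<lambda>\<xi>. G (gauss_walk h \<xi>)) \<in> borel_measurable (distr P (PiM {..<n} (\<lambda>_. borel)) (normalised_increments n h))"
      using G by (simp cong: measurable_cong_sets)
  qed
  finally show ?thesis by (simp add: normalised_increments_distr h n)
qed

lemma grid_exp_functional:
  assumes "\<theta> \<in> borel_measurable borel" "0 < h" "0 < n"
  shows "(\<integral>\<^sup>+\<omega>. ennreal (exp_functional \<theta> h n (\<lambda>j. W (real j * h) \<omega>)) \<partial>P) = 1"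
proof -
  have "(\<integral>\<^sup>+\<omega>. ennreal (exp_functional \<theta> h n (\<lambda>j. W (real j * h) \<omega>)) \<partial>P)
    = (\<integral>\<^sup>+\<xi>. ennreal (exp_functional \<theta> h n (gauss_walk h \<xi>)) \<partial>PiM {..<n} (\<lambda>_. std_gauss))"
  proof (rule grid_expectation[OF assms(2,3)])
    show "(\<lambda>\<xi>. ennreal (exp_functional \<theta> h n (gauss_walk h \<xi>))) \<in> borel_measurable (PiM {..<n} (\<lambda>_. std_gauss))"
      using exp_functional_measurable[OF assms(1)] by simp
    show "ennreal (exp_functional \<theta> h n x) = ennreal (exp_functional \<theta> h n y)"
      if "\<And>j. j \<le> n \<Longrightarrow> x j = y j" for x y
      using that by (metis exp_functional_cong)
  qed
  with exp_functional_martingale[OF assms(1), of h n] assms(2) show ?thesis by simp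
qed

text \<open>By uniform continuity of each path, the supremum over uncountably many times is a limit
  of maxima over finite grids.\<close>

lemma smax_measurable: "(\<lambda>\<omega>. smax (\<lambda>t. W t \<omega>) T) \<in> borel_measurable P"
proof (cases "0 < T")
  case True
  show ?thesis
  proof (rule borel_measurable_LIMSEQ_real)
    fix \<omega> assume "\<omega> \<in> space P"
    interpret continuous_path "\<lambda>t. W t \<omega>" by (rule paths)
    show "(\<lambda>n. prefix_max (\<lambda>j. W (real j * (T / real n)) \<omega>) n) \<longlonglongrightarrow> smax (\<lambda>t. W t \<omega>) T"
    proof (rule tendstoI)
      fix e :: real assume "0 < e"
      then have e: "0 < e / 2" by simp
      have "\<forall>\<^sub>F n::nat in sequentially. n > 0" by (rule eventually_gt_at_top)
      with oscillation[OF e True]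
      show "\<forall>\<^sub>F n in sequentially. dist (prefix_max (\<lambda>j. W (real j * (T / real n)) \<omega>) n) (smax (\<lambda>t. W t \<omega>) T) < e"
      proof eventually_elim
        case (elim n)
        have "smax (\<lambda>t. W t \<omega>) T \<le> prefix_max (\<lambda>j. W (real j * (T / real n)) \<omega>) n + e / 2"
          by (rule smax_le_prefix_max[of "T / real n" T]) (use elim True in \<open>auto simp: field_simps\<close>)
        moreover have "prefix_max (\<lambda>j. W (real j * (T / real n)) \<omega>) n \<le> smax (\<lambda>t. W t \<omega>) T"
          using prefix_max_le_smax[of "T / real n" n] elim True by simp
        ultimately show ?case using \<open>0 < e\<close> by (simp add: dist_real_def)
      qed
    qed
  qed measurable
next
  case False
  then show ?thesis using continuous_path.smax_nonpos[OF paths] by simp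
qed

lemma area_measurable: "(\<lambda>\<omega>. area (\<lambda>t. W t \<omega>) T) \<in> borel_measurable P"
proof (cases "0 < T")
  case True
  show ?thesis
  proof (rule borel_measurable_LIMSEQ_real)
    fix \<omega> assume "\<omega> \<in> space P"
    interpret continuous_path "\<lambda>t. W t \<omega>" by (rule paths)
    show "(\<lambda>n. (\<Sum>i<n. prefix_max (\<lambda>j. W (real j * (T / real n)) \<omega>) i) * (T / real n)) \<longlonglongrightarrow> area (\<lambda>t. W t \<omega>) T"
      using riemann_sum_prefix_max[of "\<lambda>x. x" 1, OF _ True] True by (simp add: integral_smax_0)
  qed measurable
next
  case False
  have "area (\<lambda>t. W t \<omega>) T = 0" for \<omega>
    using continuous_path.area_mono[OF paths, of T 0 \<omega>] continuous_path.area_nonneg[OF paths, of \<omega> T]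
      continuous_path.area_0[OF paths, of \<omega>] False by linarith
  then show ?thesis by simp
qed

text \<open>The identity is exact on every grid and passes to the limit, because the grid functionals are
  bounded in \<open>L\<^sup>2\<close>.  By summation by parts the stochastic integral of \<open>\<theta> (S t)\<close> is
  a function of the path.\<close>

lemma exponential_martingale:
  assumes \<theta>: "\<And>x y. \<bar>\<theta> x - \<theta> y\<bar> \<le> L * \<bar>x - y\<bar>" and bound: "\<And>x. \<bar>\<theta> x\<bar> \<le> C" and T: "0 < T"
    and U: "\<And>\<omega>. U \<omega> = exp (integral {0..smax (\<lambda>t. W t \<omega>) T} \<theta>
       - \<theta> (smax (\<lambda>t. W t \<omega>) T) * (smax (\<lambda>t. W t \<omega>) T - W T \<omega>)
       - integral {0..T} (\<lambda>u. (\<theta> (smax (\<lambda>t. W t \<omega>) u))\<^sup>2) / 2)"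
    and D: "\<And>\<omega>. U \<omega> \<le> D"
  shows "U \<in> borel_measurable P" "expectation U = 1"
proof -
  have [measurable]: "\<theta> \<in> borel_measurable borel"
    using \<theta> by (intro borel_measurable_continuous_onI lipschitz_continuous_on)
  have L: "0 \<le> L" using \<theta>[of 0 1] by simp
  have C: "0 \<le> C" using bound[of 0] by simp
  define Y where "Y = (\<lambda>n \<omega>. exp_functional \<theta> (T / real n) n (\<lambda>j. W (real j * (T / real n)) \<omega>))"
  have Y_pos: "0 \<le> Y n \<omega>" for n \<omega> by (simp add: Y_def exp_functional_def)
  have U_pos: "0 \<le> U \<omega>" for \<omega> by (simp add: U)
  have Y_meas [measurable]: "Y n \<in> borel_measurable P" for n
    unfolding Y_def exp_functional_def by measurable
  have lim: "(\<lambda>n. Y n \<omega>) \<longlonglongrightarrow> U \<omega>" for \<omega>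
  proof -
    interpret continuous_path "\<lambda>t. W t \<omega>" by (rule paths)
    have sq: "\<bar>(\<theta> x)\<^sup>2 - (\<theta> y)\<^sup>2\<bar> \<le> 2 * C * L * \<bar>x - y\<bar>" for x y
    proof -
      have "\<bar>(\<theta> x)\<^sup>2 - (\<theta> y)\<^sup>2\<bar> = \<bar>\<theta> x + \<theta> y\<bar> * \<bar>\<theta> x - \<theta> y\<bar>"
        by (simp add: power2_eq_square abs_mult[symmetric] algebra_simps)
      also have "\<dots> \<le> (2 * C) * (L * \<bar>x - y\<bar>)"
        using bound[of x] bound[of y] \<theta>[of x y] C by (intro mult_mono) auto
      finally show ?thesis by (simp add: mult_ac)
    qed
    have "(\<lambda>n. exp ((\<Sum>i<n. \<theta> (prefix_max (\<lambda>j. W (real j * (T / real n)) \<omega>) i)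
        * (W (real (Suc i) * (T / real n)) \<omega> - W (real i * (T / real n)) \<omega>))
        - (\<Sum>i<n. (\<theta> (prefix_max (\<lambda>j. W (real j * (T / real n)) \<omega>) i))\<^sup>2) * (T / real n) / 2)) \<longlonglongrightarrow> U \<omega>"
      unfolding U
      by (intro tendsto_intros stochastic_sum_limit[OF \<theta> T bound] riemann_sum_prefix_max[OF sq T]) auto
    moreover have "(\<Sum>i<n. f i) * (T / real n) / 2 = (\<Sum>i<n. T / real n / 2 * f i)" for n :: nat and f :: "nat \<Rightarrow> real"
      unfolding sum_distrib_left[symmetric] by simp
    ultimately show ?thesis
      by (simp only: Y_def exp_functional_def sum_subtractf)
  qed
  show U_meas [measurable]: "U \<in> borel_measurable P"
    using lim by (rule borel_measurable_LIMSEQ_real) measurable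
  have EY: "(\<integral>\<^sup>+\<omega>. ennreal (Y n \<omega>) \<partial>P) = 1" if "n > 0" for n
  proof -
    have h: "0 < T / real n" using that T by simp
    show ?thesis unfolding Y_def by (rule grid_exp_functional[OF _ h that]) simp
  qed
  \<comment> \<open>The bound does not depend on \<open>n\<close>, because the mesh times the number
    of steps is always \<open>T\<close>.\<close>
  have EY2: "(\<integral>\<^sup>+\<omega>. ennreal ((Y n \<omega>)\<^sup>2) \<partial>P) \<le> ennreal (exp (C\<^sup>2 * T))" if "n > 0" for n
  proof -
    have h: "0 < T / real n" using that T by simp
    have "(\<integral>\<^sup>+\<omega>. ennreal ((Y n \<omega>)\<^sup>2) \<partial>P)
      \<le> (\<integral>\<^sup>+\<omega>. ennreal (exp (C\<^sup>2 * T)) * ennreal (exp_functional (\<lambda>y. 2 * \<theta> y) (T / real n) n (\<lambda>j. W (real j * (T / real n)) \<omega>)) \<partial>P)"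
      using exp_functional_second_moment[where h="T / real n" and n=n and \<theta>=\<theta> and C=C] bound h that
      by (intro nn_integral_mono) (auto simp: Y_def ennreal_mult'[symmetric] intro!: ennreal_leI)
    also have "\<dots> = ennreal (exp (C\<^sup>2 * T)) * (\<integral>\<^sup>+\<omega>. ennreal (exp_functional (\<lambda>y. 2 * \<theta> y) (T / real n) n (\<lambda>j. W (real j * (T / real n)) \<omega>)) \<partial>P)"
      by (rule nn_integral_cmult) (unfold exp_functional_def, measurable)
    also have "(\<integral>\<^sup>+\<omega>. ennreal (exp_functional (\<lambda>y. 2 * \<theta> y) (T / real n) n (\<lambda>j. W (real j * (T / real n)) \<omega>)) \<partial>P) = 1"
      by (rule grid_exp_functional[OF _ h that]) simp
    finally show ?thesis by simp
  qed
  have Y_int: "integrable P (Y n)" and Y2_int: "integrable P (\<lambda>\<omega>. (Y n \<omega>)\<^sup>2)" 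
    and Y_exp: "expectation (Y n) = 1" and Y2_exp: "expectation (\<lambda>\<omega>. (Y n \<omega>)\<^sup>2) \<le> exp (C\<^sup>2 * T)" if "n > 0" for n
  proof -
    show "integrable P (Y n)" using EY[OF that] Y_pos by (intro integrableI_nonneg) auto
    show "expectation (Y n) = 1" using EY[OF that] Y_pos by (simp add: integral_eq_nn_integral)
    show "integrable P (\<lambda>\<omega>. (Y n \<omega>)\<^sup>2)"
      using EY2[OF that] by (intro integrableI_nonneg) (auto intro: le_less_trans)
    show "expectation (\<lambda>\<omega>. (Y n \<omega>)\<^sup>2) \<le> exp (C\<^sup>2 * T)"
      using EY2[OF that] by (simp add: integral_eq_nn_integral enn2real_leI)
  qed
  \<comment> \<open>Truncation at \<open>R \<ge> D\<close> leaves the limit \<open>U\<close>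
    unchanged but makes the grid functionals bounded, so that their expectations converge. The part
    cut off costs at most the second moment divided by \<open>R\<close>, uniformly in
    \<open>n\<close>.\<close>
  have key: "\<bar>expectation U - 1\<bar> \<le> exp (C\<^sup>2 * T) / R" if R: "R > 0" "R \<ge> D" for R
  proof -
    have "(\<lambda>n. expectation (\<lambda>\<omega>. min (Y n \<omega>) R)) \<longlonglongrightarrow> expectation (\<lambda>\<omega>. min (U \<omega>) R)"
      by (rule integral_dominated_convergence[where w="\<lambda>_. R"])
        (use lim Y_pos R in \<open>auto intro!: tendsto_min\<close>)
    moreover have "(\<lambda>\<omega>. min (U \<omega>) R) = U" using D R by (intro ext min_absorb1) (rule order_trans)
    ultimately have conv: "(\<lambda>n. expectation (\<lambda>\<omega>. min (Y n \<omega>) R)) \<longlonglongrightarrow> expectation U" by simp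
    have "\<bar>expectation (\<lambda>\<omega>. min (Y n \<omega>) R) - 1\<bar> \<le> exp (C\<^sup>2 * T) / R" if n: "n > 0" for n
    proof -
      have mi: "integrable P (\<lambda>\<omega>. min (Y n \<omega>) R)"
        using Y_int[OF n] by (rule Bochner_Integration.integrable_bound) (use Y_pos R in auto)
      have le: "y - min y R \<le> y\<^sup>2 / R" if "0 \<le> y" for y :: real
      proof (cases "y \<le> R")
        case False
        then have "y * R \<le> y * y" using that by (intro mult_left_mono) auto
        then have "y \<le> y\<^sup>2 / R" using R by (simp add: field_simps power2_eq_square)
        then show ?thesis using False R by simp
      qed (use R in simp)
      have "1 - expectation (\<lambda>\<omega>. min (Y n \<omega>) R) = expectation (\<lambda>\<omega>. Y n \<omega> - min (Y n \<omega>) R)"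
        using Y_int[OF n] mi Y_exp[OF n] by simp
      also have "\<dots> \<le> expectation (\<lambda>\<omega>. (Y n \<omega>)\<^sup>2 / R)"
        using Y_int[OF n] mi Y2_int[OF n] le Y_pos by (intro integral_mono) auto
      also have "\<dots> \<le> exp (C\<^sup>2 * T) / R" using Y2_exp[OF n] R by (simp add: divide_right_mono)
      finally have "1 - expectation (\<lambda>\<omega>. min (Y n \<omega>) R) \<le> exp (C\<^sup>2 * T) / R" .
      moreover have "expectation (\<lambda>\<omega>. min (Y n \<omega>) R) \<le> expectation (Y n)"
        using Y_int[OF n] mi by (intro integral_mono) auto
      moreover have "0 \<le> exp (C\<^sup>2 * T) / R" using R by simp
      ultimately show ?thesis using Y_exp[OF n] by linarith
    qed
    then show ?thesis
      by (intro tendsto_upperbound[OF tendsto_rabs[OF tendsto_diff[OF conv tendsto_const]]])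
        (auto intro: eventually_sequentiallyI[of 1])
  qed
  have "\<bar>expectation U - 1\<bar> \<le> 0"
  proof (rule tendsto_lowerbound)
    show "((\<lambda>R. exp (C\<^sup>2 * T) / R) \<longlongrightarrow> 0) at_top" by real_asymp
    show "\<forall>\<^sub>F R in at_top. \<bar>expectation U - 1\<bar> \<le> exp (C\<^sup>2 * T) / R"
      using eventually_ge_at_top[of "max 1 D"] by eventually_elim (rule key; simp)
  qed simp
  then show "expectation U = 1" by simp
qed

end

text \<open>Rounding the time down to the grid of mesh \<open>1 / n\<close> leaves countably many
  times, for which measurability of each \<open>f t\<close> suffices; continuity in time gives the
  limit. Fubini's theorem over time and probability needs this joint measurability.\<close>

lemma borel_measurable_caratheodory:
  fixes f :: "real \<Rightarrow> 'a \<Rightarrow> real"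
  assumes cont: "\<And>\<omega>. \<omega> \<in> space M \<Longrightarrow> continuous_on UNIV (\<lambda>t. f t \<omega>)"
    and meas: "\<And>t. f t \<in> borel_measurable M"
  shows "(\<lambda>(t, \<omega>). f t \<omega>) \<in> borel_measurable (borel \<Otimes>\<^sub>M M)"
proof (rule borel_measurable_LIMSEQ_real)
  show "(\<lambda>z. f (real_of_int \<lfloor>fst z * real n\<rfloor> / real n) (snd z)) \<in> borel_measurable (borel \<Otimes>\<^sub>M M)" for n
    by (rule measurable_compose_countable[where g="\<lambda>z. \<lfloor>fst z * real n\<rfloor>" and f="\<lambda>i z. f (real_of_int i / real n) (snd z)"])
      (use meas in measurable)
next
  fix z :: "real \<times> 'a" assume "z \<in> space (borel \<Otimes>\<^sub>M M)"
  then obtain t \<omega> where z: "z = (t, \<omega>)" "\<omega> \<in> space M" by (auto simp: space_pair_measure)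
  have "(\<lambda>n. real_of_int \<lfloor>t * real n\<rfloor> / real n) \<longlonglongrightarrow> t" by real_asymp
  then have "(\<lambda>n. f (real_of_int \<lfloor>t * real n\<rfloor> / real n) \<omega>) \<longlonglongrightarrow> f t \<omega>"
    by (rule continuous_on_tendsto_compose[OF cont[OF z(2)]]) auto
  then show "(\<lambda>n. f (real_of_int \<lfloor>fst z * real n\<rfloor> / real n) (snd z)) \<longlonglongrightarrow> (case z of (t, \<omega>) \<Rightarrow> f t \<omega>)"
    by (simp add: z)
qed

section \<open>Brownian scaling of the area\<close>

context continuous_brownian_motion
begin

text \<open>With \<open>n\<close> steps the Riemann sum for time \<open>T\<close> is
  \<open>(T / n) powr (3/2)\<close> times one and the same functional of \<open>n\<close> standard
  normal variables. Hence \<open>x powr (3/2)\<close> times the sum for time 1 has the law of the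
  sum for time \<open>x\<close>.\<close>

lemma area_scaling:
  assumes x: "0 < x"
  shows "expectation (\<lambda>\<omega>. exp (- (x powr (3/2)) * area (\<lambda>t. W t \<omega>) 1))
       = expectation (\<lambda>\<omega>. exp (- area (\<lambda>t. W t \<omega>) x))"
proof -
  define R where "R = (\<lambda>T n \<omega>. (\<Sum>i<n. prefix_max (\<lambda>j. W (real j * (T / real n)) \<omega>) i) * (T / real n))"
  have [measurable]: "R T n \<in> borel_measurable P" for T n unfolding R_def by measurable
  have [measurable]: "(\<lambda>\<omega>. area (\<lambda>t. W t \<omega>) T) \<in> borel_measurable P" for T by (rule area_measurable)
  have R_lim: "(\<lambda>n. R T n \<omega>) \<longlonglongrightarrow> area (\<lambda>t. W t \<omega>) T" if "0 < T" for T \<omega>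
  proof -
    interpret continuous_path "\<lambda>t. W t \<omega>" by (rule paths)
    show ?thesis unfolding R_def
      using riemann_sum_prefix_max[of "\<lambda>x. x" 1, OF _ that] that by (simp add: integral_smax_0)
  qed
  have R_pos: "0 \<le> R T n \<omega>" if "0 < T" for T n \<omega>
  proof -
    have "0 \<le> prefix_max (\<lambda>j. W (real j * (T / real n)) \<omega>) i" for i
      using prefix_max_ge[of 0 i "\<lambda>j. W (real j * (T / real n)) \<omega>"] W_0 by simp
    then show ?thesis using that unfolding R_def by (intro mult_nonneg_nonneg sum_nonneg) auto
  qed
  have lim: "(\<lambda>n. expectation (\<lambda>\<omega>. exp (- c * R T n \<omega>))) \<longlonglongrightarrow> expectation (\<lambda>\<omega>. exp (- c * area (\<lambda>t. W t \<omega>) T))"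
    if "0 < T" "0 < c" for T c
    by (rule integral_dominated_convergence[where w="\<lambda>_. 1"])
      (use that R_pos R_lim in \<open>auto intro!: tendsto_intros\<close>)
  have nn: "(\<integral>\<^sup>+\<omega>. ennreal (exp (- c * R T n \<omega>)) \<partial>P)
    = (\<integral>\<^sup>+\<xi>. ennreal (exp (- (c * (sqrt (T / real n) * (T / real n))) * (\<Sum>i<n. prefix_max (\<lambda>j. \<Sum>k<j. \<xi> k) i))) \<partial>PiM {..<n} (\<lambda>_. std_gauss))"
    if "0 < T" "0 < n" for T c n
  proof -
    have h: "0 < T / real n" using that by simp
    have "(\<integral>\<^sup>+\<omega>. ennreal (exp (- c * R T n \<omega>)) \<partial>P)
      = (\<integral>\<^sup>+\<xi>. ennreal (exp (- c * ((\<Sum>i<n. prefix_max (gauss_walk (T / real n) \<xi>) i) * (T / real n)))) \<partial>PiM {..<n} (\<lambda>_. std_gauss))"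
      unfolding R_def
    proof (rule grid_expectation[OF h that(2)])
      have [measurable]: "(\<lambda>\<xi>. prefix_max (gauss_walk (T / real n) \<xi>) i) \<in> borel_measurable (PiM {..<n} (\<lambda>_. std_gauss))"
        if "i < n" for i using that by (intro gauss_walk_prefix_max_measurable) simp
      have "(\<lambda>\<xi>. \<Sum>i<n. prefix_max (gauss_walk (T / real n) \<xi>) i) \<in> borel_measurable (PiM {..<n} (\<lambda>_. std_gauss))"
        by (intro borel_measurable_sum) simp
      then show "(\<lambda>\<xi>. ennreal (exp (- c * ((\<Sum>i<n. prefix_max (gauss_walk (T / real n) \<xi>) i) * (T / real n)))))
        \<in> borel_measurable (PiM {..<n} (\<lambda>_. std_gauss))" by measurable
      show "ennreal (exp (- c * ((\<Sum>i<n. prefix_max x i) * (T / real n)))) = ennreal (exp (- c * ((\<Sum>i<n. prefix_max y i) * (T / real n))))"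
        if "\<And>j. j \<le> n \<Longrightarrow> x j = y j" for x y
      proof -
        have "prefix_max x i = prefix_max y i" if "i < n" for i
          using that \<open>\<And>j. j \<le> n \<Longrightarrow> x j = y j\<close> by (intro prefix_max_cong) auto
        then show ?thesis by simp
      qed
    qed
    moreover have "prefix_max (gauss_walk (T / real n) \<xi>) i = sqrt (T / real n) * prefix_max (\<lambda>j. \<Sum>k<j. \<xi> k) i" for \<xi> i
      using h unfolding gauss_walk_def[abs_def] by (intro prefix_max_scale) simp
    ultimately show ?thesis by (simp add: sum_distrib_left[symmetric] mult_ac)
  qed
  have eq: "expectation (\<lambda>\<omega>. exp (- (x powr (3/2)) * R 1 n \<omega>)) = expectation (\<lambda>\<omega>. exp (- 1 * R x n \<omega>))" if "0 < n" for n
  proof -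
    have "x powr (3/2) = x powr (1 + 1/2)" by simp
    also have "\<dots> = x * sqrt x" using x unfolding powr_add by (simp add: powr_half_sqrt)
    finally have "x powr (3/2) * (sqrt (1 / real n) * (1 / real n)) = 1 * (sqrt (x / real n) * (x / real n))"
      by (simp add: real_sqrt_divide)
    then have "(\<integral>\<^sup>+\<omega>. ennreal (exp (- (x powr (3/2)) * R 1 n \<omega>)) \<partial>P) = (\<integral>\<^sup>+\<omega>. ennreal (exp (- 1 * R x n \<omega>)) \<partial>P)"
      using nn[of 1 n "x powr (3/2)"] nn[of x n 1] that x by (simp only: zero_less_one)
    then show ?thesis by (simp add: integral_eq_nn_integral)
  qed
  have "(\<lambda>n. expectation (\<lambda>\<omega>. exp (- 1 * R x n \<omega>))) \<longlonglongrightarrow> expectation (\<lambda>\<omega>. exp (- (x powr (3/2)) * area (\<lambda>t. W t \<omega>) 1))"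
    by (rule Lim_transform_eventually[OF lim[OF zero_less_one, of "x powr (3/2)"]])
      (use x eq in \<open>auto intro: eventually_sequentiallyI[of 1]\<close>)
  from LIMSEQ_unique[OF this lim[OF x zero_less_one]] show ?thesis by simp
qed

end

section \<open>Killing at the hitting time of a level\<close>

text \<open>With \<open>\<theta> m = sqrt (2 * (l + m))\<close> the compensator of the martingale is \<open>l * t + area w t\<close>.
  The slope has to vanish above the level \<open>a\<close> to stop the martingale there, so it is approximated
  from below by Lipschitz functions.\<close>

definition killed_slope :: "real \<Rightarrow> real \<Rightarrow> real" where
  "killed_slope l m = sqrt (2 * (l + max 0 m))"

definition cut_slope :: "real \<Rightarrow> real \<Rightarrow> real \<Rightarrow> real" where
  "cut_slope l a m = (if m < a then killed_slope l m else 0)"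

text \<open>The line \<open>real k * (a - m)\<close> vanishes at \<open>a\<close>, and for fixed
  \<open>m < a\<close> it lies above the slope once \<open>k\<close> is large. It smooths the jump
  of \<open>cut_slope\<close> at \<open>a\<close>, which would exclude that function from
  \<open>exponential_martingale\<close>.\<close>

definition lipschitz_slope :: "real \<Rightarrow> real \<Rightarrow> nat \<Rightarrow> real \<Rightarrow> real" where
  "lipschitz_slope l a k m = max 0 (min (killed_slope l m) (real k * (a - m)))"

text \<open>The squares of the two roots differ by at most \<open>2 * \<bar>x - y\<bar>\<close>, and
  the roots add up to at least \<open>2 * sqrt (2 * l)\<close>: positive \<open>l\<close> keeps the
  argument away from the singularity of the root.\<close>

lemma killed_slope_lipschitz:
  assumes "0 < l"
  shows "\<bar>killed_slope l x - killed_slope l y\<bar> \<le> 1 / sqrt (2 * l) * \<bar>x - y\<bar>"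
proof -
  define p q r where "p = sqrt (2 * (l + max 0 x))" and "q = sqrt (2 * (l + max 0 y))" and "r = sqrt (2 * l)"
  have pq: "r \<le> p" "r \<le> q" "0 < r" using assms by (simp_all add: p_def q_def r_def)
  have "p\<^sup>2 - q\<^sup>2 = 2 * (max 0 x - max 0 y)" using assms by (simp add: p_def q_def)
  then have "(p - q) * (p + q) = 2 * (max 0 x - max 0 y)" by (simp add: power2_eq_square algebra_simps)
  then have "\<bar>p - q\<bar> * \<bar>p + q\<bar> = 2 * \<bar>max 0 x - max 0 y\<bar>" by (metis abs_mult abs_numeral)
  moreover have "\<bar>p - q\<bar> * (2 * r) \<le> \<bar>p - q\<bar> * \<bar>p + q\<bar>"
    using pq by (intro mult_left_mono) auto
  moreover have "\<bar>max 0 x - max 0 y\<bar> \<le> \<bar>x - y\<bar>" by linarith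
  ultimately have "\<bar>p - q\<bar> * r \<le> \<bar>x - y\<bar>" by linarith
  then show ?thesis using pq unfolding killed_slope_def p_def[symmetric] q_def[symmetric] r_def[symmetric]
    by (simp add: field_simps)
qed

lemma lipschitz_slope_lipschitz:
  assumes "0 < l"
  shows "\<bar>lipschitz_slope l a k x - lipschitz_slope l a k y\<bar> \<le> (1 / sqrt (2 * l) + real k) * \<bar>x - y\<bar>"
proof -
  have "\<bar>lipschitz_slope l a k x - lipschitz_slope l a k y\<bar>
    \<le> \<bar>killed_slope l x - killed_slope l y\<bar> + \<bar>real k * (a - x) - real k * (a - y)\<bar>"
    unfolding lipschitz_slope_def by (auto simp: max_def min_def abs_if)
  also have "\<bar>real k * (a - x) - real k * (a - y)\<bar> = real k * \<bar>x - y\<bar>"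
    by (simp add: right_diff_distrib[symmetric] abs_mult abs_minus_commute)
  finally show ?thesis using killed_slope_lipschitz[OF assms, of x y] by (simp add: algebra_simps)
qed

lemma killed_slope_mono: "x \<le> y \<Longrightarrow> killed_slope l x \<le> killed_slope l y"
  by (simp add: killed_slope_def)

lemma lipschitz_slope_bound:
  assumes "0 < l" shows "0 \<le> lipschitz_slope l a k m" "lipschitz_slope l a k m \<le> killed_slope l a"
proof -
  have "0 \<le> killed_slope l a" using assms by (simp add: killed_slope_def)
  moreover have "real k * (a - m) \<le> 0" if "a \<le> m" using that by (simp add: mult_nonneg_nonpos)
  ultimately show "lipschitz_slope l a k m \<le> killed_slope l a"
    using killed_slope_mono[of m a l] by (cases "a \<le> m") (auto simp: lipschitz_slope_def min_def)
qed (simp add: lipschitz_slope_def)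

lemma lipschitz_slope_above: "a \<le> m \<Longrightarrow> lipschitz_slope l a k m = 0"
  using mult_nonneg_nonpos[of "real k" "a - m"] unfolding lipschitz_slope_def by linarith

lemma lipschitz_slope_limit:
  assumes "0 < l" shows "(\<lambda>k. lipschitz_slope l a k m) \<longlonglongrightarrow> cut_slope l a m"
proof (cases "m < a")
  case True
  have "0 \<le> killed_slope l m" using assms by (simp add: killed_slope_def)
  obtain K :: nat where K: "killed_slope l m < real K * (a - m)"
    using True by (metis diff_gt_0_iff_gt reals_Archimedean3)
  have "lipschitz_slope l a k m = killed_slope l m" if "K \<le> k" for k
  proof -
    have "real K * (a - m) \<le> real k * (a - m)" using that True by (intro mult_right_mono) auto
    then show ?thesis using K \<open>0 \<le> killed_slope l m\<close> by (simp add: lipschitz_slope_def)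
  qed
  then have "\<forall>\<^sub>F k in sequentially. lipschitz_slope l a k m = cut_slope l a m"
    using True by (auto intro: eventually_sequentiallyI[of K] simp: cut_slope_def)
  then show ?thesis by (rule tendsto_eventually)
qed (simp add: lipschitz_slope_above cut_slope_def)


lemma cut_slope_nonneg: "0 < l \<Longrightarrow> 0 \<le> cut_slope l a m"
  by (simp add: cut_slope_def killed_slope_def)

lemma integral_tendsto_bounded:
  fixes f :: "nat \<Rightarrow> real \<Rightarrow> real"
  assumes "\<And>k. continuous_on {a..b} (f k)" "\<And>k x. \<bar>f k x\<bar> \<le> C" "\<And>x. (\<lambda>k. f k x) \<longlonglongrightarrow> g x"
  shows "(\<lambda>k. integral {a..b} (f k)) \<longlonglongrightarrow> integral {a..b} g"
proof -
  have 1: "f k integrable_on {a..b}" for k by (intro integrable_continuous_real assms)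
  have 2: "(\<lambda>x. C) integrable_on {a..b}" by (rule integrable_const_ivl)
  have 3: "norm (f k x) \<le> C" for k x using assms(2) by simp
  show ?thesis by (rule dominated_convergence(2)[OF 1 2 3 assms(3)])
qed

lemma integral_cut_at_hitting:
  fixes f g :: "real \<Rightarrow> real"
  assumes "0 \<le> \<tau>" "\<tau> \<le> T" "\<And>t. 0 \<le> t \<Longrightarrow> t < \<tau> \<Longrightarrow> g t = f t" "\<And>t. \<tau> < t \<Longrightarrow> g t = 0"
  shows "integral {0..T} g = integral {0..\<tau>} f"
proof -
  \<comment> \<open>Nothing is assumed about \<open>g\<close> at \<open>\<tau>\<close> itself; a
    single point does not affect the integral.\<close>
  have "integral {0..T} g = integral {0..T} (\<lambda>t. if t \<in> {0..\<tau>} then f t else 0)"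
    by (rule integral_spike[of "{\<tau>}"]) (use assms in auto)
  also have "\<dots> = integral ({0..\<tau>} \<inter> {0..T}) f"
    by (rule integral_restrict_Int)
  also have "{0..\<tau>} \<inter> {0..T} = {0..\<tau>}" using assms by auto
  finally show ?thesis .
qed

definition killed_exponent :: "real \<Rightarrow> real \<Rightarrow> real" where
  "killed_exponent l a = integral {0..a} (killed_slope l)"

text \<open>The integral equals \<open>exp (- (l * \<tau>) - area w \<tau>)\<close> if \<open>\<tau>\<close> is the hitting time of \<open>a\<close>,
  and \<open>0\<close> if \<open>a\<close> is not reached.\<close>

definition hitting_weight :: "real \<Rightarrow> real \<Rightarrow> (real \<Rightarrow> real) \<Rightarrow> ennreal" where
  "hitting_weight l a w = (\<integral>\<^sup>+t. ennreal ((l + smax w t) * exp (- (l * t) - area w t))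
     * indicator {0..} t * indicator {t. a \<le> smax w t} t \<partial>lborel)"

lemma (in continuous_path) hitting_weight_eq:
  assumes "0 < l" "0 < \<tau>" "\<And>t. a \<le> smax w t \<longleftrightarrow> \<tau> \<le> t"
  shows "hitting_weight l a w = ennreal (exp (- (l * \<tau>) - area w \<tau>))"
proof -
  have "hitting_weight l a w = (\<integral>\<^sup>+t. ennreal ((l + smax w t) * exp (- (l * t) - area w t)) * indicator {\<tau>..} t \<partial>lborel)"
    unfolding hitting_weight_def using assms by (intro nn_integral_cong) (auto simp: indicator_def)
  also have "\<dots> = ennreal (exp (- (l * \<tau>) - area w \<tau>))"
    using assms by (intro killed_hitting_integral) auto
  finally show ?thesis .
qed

lemma (in continuous_path) hitting_weight_eq_0:
  assumes "\<And>t. 0 \<le> t \<Longrightarrow> smax w t < a"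
  shows "hitting_weight l a w = 0"
proof -
  have "hitting_weight l a w = (\<integral>\<^sup>+t. 0 \<partial>(lborel :: real measure))"
    unfolding hitting_weight_def
    by (intro nn_integral_cong) (auto simp: indicator_def, metis assms not_le)
  then show ?thesis by simp
qed

context continuous_path
begin

lemma integral_cut_slope_above:
  assumes "0 \<le> a" "a \<le> s" shows "integral {0..s} (cut_slope l a) = killed_exponent l a"
  unfolding killed_exponent_def using assms
  by (intro integral_cut_at_hitting) (auto simp: cut_slope_def)

lemma integral_cut_slope_square:
  assumes l: "0 < l" and "0 \<le> \<tau>" "\<tau> \<le> T" and hit: "\<And>t. 0 \<le> t \<Longrightarrow> t < \<tau> \<Longrightarrow> smax w t < a" "\<And>t. \<tau> < t \<Longrightarrow> t \<le> T \<Longrightarrow> a \<le> smax w t"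
  shows "integral {0..T} (\<lambda>u. (cut_slope l a (smax w u))\<^sup>2) = 2 * (l * \<tau> + area w \<tau>)"
proof -
  have "integral {0..T} (\<lambda>u. (cut_slope l a (smax w u))\<^sup>2)
     = integral {0..T} (\<lambda>u. if u \<le> T then (cut_slope l a (smax w u))\<^sup>2 else 0)"
    by (rule integral_cong) auto
  also have "\<dots> = integral {0..\<tau>} (\<lambda>u. 2 * (l + smax w u))"
  proof (rule integral_cut_at_hitting)
    show "(if t \<le> T then (cut_slope l a (smax w t))\<^sup>2 else 0) = 2 * (l + smax w t)" if "0 \<le> t" "t < \<tau>" for t
      using that hit(1)[of t] assms smax_nonneg[of t] by (auto simp: cut_slope_def killed_slope_def max_def)
    show "(if t \<le> T then (cut_slope l a (smax w t))\<^sup>2 else 0) = 0" if "\<tau> < t" for t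
      using that hit(2)[of t] by (auto simp: cut_slope_def)
  qed (use assms in auto)
  also have "\<dots> = integral {0..\<tau>} (\<lambda>u. 2 * l) + integral {0..\<tau>} (\<lambda>u. 2 * smax w u)"
    unfolding distrib_left
    by (intro Henstock_Kurzweil_Integration.integral_add integrable_continuous_real continuous_intros smax_continuous)
  also have "\<dots> = 2 * (l * \<tau> + area w \<tau>)"
    using assms integral_smax_0[of \<tau>] by simp
  finally show ?thesis .
qed

end

context continuous_brownian_motion
begin

text \<open>Once the maximum has reached \<open>a\<close>, the slope is 0 and the exponent stays
  constant, so this is the value at time \<open>T\<close> of the exponential martingale stopped at
  the hitting time of \<open>a\<close>.\<close>

definition killed_martingale :: "real \<Rightarrow> real \<Rightarrow> real \<Rightarrow> 'a \<Rightarrow> real" where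
  "killed_martingale l a T \<omega> = exp (integral {0..smax (\<lambda>t. W t \<omega>) T} (cut_slope l a)
       - cut_slope l a (smax (\<lambda>t. W t \<omega>) T) * (smax (\<lambda>t. W t \<omega>) T - W T \<omega>)
       - integral {0..T} (\<lambda>u. (cut_slope l a (smax (\<lambda>t. W t \<omega>) u))\<^sup>2) / 2)"

lemma killed_martingale_nonneg: "0 \<le> killed_martingale l a T \<omega>"
  by (simp add: killed_martingale_def)

text \<open>The Lipschitz approximations have expectation 1. All of them are bounded by
  \<open>exp (killed_slope l a * a)\<close>, since their slopes vanish above \<open>a\<close> and
  the two subtracted terms are nonnegative, so the limit keeps expectation 1.\<close>

lemma killed_martingale_expectation:
  assumes l: "0 < l" and a: "0 < a" and T: "0 < T"
  shows "killed_martingale l a T \<in> borel_measurable P" "expectation (killed_martingale l a T) = 1"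
proof -
  define C where "C = killed_slope l a"
  have C: "0 \<le> C" using l by (simp add: C_def killed_slope_def)
  let ?S = "\<lambda>\<omega>. smax (\<lambda>t. W t \<omega>)"
  define U where "U = (\<lambda>k \<omega>. exp (integral {0..?S \<omega> T} (lipschitz_slope l a k)
       - lipschitz_slope l a k (?S \<omega> T) * (?S \<omega> T - W T \<omega>)
       - integral {0..T} (\<lambda>u. (lipschitz_slope l a k (?S \<omega> u))\<^sup>2) / 2))"
  have lcont: "continuous_on A (lipschitz_slope l a k)" for A k
    using lipschitz_slope_lipschitz[OF l] by (rule lipschitz_continuous_on)
  have abs: "\<bar>lipschitz_slope l a k m\<bar> \<le> C" for k m
    using lipschitz_slope_bound[OF l, of a k m] by (simp add: C_def)
  have bound: "U k \<omega> \<le> exp (C * a)" for k \<omega>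
  proof -
    interpret continuous_path "\<lambda>t. W t \<omega>" by (rule paths)
    have "integral {0..?S \<omega> T} (lipschitz_slope l a k) \<le> C * a"
    proof -
      have le: "integral {0..x} (lipschitz_slope l a k) \<le> C * x" if "0 \<le> x" for x
      proof -
        have "norm (integral {0..x} (lipschitz_slope l a k)) \<le> C * (x - 0)"
          using that abs lcont by (intro integral_bound) auto
        then show ?thesis by simp
      qed
      show ?thesis
      proof (cases "a \<le> ?S \<omega> T")
        case True
        have "integral {0..?S \<omega> T} (lipschitz_slope l a k) = integral {0..a} (lipschitz_slope l a k)"
          using True a by (intro integral_cut_at_hitting) (auto simp: lipschitz_slope_above)
        then show ?thesis using le[of a] a by simp
      next
        case False
        then have "C * ?S \<omega> T \<le> C * a" using C by (intro mult_left_mono) auto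
        then show ?thesis using le[OF smax_nonneg[of T]] by linarith
      qed
    qed
    moreover have "0 \<le> lipschitz_slope l a k (?S \<omega> T) * (?S \<omega> T - W T \<omega>)"
      using lipschitz_slope_bound(1)[OF l] smax_ge[of T T] T by (intro mult_nonneg_nonneg) auto
    moreover have "0 \<le> integral {0..T} (\<lambda>u. (lipschitz_slope l a k (?S \<omega> u))\<^sup>2)"
      by (intro integral_nonneg integrable_continuous_real continuous_intros
          continuous_on_compose2[OF lcont smax_continuous]) auto
    ultimately show ?thesis by (simp add: U_def)
  qed
  have mart: "U k \<in> borel_measurable P" "expectation (U k) = 1" for k
    by (rule exponential_martingale[OF lipschitz_slope_lipschitz[OF l] abs T _ bound], simp add: U_def)+
  have lim: "(\<lambda>k. U k \<omega>) \<longlonglongrightarrow> killed_martingale l a T \<omega>" for \<omega>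
  proof -
    interpret continuous_path "\<lambda>t. W t \<omega>" by (rule paths)
    have sq: "\<bar>(lipschitz_slope l a k m)\<^sup>2\<bar> \<le> C\<^sup>2" for k m
      using abs[of k m] by (simp add: power2_le_iff_abs_le C)
    show ?thesis unfolding U_def killed_martingale_def
      by (intro tendsto_intros integral_tendsto_bounded[where C=C and f="\<lambda>k. lipschitz_slope l a k"]
          integral_tendsto_bounded[where C="C\<^sup>2" and f="\<lambda>k u. (lipschitz_slope l a k (smax (\<lambda>t. W t \<omega>) u))\<^sup>2"]
          lipschitz_slope_limit l lcont abs sq continuous_on_compose2[OF lcont smax_continuous] continuous_intros) auto
  qed
  show meas: "killed_martingale l a T \<in> borel_measurable P"
    using lim mart(1) by (rule borel_measurable_LIMSEQ_real)
  have "(\<lambda>k. expectation (U k)) \<longlonglongrightarrow> expectation (killed_martingale l a T)"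
    by (rule integral_dominated_convergence[where w="\<lambda>_. exp (C * a)"])
      (use meas mart(1) lim bound in \<open>auto simp: U_def\<close>)
  then show "expectation (killed_martingale l a T) = 1"
    by (simp add: mart(2) LIMSEQ_const_iff)
qed

text \<open>The two subtracted terms are nonnegative, and the first term is at most its value at
  level \<open>a\<close>. If \<open>a\<close> has not been reached by time \<open>T\<close>, the
  compensator is at least \<open>l * T\<close>; this decay makes paths that never reach
  \<open>a\<close> contribute 0 in the limit.\<close>

lemma killed_martingale_bound:
  assumes l: "0 < l" and a: "0 < a" and T: "0 < T"
  shows "killed_martingale l a T \<omega> \<le> exp (killed_slope l a * a)"
    and "smax (\<lambda>t. W t \<omega>) T < a \<Longrightarrow> killed_martingale l a T \<omega> \<le> exp (killed_slope l a * a) * exp (- (l * T))"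
proof -
  interpret continuous_path "\<lambda>t. W t \<omega>" by (rule paths)
  let ?S = "smax (\<lambda>t. W t \<omega>)"
  have nonneg: "0 \<le> cut_slope l a (?S T) * (?S T - W T \<omega>)"
    using cut_slope_nonneg[OF l] smax_ge[of T T] T by (intro mult_nonneg_nonneg) auto
  have int: "killed_slope l integrable_on {0..x}" for x
    using killed_slope_lipschitz[OF l] by (intro integrable_continuous_real lipschitz_continuous_on)
  have ex: "killed_exponent l x \<le> killed_slope l a * a" if "0 \<le> x" "x \<le> a" for x
  proof -
    have "killed_exponent l x \<le> integral {0..x} (\<lambda>_. killed_slope l a)"
      unfolding killed_exponent_def using that by (intro integral_le int) (auto intro: killed_slope_mono)
    also have "\<dots> = killed_slope l a * x" using that by simp
    also have "\<dots> \<le> killed_slope l a * a" using that l by (intro mult_left_mono) (auto simp: killed_slope_def)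
    finally show ?thesis .
  qed
  show low: "killed_martingale l a T \<omega> \<le> exp (killed_slope l a * a) * exp (- (l * T))" if "?S T < a"
  proof -
    have "integral {0..?S T} (cut_slope l a) = killed_exponent l (?S T)"
      unfolding killed_exponent_def using that
      by (intro Henstock_Kurzweil_Integration.integral_cong) (auto simp: cut_slope_def)
    moreover have "integral {0..T} (\<lambda>u. (cut_slope l a (?S u))\<^sup>2) = 2 * (l * T + area (\<lambda>t. W t \<omega>) T)"
    proof (rule integral_cut_slope_square)
      show "?S t < a" if "t < T" for t using smax_mono[of t T] that \<open>?S T < a\<close> by simp
    qed (use l T in auto)
    ultimately show ?thesis
      using ex[of "?S T"] that smax_nonneg[of T] nonneg area_nonneg[of T]
      unfolding killed_martingale_def exp_add[symmetric] by (simp add: add_divide_distrib)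
  qed
  show "killed_martingale l a T \<omega> \<le> exp (killed_slope l a * a)"
  proof (cases "?S T < a")
    case True
    then show ?thesis using low l T by (auto elim!: order_trans)
  next
    case False
    then obtain \<tau> where \<tau>: "0 < \<tau>" "\<tau> \<le> T" "\<And>t. a \<le> ?S t \<longleftrightarrow> \<tau> \<le> t"
      using smax_hitting_time[OF a, of T] by (metis linorder_not_less)
    have "integral {0..?S T} (cut_slope l a) = killed_exponent l a"
      using False a by (intro integral_cut_slope_above) auto
    moreover have "integral {0..T} (\<lambda>u. (cut_slope l a (?S u))\<^sup>2) = 2 * (l * \<tau> + area (\<lambda>t. W t \<omega>) \<tau>)"
      using l \<tau>(1,2) by (intro integral_cut_slope_square) (auto simp: \<tau>(3) not_le[symmetric])
    ultimately show ?thesis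
      using ex[of a] a nonneg area_nonneg[of \<tau>] mult_pos_pos[OF l \<tau>(1)] unfolding killed_martingale_def by (simp add: add_divide_distrib)
  qed
qed

text \<open>On a path that reaches \<open>a\<close> the sequence is eventually constant; on any
  other path it decays to 0. The times \<open>real (Suc n)\<close> are positive, as the bounds
  require.\<close>

lemma killed_martingale_limit:
  assumes l: "0 < l" and a: "0 < a"
  shows "(\<lambda>n. ennreal (exp (- killed_exponent l a) * killed_martingale l a (real (Suc n)) \<omega>)) \<longlonglongrightarrow> hitting_weight l a (\<lambda>t. W t \<omega>)"
proof -
  interpret continuous_path "\<lambda>t. W t \<omega>" by (rule paths)
  let ?S = "smax (\<lambda>t. W t \<omega>)"
  show ?thesis
  proof (cases "\<exists>T. a \<le> ?S T")
    case True
    then obtain T0 where "a \<le> ?S T0" by blast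
    then obtain \<tau> where \<tau>: "0 < \<tau>" "\<And>t. a \<le> ?S t \<longleftrightarrow> \<tau> \<le> t"
      using smax_hitting_time[OF a, of T0] by metis
    have "killed_martingale l a T \<omega> = exp (killed_exponent l a) * exp (- (l * \<tau>) - area (\<lambda>t. W t \<omega>) \<tau>)" if "\<tau> \<le> T" for T
    proof -
      have "integral {0..?S T} (cut_slope l a) = killed_exponent l a"
        using that a by (intro integral_cut_slope_above) (auto simp: \<tau>)
      moreover have "integral {0..T} (\<lambda>u. (cut_slope l a (?S u))\<^sup>2) = 2 * (l * \<tau> + area (\<lambda>t. W t \<omega>) \<tau>)"
        using l \<tau>(1) that by (intro integral_cut_slope_square) (auto simp: \<tau>(2) not_le[symmetric])
      moreover have "cut_slope l a (?S T) = 0" using that \<tau>(2)[of T] by (simp add: cut_slope_def)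
      ultimately show ?thesis unfolding killed_martingale_def exp_add[symmetric] by (simp add: add_divide_distrib)
    qed
    then have "exp (- killed_exponent l a) * killed_martingale l a T \<omega> = exp (- (l * \<tau>) - area (\<lambda>t. W t \<omega>) \<tau>)" if "\<tau> \<le> T" for T
      using that by (simp add: exp_add[symmetric])
    moreover have "\<forall>\<^sub>F n in sequentially. \<tau> \<le> real (Suc n)"
      by (meson eventually_sequentiallyI le_nat_iff nat_ceiling_le_eq le_SucI)
    ultimately have "\<forall>\<^sub>F n in sequentially. ennreal (exp (- killed_exponent l a) * killed_martingale l a (real (Suc n)) \<omega>)
       = hitting_weight l a (\<lambda>t. W t \<omega>)"
      unfolding hitting_weight_eq[OF l \<tau>] by (auto elim!: eventually_mono)
    then show ?thesis by (rule tendsto_eventually)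
  next
    case False
    then have S: "?S T < a" for T by (simp add: not_le)
    define D where "D = exp (- killed_exponent l a) * exp (killed_slope l a * a)"
    have "(\<lambda>n. exp (- killed_exponent l a) * killed_martingale l a (real (Suc n)) \<omega>) \<longlonglongrightarrow> 0"
    proof (rule tendsto_sandwich)
      show "\<forall>\<^sub>F n in sequentially. 0 \<le> exp (- killed_exponent l a) * killed_martingale l a (real (Suc n)) \<omega>"
        by (simp add: killed_martingale_def)
      show "\<forall>\<^sub>F n in sequentially. exp (- killed_exponent l a) * killed_martingale l a (real (Suc n)) \<omega> \<le> D * exp (- (l * real (Suc n)))"
      proof (rule always_eventually, rule allI)
        fix n
        have "killed_martingale l a (real (Suc n)) \<omega> \<le> exp (killed_slope l a * a) * exp (- (l * real (Suc n)))"
          by (rule killed_martingale_bound(2)[OF l a _ S]) simp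
        then show "exp (- killed_exponent l a) * killed_martingale l a (real (Suc n)) \<omega> \<le> D * exp (- (l * real (Suc n)))"
          unfolding D_def mult.assoc by (rule mult_left_mono) simp
      qed
      show "(\<lambda>n. D * exp (- (l * real (Suc n)))) \<longlonglongrightarrow> 0" using l by real_asymp
    qed simp
    moreover have "hitting_weight l a (\<lambda>t. W t \<omega>) = 0" using S by (intro hitting_weight_eq_0)
    ultimately show ?thesis using tendsto_ennrealI by fastforce
  qed
qed

text \<open>Optional stopping in the limit of large time: for fixed \<open>a\<close> the stopped
  martingale is bounded uniformly in time and path.\<close>

theorem hitting_weight_expectation:
  assumes l: "0 < l" and a: "0 < a"
  shows "(\<integral>\<^sup>+\<omega>. hitting_weight l a (\<lambda>t. W t \<omega>) \<partial>P) = ennreal (exp (- killed_exponent l a))"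
proof -
  note of_nat_Suc [simp del]
  let ?f = "\<lambda>n \<omega>. ennreal (exp (- killed_exponent l a) * killed_martingale l a (real (Suc n)) \<omega>)"
  have [measurable]: "killed_martingale l a (real (Suc n)) \<in> borel_measurable P" for n
    using assms by (intro killed_martingale_expectation) auto
  have D: "exp (- killed_exponent l a) * killed_martingale l a (real (Suc n)) \<omega> \<le> exp (- killed_exponent l a) * exp (killed_slope l a * a)" for n \<omega>
    using assms by (intro mult_left_mono killed_martingale_bound) auto
  have "(\<lambda>n. \<integral>\<^sup>+\<omega>. ?f n \<omega> \<partial>P) \<longlonglongrightarrow> (\<integral>\<^sup>+\<omega>. hitting_weight l a (\<lambda>t. W t \<omega>) \<partial>P)"
  proof (rule nn_integral_dominated_convergence[where w="\<lambda>_. ennreal (exp (- killed_exponent l a) * exp (killed_slope l a * a))"])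
    show "(\<lambda>\<omega>. hitting_weight l a (\<lambda>t. W t \<omega>)) \<in> borel_measurable P"
      by (rule borel_measurable_LIMSEQ_order[OF killed_martingale_limit[OF assms]]) simp
  qed (use killed_martingale_limit[OF assms] D in \<open>auto intro!: ennreal_leI simp: emeasure_space_1\<close>)
  moreover have "(\<integral>\<^sup>+\<omega>. ?f n \<omega> \<partial>P) = ennreal (exp (- killed_exponent l a))" for n
  proof -
    \<comment> \<open>A non-integrable function has expectation 0 by convention, so expectation 1
      already shows integrability.\<close>
    have "integrable P (killed_martingale l a (real (Suc n)))"
      using killed_martingale_expectation(2)[OF assms, of "real (Suc n)"] not_integrable_integral_eq by fastforce
    then have "(\<integral>\<^sup>+\<omega>. ?f n \<omega> \<partial>P) = ennreal (expectation (\<lambda>\<omega>. exp (- killed_exponent l a) * killed_martingale l a (real (Suc n)) \<omega>))"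
      by (intro nn_integral_eq_integral) (auto simp: killed_martingale_nonneg)
    also have "expectation (\<lambda>\<omega>. exp (- killed_exponent l a) * killed_martingale l a (real (Suc n)) \<omega>) = exp (- killed_exponent l a)"
      using killed_martingale_expectation(2)[OF assms, of "real (Suc n)"] by simp
    finally show ?thesis .
  qed
  ultimately show ?thesis by (simp add: LIMSEQ_const_iff)
qed

end

section \<open>The Laplace transform of the tail\<close>

lemma killed_exponent_eq:
  assumes l: "0 < l" and a: "0 \<le> a"
  shows "killed_exponent l a = 2 * sqrt 2 / 3 * ((l + a) powr (3/2) - l powr (3/2))"
proof -
  let ?F = "\<lambda>m. 2 * sqrt 2 / 3 * (l + m) powr (3/2)"
  have "(killed_slope l has_integral ?F a - ?F 0) {0..a}"
  proof (rule fundamental_theorem_of_calculus[OF a])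
    fix m assume m: "m \<in> {0..a}"
    then have "(?F has_real_derivative 2 * sqrt 2 / 3 * (3/2 * (l + m) powr (3/2 - 1))) (at m within {0..a})"
      using l by (auto intro!: derivative_eq_intros)
    also have "2 * sqrt 2 / 3 * (3/2 * (l + m) powr (3/2 - 1)) = killed_slope l m"
      using l m real_sqrt_mult[of 2 "l + m"] by (simp add: killed_slope_def powr_half_sqrt mult.commute)
    finally show "(?F has_vector_derivative killed_slope l m) (at m within {0..a})"
      by (simp add: has_real_derivative_iff_has_vector_derivative)
  qed
  then show ?thesis by (simp add: killed_exponent_def integral_unique right_diff_distrib)
qed

lemma nn_integral_inverse_square:
  assumes "0 < l" "0 \<le> s"
  shows "(\<integral>\<^sup>+a. ennreal (1 / (l + a)\<^sup>2) * indicator {0<..} a * (if a \<le> s then 1 else 0) \<partial>lborel) = ennreal (1 / l - 1 / (l + s))"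
proof -
  have "(\<integral>\<^sup>+a. ennreal (1 / (l + a)\<^sup>2) * indicator {0<..} a * (if a \<le> s then 1 else 0) \<partial>lborel)
    = (\<integral>\<^sup>+a. ennreal (1 / (l + a)\<^sup>2) * indicator {0..s} a \<partial>lborel)"
    using AE_lborel_singleton[of "0::real"] by (intro nn_integral_cong_AE) (auto simp: indicator_def elim!: eventually_mono)
  also have "\<dots> = ennreal (- 1 / (l + s) - (- 1 / (l + 0)))"
  proof (rule nn_integral_FTC_Icc)
    fix x assume "x \<in> {0..s}"
    then have "l + x \<noteq> 0" using assms by auto
    then show "((\<lambda>a. - 1 / (l + a)) has_real_derivative 1 / (l + x)\<^sup>2) (at x)"
      by (auto intro!: derivative_eq_intros simp: power2_eq_square)
  qed (use assms in auto)
  finally show ?thesis by simp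
qed

context continuous_brownian_motion
begin

lemma smax_measurable' [measurable (raw)]:
  assumes "f \<in> borel_measurable N" "g \<in> measurable N P"
  shows "(\<lambda>x. smax (\<lambda>u. W u (g x)) (f x)) \<in> borel_measurable N"
proof -
  have "(\<lambda>(t, \<omega>). smax (\<lambda>u. W u \<omega>) t) \<in> borel_measurable (borel \<Otimes>\<^sub>M P)"
    by (rule borel_measurable_caratheodory[OF continuous_path.smax_continuous[OF paths] smax_measurable])
  from measurable_compose[OF measurable_Pair[OF assms] this] show ?thesis by simp
qed

lemma area_measurable' [measurable (raw)]:
  assumes "f \<in> borel_measurable N" "g \<in> measurable N P"
  shows "(\<lambda>x. area (\<lambda>u. W u (g x)) (f x)) \<in> borel_measurable N"
proof -
  have "(\<lambda>(t, \<omega>). area (\<lambda>u. W u \<omega>) t) \<in> borel_measurable (borel \<Otimes>\<^sub>M P)"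
    by (rule borel_measurable_caratheodory[OF continuous_path.area_continuous[OF paths] area_measurable])
  from measurable_compose[OF measurable_Pair[OF assms] this] show ?thesis by simp
qed

text \<open>Both terms are integrals of the survival factor. In the second, for a fixed time the
  level ranges over \<open>(0, S]\<close>, and
  \<open>(l + S) * (1 / l - 1 / (l + S)) = S / l\<close>. The two integrands therefore add up to
  \<open>1 / l\<close> times the killing density, which has total mass 1 on each path.\<close>

theorem area_laplace_identity:
  assumes l: "0 < l"
  shows "(\<integral>\<^sup>+t. ennreal (exp (- (l * t)) * expectation (\<lambda>\<omega>. exp (- area (\<lambda>u. W u \<omega>) t))) * indicator {0..} t \<partial>lborel)
    + (\<integral>\<^sup>+a. ennreal (1 / (l + a)\<^sup>2 * exp (- killed_exponent l a)) * indicator {0<..} a \<partial>lborel) = ennreal (1 / l)"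
proof -
  interpret pair_sigma_finite lborel P ..
  define S where "S = (\<lambda>t \<omega>. smax (\<lambda>u. W u \<omega>) t)"
  define E where "E = (\<lambda>t \<omega>. exp (- (l * t) - area (\<lambda>u. W u \<omega>) t))"
  \<comment> \<open>The density of the killing time; restricted to the times with
    \<open>a \<le> S t \<omega>\<close> it integrates to \<open>hitting_weight l a\<close>.\<close>
  define K where "K = (\<lambda>t \<omega>. ennreal ((l + S t \<omega>) * E t \<omega>) * indicator {0..} t)"
  have S_pos: "0 \<le> S t \<omega>" for t \<omega> unfolding S_def by (rule continuous_path.smax_nonneg[OF paths])
  have S_meas [measurable (raw)]: "(\<lambda>x. S (f x) (g x)) \<in> borel_measurable N"
    if "f \<in> borel_measurable N" "g \<in> measurable N P" for f g and N :: "'z measure"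
    using that unfolding S_def by measurable
  have E_meas [measurable (raw)]: "(\<lambda>x. E (f x) (g x)) \<in> borel_measurable N"
    if "f \<in> borel_measurable N" "g \<in> measurable N P" for f g and N :: "'z measure"
    using that unfolding E_def by measurable
  have 1: "(\<integral>\<^sup>+t. ennreal (exp (- (l * t)) * expectation (\<lambda>\<omega>. exp (- area (\<lambda>u. W u \<omega>) t))) * indicator {0..} t \<partial>lborel)
    = (\<integral>\<^sup>+\<omega>. (\<integral>\<^sup>+t. ennreal (E t \<omega>) * indicator {0..} t \<partial>lborel) \<partial>P)"
  proof -
    have "ennreal (exp (- (l * t)) * expectation (\<lambda>\<omega>. exp (- area (\<lambda>u. W u \<omega>) t))) * indicator {0..} t
      = (\<integral>\<^sup>+\<omega>. ennreal (E t \<omega>) * indicator {0..} t \<partial>P)" for t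
    proof -
      have "integrable P (\<lambda>\<omega>. exp (- area (\<lambda>u. W u \<omega>) t))"
        by (rule integrable_const_bound[where B=1]) (simp_all add: continuous_path.area_nonneg[OF paths])
      then have "ennreal (expectation (\<lambda>\<omega>. exp (- area (\<lambda>u. W u \<omega>) t))) = (\<integral>\<^sup>+\<omega>. ennreal (exp (- area (\<lambda>u. W u \<omega>) t)) \<partial>P)"
        by (intro nn_integral_eq_integral[symmetric]) auto
      then have "ennreal (exp (- (l * t)) * expectation (\<lambda>\<omega>. exp (- area (\<lambda>u. W u \<omega>) t)))
        = ennreal (exp (- (l * t))) * (\<integral>\<^sup>+\<omega>. ennreal (exp (- area (\<lambda>u. W u \<omega>) t)) \<partial>P)"
        by (simp add: ennreal_mult')
      also have "\<dots> = (\<integral>\<^sup>+\<omega>. ennreal (exp (- (l * t))) * ennreal (exp (- area (\<lambda>u. W u \<omega>) t)) \<partial>P)"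
        by (rule nn_integral_cmult[symmetric]) measurable
      also have "\<dots> = (\<integral>\<^sup>+\<omega>. ennreal (E t \<omega>) \<partial>P)"
        by (simp add: E_def ennreal_mult'[symmetric] exp_add[symmetric])
      finally show ?thesis by (simp add: indicator_def)
    qed
    then show ?thesis by (simp only:) (rule Fubini'[symmetric], measurable)
  qed
  \<comment> \<open>By \<open>hitting_weight_expectation\<close> the exponential is a mean over
    paths of an integral over the times with \<open>a \<le> S t \<omega>\<close>. Exchanging the
    integrals makes the level innermost.\<close>
  have 2: "(\<integral>\<^sup>+a. ennreal (1 / (l + a)\<^sup>2 * exp (- killed_exponent l a)) * indicator {0<..} a \<partial>lborel)
    = (\<integral>\<^sup>+\<omega>. (\<integral>\<^sup>+t. ennreal (S t \<omega> / l * E t \<omega>) * indicator {0..} t \<partial>lborel) \<partial>P)"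
  proof -
    let ?c = "\<lambda>a. ennreal (1 / (l + a)\<^sup>2) * indicator {0<..} a"
    have "(\<integral>\<^sup>+a. ennreal (1 / (l + a)\<^sup>2 * exp (- killed_exponent l a)) * indicator {0<..} a \<partial>lborel)
      = (\<integral>\<^sup>+a. (\<integral>\<^sup>+\<omega>. (\<integral>\<^sup>+t. K t \<omega> * (?c a * (if a \<le> S t \<omega> then 1 else 0)) \<partial>lborel) \<partial>P) \<partial>lborel)"
    proof (rule nn_integral_cong)
      fix a :: real
      show "ennreal (1 / (l + a)\<^sup>2 * exp (- killed_exponent l a)) * indicator {0<..} a
        = (\<integral>\<^sup>+\<omega>. (\<integral>\<^sup>+t. K t \<omega> * (?c a * (if a \<le> S t \<omega> then 1 else 0)) \<partial>lborel) \<partial>P)"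
      proof (cases "0 < a")
        case True
        have ind: "(if a \<le> S t \<omega> then 1 else 0) = (indicator {t. a \<le> S t \<omega>} t :: ennreal)" for t \<omega>
          by (simp add: indicator_def)
        have "(\<integral>\<^sup>+\<omega>. (\<integral>\<^sup>+t. K t \<omega> * (?c a * (if a \<le> S t \<omega> then 1 else 0)) \<partial>lborel) \<partial>P)
          = (\<integral>\<^sup>+\<omega>. ?c a * hitting_weight l a (\<lambda>u. W u \<omega>) \<partial>P)"
        proof (rule nn_integral_cong)
          fix \<omega> assume [measurable]: "\<omega> \<in> space P"
          have "(\<integral>\<^sup>+t. K t \<omega> * (?c a * (if a \<le> S t \<omega> then 1 else 0)) \<partial>lborel)
            = (\<integral>\<^sup>+t. ?c a * (K t \<omega> * (if a \<le> S t \<omega> then 1 else 0)) \<partial>lborel)" by (simp add: mult_ac)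
          also have "\<dots> = ?c a * (\<integral>\<^sup>+t. K t \<omega> * (if a \<le> S t \<omega> then 1 else 0) \<partial>lborel)"
            unfolding K_def by (rule nn_integral_cmult) measurable
          also have "(\<integral>\<^sup>+t. K t \<omega> * (if a \<le> S t \<omega> then 1 else 0) \<partial>lborel) = hitting_weight l a (\<lambda>u. W u \<omega>)"
            unfolding hitting_weight_def K_def ind by (simp add: S_def E_def)
          finally show "(\<integral>\<^sup>+t. K t \<omega> * (?c a * (if a \<le> S t \<omega> then 1 else 0)) \<partial>lborel) = ?c a * hitting_weight l a (\<lambda>u. W u \<omega>)" .
        qed
        also have "\<dots> = ?c a * (\<integral>\<^sup>+\<omega>. hitting_weight l a (\<lambda>u. W u \<omega>) \<partial>P)"
          by (rule nn_integral_cmult) (unfold hitting_weight_def, measurable)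
        finally show ?thesis using True by (simp add: hitting_weight_expectation l ennreal_mult'[symmetric])
      qed simp
    qed
    also have "\<dots> = (\<integral>\<^sup>+\<omega>. (\<integral>\<^sup>+a. (\<integral>\<^sup>+t. K t \<omega> * (?c a * (if a \<le> S t \<omega> then 1 else 0)) \<partial>lborel) \<partial>lborel) \<partial>P)"
      unfolding K_def by (rule Fubini'[symmetric]) measurable
    also have "\<dots> = (\<integral>\<^sup>+\<omega>. (\<integral>\<^sup>+t. ennreal (S t \<omega> / l * E t \<omega>) * indicator {0..} t \<partial>lborel) \<partial>P)"
    proof (rule nn_integral_cong)
      fix \<omega> assume [measurable]: "\<omega> \<in> space P"
      have "(\<integral>\<^sup>+a. (\<integral>\<^sup>+t. K t \<omega> * (?c a * (if a \<le> S t \<omega> then 1 else 0)) \<partial>lborel) \<partial>lborel)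
        = (\<integral>\<^sup>+t. (\<integral>\<^sup>+a. K t \<omega> * (?c a * (if a \<le> S t \<omega> then 1 else 0)) \<partial>lborel) \<partial>lborel)"
        unfolding K_def by (rule lborel_pair.Fubini') measurable
      also have "\<dots> = (\<integral>\<^sup>+t. ennreal (S t \<omega> / l * E t \<omega>) * indicator {0..} t \<partial>lborel)"
      proof (rule nn_integral_cong)
        fix t :: real
        have "(\<integral>\<^sup>+a. K t \<omega> * (?c a * (if a \<le> S t \<omega> then 1 else 0)) \<partial>lborel)
          = K t \<omega> * (\<integral>\<^sup>+a. ?c a * (if a \<le> S t \<omega> then 1 else 0) \<partial>lborel)"
          by (rule nn_integral_cmult) measurable
        also have "\<dots> = K t \<omega> * ennreal (1 / l - 1 / (l + S t \<omega>))"
          by (simp add: nn_integral_inverse_square[OF l S_pos])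
        also have "\<dots> = ennreal ((l + S t \<omega>) * E t \<omega> * (1 / l - 1 / (l + S t \<omega>))) * indicator {0..} t"
          using l S_pos[of t \<omega>] by (simp add: K_def ennreal_mult E_def mult_ac frac_le)
        also have "(l + S t \<omega>) * E t \<omega> * (1 / l - 1 / (l + S t \<omega>)) = S t \<omega> / l * E t \<omega>"
        proof -
          have "l + S t \<omega> \<noteq> 0" using l S_pos[of t \<omega>] by linarith
          then have "(l + S t \<omega>) * (1 / l - 1 / (l + S t \<omega>)) = S t \<omega> / l"
            using l by (simp add: right_diff_distrib add_divide_distrib)
          then show ?thesis by (metis mult.assoc mult.commute)
        qed
        finally show "(\<integral>\<^sup>+a. K t \<omega> * (?c a * (if a \<le> S t \<omega> then 1 else 0)) \<partial>lborel) = ennreal (S t \<omega> / l * E t \<omega>) * indicator {0..} t" .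
      qed
      finally show "(\<integral>\<^sup>+a. (\<integral>\<^sup>+t. K t \<omega> * (?c a * (if a \<le> S t \<omega> then 1 else 0)) \<partial>lborel) \<partial>lborel)
        = (\<integral>\<^sup>+t. ennreal (S t \<omega> / l * E t \<omega>) * indicator {0..} t \<partial>lborel)" .
    qed
    finally show ?thesis .
  qed
  have "(\<integral>\<^sup>+\<omega>. (\<integral>\<^sup>+t. ennreal (E t \<omega>) * indicator {0..} t \<partial>lborel) \<partial>P)
      + (\<integral>\<^sup>+\<omega>. (\<integral>\<^sup>+t. ennreal (S t \<omega> / l * E t \<omega>) * indicator {0..} t \<partial>lborel) \<partial>P)
    = (\<integral>\<^sup>+\<omega>. (\<integral>\<^sup>+t. ennreal (E t \<omega>) * indicator {0..} t \<partial>lborel)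
      + (\<integral>\<^sup>+t. ennreal (S t \<omega> / l * E t \<omega>) * indicator {0..} t \<partial>lborel) \<partial>P)"
    by (rule nn_integral_add[symmetric]) measurable
  also have "\<dots> = (\<integral>\<^sup>+\<omega>. ennreal (1 / l) \<partial>P)"
  proof (rule nn_integral_cong)
    fix \<omega> assume [measurable]: "\<omega> \<in> space P"
    have "(\<integral>\<^sup>+t. ennreal (E t \<omega>) * indicator {0..} t \<partial>lborel) + (\<integral>\<^sup>+t. ennreal (S t \<omega> / l * E t \<omega>) * indicator {0..} t \<partial>lborel)
      = (\<integral>\<^sup>+t. ennreal (E t \<omega>) * indicator {0..} t + ennreal (S t \<omega> / l * E t \<omega>) * indicator {0..} t \<partial>lborel)"
      by (rule nn_integral_add[symmetric]) measurable
    also have "\<dots> = (\<integral>\<^sup>+t. ennreal (1 / l) * K t \<omega> \<partial>lborel)"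
    proof (rule nn_integral_cong)
      fix t :: real
      have "E t \<omega> + S t \<omega> / l * E t \<omega> = 1 / l * ((l + S t \<omega>) * E t \<omega>)" using l by (simp add: field_simps)
      moreover have "ennreal (E t \<omega>) + ennreal (S t \<omega> / l * E t \<omega>) = ennreal (E t \<omega> + S t \<omega> / l * E t \<omega>)"
        using l S_pos[of t \<omega>] by (intro ennreal_plus[symmetric]) (auto simp: E_def)
      ultimately have "ennreal (E t \<omega>) + ennreal (S t \<omega> / l * E t \<omega>) = ennreal (1 / l) * ennreal ((l + S t \<omega>) * E t \<omega>)"
        using l by (simp add: ennreal_mult'[symmetric])
      then show "ennreal (E t \<omega>) * indicator {0..} t + ennreal (S t \<omega> / l * E t \<omega>) * indicator {0..} t = ennreal (1 / l) * K t \<omega>"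
        by (simp add: K_def indicator_def)
    qed
    also have "\<dots> = ennreal (1 / l) * (\<integral>\<^sup>+t. K t \<omega> \<partial>lborel)"
      unfolding K_def by (rule nn_integral_cmult) measurable
    also have "(\<integral>\<^sup>+t. K t \<omega> \<partial>lborel) = 1"
      using continuous_path.killed_hitting_integral[OF paths l, of 0 \<omega>]
      by (simp add: K_def E_def S_def continuous_path.area_0[OF paths])
    finally show "(\<integral>\<^sup>+t. ennreal (E t \<omega>) * indicator {0..} t \<partial>lborel)
      + (\<integral>\<^sup>+t. ennreal (S t \<omega> / l * E t \<omega>) * indicator {0..} t \<partial>lborel) = ennreal (1 / l)" by simp
  qed
  finally show ?thesis unfolding 1 2 by (simp add: emeasure_space_1)
qed

end

section \<open>Moments from the Laplace transform\<close>

lemma nn_integral_eq_iff_has_integral: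
  fixes h :: "real \<Rightarrow> real"
  assumes h: "\<And>x. 0 \<le> h x" and S: "S \<in> sets borel" and meas: "(\<lambda>x. h x * indicator S x) \<in> borel_measurable borel" and r: "0 \<le> r"
  shows "(\<integral>\<^sup>+x. ennreal (h x) * indicator S x \<partial>lborel) = ennreal r \<longleftrightarrow> (h has_integral r) S"
proof -
  have eq: "(\<integral>\<^sup>+x. ennreal (h x) * indicator S x \<partial>lborel) = (\<integral>\<^sup>+x. ennreal (h x * indicator S x) \<partial>lborel)"
    by (intro nn_integral_cong) (simp add: indicator_def)
  have iff: "(h has_integral r) S \<longleftrightarrow> ((\<lambda>x. h x * indicator S x) has_integral r) UNIV"
  proof -
    have "(\<lambda>x. h x * indicator S x) = (\<lambda>x. if x \<in> S then h x else 0)" by (auto simp: indicator_def)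
    then show ?thesis using has_integral_restrict_UNIV[of S h r] by simp
  qed
  show ?thesis
  proof
    assume "(\<integral>\<^sup>+x. ennreal (h x) * indicator S x \<partial>lborel) = ennreal r"
    then show "(h has_integral r) S"
      unfolding iff using meas h r by (intro nn_integral_has_integral) (auto simp: eq)
  next
    assume "(h has_integral r) S"
    then show "(\<integral>\<^sup>+x. ennreal (h x) * indicator S x \<partial>lborel) = ennreal r"
      unfolding iff eq using nn_integral_has_integral_lborel[of "\<lambda>x. h x * indicator S x" r] meas h by simp
  qed
qed

text \<open>Both sides may be infinite, so it is shown that each finite nonnegative number is the
  value of the left side exactly when it is the value of the right side.\<close>

lemma nn_integral_change_of_variables:
  fixes f g g' :: "real \<Rightarrow> real"
  assumes f: "\<And>x. 0 \<le> f x" "f \<in> borel_measurable borel"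
    and S: "S \<in> sets borel" and T: "g ` S = T" "T \<in> sets borel"
    and g: "\<And>x. x \<in> S \<Longrightarrow> (g has_real_derivative g' x) (at x within S)" "inj_on g S"
    and meas: "g \<in> borel_measurable borel" "g' \<in> borel_measurable borel"
  shows "(\<integral>\<^sup>+x. ennreal (\<bar>g' x\<bar> * f (g x)) * indicator S x \<partial>lborel) = (\<integral>\<^sup>+y. ennreal (f y) * indicator T y \<partial>lborel)"
    (is "?L = ?R")
proof -
  note [measurable] = f(2) S T(2) meas
  have cov: "(\<lambda>x. \<bar>g' x\<bar> * f (g x)) absolutely_integrable_on S \<and> integral S (\<lambda>x. \<bar>g' x\<bar> * f (g x)) = b
     \<longleftrightarrow> f absolutely_integrable_on T \<and> integral T f = b" for b
    unfolding T(1)[symmetric] using S g by (intro has_absolute_integral_change_of_variables_1') auto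
  have hi: "(h has_integral r) A \<longleftrightarrow> h absolutely_integrable_on A \<and> integral A h = r" if "\<And>x. 0 \<le> h x" for h :: "real \<Rightarrow> real" and A r
  proof
    assume *: "(h has_integral r) A"
    then have "h absolutely_integrable_on A" using that by (intro nonnegative_absolutely_integrable_1) auto
    with * show "h absolutely_integrable_on A \<and> integral A h = r" by (simp add: integral_unique)
  next
    assume *: "h absolutely_integrable_on A \<and> integral A h = r"
    then have "h integrable_on A" by (intro set_lebesgue_integral_eq_integral(1)) simp
    with * show "(h has_integral r) A" by (simp add: has_integral_iff)
  qed
  have L: "?L = ennreal r \<longleftrightarrow> ((\<lambda>x. \<bar>g' x\<bar> * f (g x)) has_integral r) S" if "0 \<le> r" for r
    using that f(1) by (intro nn_integral_eq_iff_has_integral) auto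
  have R: "?R = ennreal r \<longleftrightarrow> (f has_integral r) T" if "0 \<le> r" for r
    using that f(1) by (intro nn_integral_eq_iff_has_integral) auto
  have eq: "?L = ennreal r \<longleftrightarrow> ?R = ennreal r" if "0 \<le> r" for r
    unfolding L[OF that] R[OF that] hi[OF f(1)]
    using hi[of "\<lambda>x. \<bar>g' x\<bar> * f (g x)" r S] f(1) cov[of r] by (simp only: mult_nonneg_nonneg abs_ge_zero)
  show ?thesis
  proof (cases ?L)
    case (real r)
    then show ?thesis using eq[of r] by simp
  next
    case top
    show ?thesis
    proof (cases ?R)
      case (real r)
      then show ?thesis using eq[of r] by simp
    qed (use top in simp)
  qed
qed

lemma inj_on_powr:
  fixes a :: real assumes "a \<noteq> 0" shows "inj_on (\<lambda>x::real. x powr a) {0<..}"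
  by (rule inj_on_inverseI[where g="\<lambda>y. y powr (1 / a)"]) (use assms in \<open>auto simp: powr_powr\<close>)

text \<open>The substitution \<open>t = k * x powr p\<close> reduces this to Euler's integral for
  \<open>Gamma (r / p)\<close>. It is used with \<open>p = 1\<close> and with
  \<open>p = 3/2\<close>.\<close>

lemma nn_integral_gamma_power:
  assumes r: "0 < r" and p: "0 < p" and k: "0 < k"
  shows "(\<integral>\<^sup>+x. ennreal (x powr (r - 1) * exp (- (k * x powr p))) * indicator {0<..} x \<partial>lborel)
    = ennreal (Gamma (r / p) / p * k powr (- r / p))"
proof -
  let ?f = "\<lambda>t. t powr (r / p - 1) / exp t"
  let ?c = "p * k powr (r / p)"
  have img: "(\<lambda>x. k * x powr p) ` {0<..} = {0<..}"
  proof (intro equalityI subsetI)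
    fix y :: real assume "y \<in> {0<..}"
    then have "y = k * ((y / k) powr (1 / p)) powr p" "(y / k) powr (1 / p) > 0" using k p by (auto simp: powr_powr)
    then show "y \<in> (\<lambda>x. k * x powr p) ` {0<..}" by blast
  qed (use k in auto)
  have "(\<integral>\<^sup>+x. ennreal (\<bar>k * (p * x powr (p - 1))\<bar> * ?f (k * x powr p)) * indicator {0<..} x \<partial>lborel)
    = (\<integral>\<^sup>+t. ennreal (?f t) * indicator {0<..} t \<partial>lborel)"
  proof (rule nn_integral_change_of_variables[OF _ _ _ img])
    show "((\<lambda>x. k * x powr p) has_real_derivative k * (p * x powr (p - 1))) (at x within {0<..})" if "x \<in> {0<..}" for x
      using that by (auto intro!: derivative_eq_intros)
    show "inj_on (\<lambda>x. k * x powr p) {0<..}"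
      using k inj_on_powr[of p] p by (auto simp: inj_on_def)
  qed auto
  also have "(\<integral>\<^sup>+t. ennreal (?f t) * indicator {0<..} t \<partial>lborel) = (\<integral>\<^sup>+t. ennreal (?f t) * indicator {0..} t \<partial>lborel)"
    by (intro nn_integral_cong) (auto simp: indicator_def)
  also have "\<dots> = ennreal (Gamma (r / p))"
  proof (subst nn_integral_eq_iff_has_integral)
    show "0 \<le> Gamma (r / p)" using r p by (simp add: Gamma_real_nonneg)
  qed (use Gamma_integral_real[of "r / p"] r p in auto)
  finally have 1: "(\<integral>\<^sup>+x. ennreal (\<bar>k * (p * x powr (p - 1))\<bar> * ?f (k * x powr p)) * indicator {0<..} x \<partial>lborel) = ennreal (Gamma (r / p))" .
  have "(\<integral>\<^sup>+x. ennreal (\<bar>k * (p * x powr (p - 1))\<bar> * ?f (k * x powr p)) * indicator {0<..} x \<partial>lborel)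
     = (\<integral>\<^sup>+x. ennreal ?c * (ennreal (x powr (r - 1) * exp (- (k * x powr p))) * indicator {0<..} x) \<partial>lborel)"
  proof (rule nn_integral_cong)
    fix x :: real
    show "ennreal (\<bar>k * (p * x powr (p - 1))\<bar> * ?f (k * x powr p)) * indicator {0<..} x
      = ennreal ?c * (ennreal (x powr (r - 1) * exp (- (k * x powr p))) * indicator {0<..} x)"
    proof (cases "0 < x")
      case True
      have "k * (p * x powr (p - 1)) * (k * x powr p) powr (r / p - 1)
        = p * (k powr 1 * k powr (r / p - 1)) * (x powr (p - 1) * x powr (p * (r / p - 1)))"
        using True k by (simp add: powr_mult powr_powr)
      also have "\<dots> = ?c * x powr (r - 1)"
        unfolding powr_add[symmetric] using p by (simp add: field_simps)
      finally have "\<bar>k * (p * x powr (p - 1))\<bar> * ?f (k * x powr p) = ?c * (x powr (r - 1) * exp (- (k * x powr p)))"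
        using True k p by (simp add: exp_minus field_simps)
      then show ?thesis using True p by (simp add: ennreal_mult'[symmetric])
    qed simp
  qed
  also have "\<dots> = ennreal ?c * (\<integral>\<^sup>+x. ennreal (x powr (r - 1) * exp (- (k * x powr p))) * indicator {0<..} x \<partial>lborel)"
    by (rule nn_integral_cmult) simp
  finally have 2: "ennreal ?c * (\<integral>\<^sup>+x. ennreal (x powr (r - 1) * exp (- (k * x powr p))) * indicator {0<..} x \<partial>lborel) = ennreal (Gamma (r / p))"
    using 1 by simp
  have c: "0 < ?c" using p k by simp
  have "ennreal (1 / ?c) * (ennreal ?c * (\<integral>\<^sup>+x. ennreal (x powr (r - 1) * exp (- (k * x powr p))) * indicator {0<..} x \<partial>lborel))
     = ennreal (1 / ?c * ?c) * (\<integral>\<^sup>+x. ennreal (x powr (r - 1) * exp (- (k * x powr p))) * indicator {0<..} x \<partial>lborel)"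
    using c by (subst mult.assoc[symmetric], subst ennreal_mult'[symmetric]) auto
  also have "1 / ?c * ?c = 1" using c k p by simp
  finally have "(\<integral>\<^sup>+x. ennreal (x powr (r - 1) * exp (- (k * x powr p))) * indicator {0<..} x \<partial>lborel) = ennreal (1 / ?c) * ennreal (Gamma (r / p))"
    unfolding 2 by simp
  also have "\<dots> = ennreal (Gamma (r / p) / p * k powr (- r / p))"
  proof -
    have "- r / p = - (r / p)" by simp
    then have "1 / ?c * Gamma (r / p) = Gamma (r / p) / p * k powr (- r / p)"
      by (simp only: powr_minus_divide) simp
    then show ?thesis using c by (simp add: ennreal_mult'[symmetric])
  qed
  finally show ?thesis .
qed

text \<open>The substitution \<open>w = (1 + b) powr (- 3 / 2)\<close> turns the integral into a Beta integral.\<close>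

lemma nn_integral_beta_variant:
  assumes "0 < q" "q < 1"
  shows "(\<integral>\<^sup>+b. ennreal (1 / (1 + b)\<^sup>2 * ((1 + b) powr (3/2) - 1) powr (- q)) * indicator {0<..} b \<partial>lborel)
    = ennreal (2 / 3 * Beta (2/3 + q) (1 - q))"
proof -
  let ?f = "\<lambda>b::real. 1 / (1 + b)\<^sup>2 * ((1 + b) powr (3/2) - 1) powr (- q)"
  \<comment> \<open>\<open>?g\<close> is the inverse of the substitution, taking \<open>w\<close> in
    \<open>(0, 1)\<close> to the level \<open>b\<close>.\<close>
  let ?g = "\<lambda>w::real. w powr (- (2/3)) - 1" and ?g' = "\<lambda>w::real. - (2/3) * w powr (- (2/3) - 1)"
  have img: "?g ` {0<..<1} = {0<..}"
  proof (intro equalityI subsetI)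
    fix y :: real assume "y \<in> {0<..}"
    then have y: "y > 0" by simp
    have "(1 + y) powr (- (3/2)) < (1 + y) powr 0" using y by (subst powr_less_cancel_iff) auto
    moreover have "y = ?g ((1 + y) powr (- (3/2)))" using y unfolding powr_powr by simp
    moreover have "(1 + y) powr (- (3/2)) > 0" using y by simp
    ultimately show "y \<in> ?g ` {0<..<1}" using y by (intro image_eqI[of _ _ "(1 + y) powr (- (3/2))"]) auto
  next
    fix y assume "y \<in> ?g ` {0<..<1}"
    then obtain w :: real where w: "0 < w" "w < 1" "y = ?g w" by auto
    have "1 powr (- (2/3)) < w powr (- (2/3))" using w by (intro powr_less_mono2_neg) auto
    then show "y \<in> {0<..}" using w by simp
  qed
  have "(\<integral>\<^sup>+b. ennreal (?f b) * indicator {0<..} b \<partial>lborel)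
    = (\<integral>\<^sup>+w. ennreal (\<bar>?g' w\<bar> * ?f (?g w)) * indicator {0<..<1} w \<partial>lborel)"
  proof (rule nn_integral_change_of_variables[OF _ _ _ img, symmetric])
    show "(?g has_real_derivative ?g' w) (at w within {0<..<1})" if "w \<in> {0<..<1}" for w
      using that by (auto intro!: derivative_eq_intros)
    show "inj_on ?g {0<..<1}"
      using inj_on_powr[of "- (2/3)"] by (auto simp: inj_on_def)
  qed auto
  also have "\<dots> = (\<integral>\<^sup>+w. ennreal (2/3) * (ennreal (w powr (2/3 + q - 1) * (1 - w) powr (1 - q - 1)) * indicator {0..1} w) \<partial>lborel)"
  proof (rule nn_integral_cong_AE)
    have "AE w in lborel. w \<noteq> (0::real) \<and> w \<noteq> 1"
      using AE_lborel_singleton[of "0::real"] AE_lborel_singleton[of "1::real"] by eventually_elim simp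
    then show "AE w in lborel. ennreal (\<bar>?g' w\<bar> * ?f (?g w)) * indicator {0<..<1} w
      = ennreal (2/3) * (ennreal (w powr (2/3 + q - 1) * (1 - w) powr (1 - q - 1)) * indicator {0..1} w)"
    proof eventually_elim
      case (elim w)
      show ?case
      proof (cases "w \<in> {0<..<1}")
        case True
        then have w: "0 < w" "w < 1" by auto
        have 1: "(w powr (- (2/3))) powr (3/2) - 1 = w powr (-1) * (1 - w)"
          using w unfolding powr_powr by (simp add: powr_minus_divide diff_divide_distrib right_diff_distrib)
        have 2: "1 / (w powr (- (2/3)))\<^sup>2 = w powr (4/3)"
        proof -
          have "(w powr (- (2/3)))\<^sup>2 = w powr (- (4/3))"
            unfolding power2_eq_square powr_add[symmetric] by simp
          then show ?thesis using w by (simp add: powr_minus_divide)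
        qed
        have "\<bar>?g' w\<bar> * ?f (?g w) = 2/3 * w powr (- (2/3) - 1) * (w powr (4/3) * (w powr (-1) * (1 - w)) powr (- q))"
        proof -
          have "1 + ?g w = w powr (- (2/3))" by simp
          moreover have "\<bar>?g' w\<bar> = 2/3 * w powr (- (2/3) - 1)" unfolding abs_mult by simp
          ultimately show ?thesis by (simp only: 1 2)
        qed
        also have "(w powr (-1) * (1 - w)) powr (- q) = w powr q * (1 - w) powr (- q)"
        proof -
          have "(w powr (-1) * (1 - w)) powr (- q) = (w powr (-1)) powr (- q) * (1 - w) powr (- q)"
            using w by (intro powr_mult)
          then show ?thesis unfolding powr_powr by simp
        qed
        also have "2/3 * w powr (- (2/3) - 1) * (w powr (4/3) * (w powr q * (1 - w) powr (- q)))
          = 2/3 * ((w powr (- (2/3) - 1) * w powr (4/3) * w powr q) * (1 - w) powr (- q))" by simp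
        also have "w powr (- (2/3) - 1) * w powr (4/3) * w powr q = w powr (2/3 + q - 1)"
          unfolding powr_add[symmetric] by simp
        finally show ?thesis using True by (simp add: ennreal_mult'[symmetric])
      next
        case False
        then show ?thesis using elim by (auto simp: indicator_def)
      qed
    qed
  qed
  also have "\<dots> = ennreal (2/3) * (\<integral>\<^sup>+w. ennreal (w powr (2/3 + q - 1) * (1 - w) powr (1 - q - 1)) * indicator {0..1} w \<partial>lborel)"
    by (rule nn_integral_cmult) simp
  also have "(\<integral>\<^sup>+w. ennreal (w powr (2/3 + q - 1) * (1 - w) powr (1 - q - 1)) * indicator {0..1} w \<partial>lborel) = ennreal (Beta (2/3 + q) (1 - q))"
  proof (subst nn_integral_eq_iff_has_integral)
    show "0 \<le> Beta (2/3 + q) (1 - q)" using assms by (simp add: Beta_def Gamma_real_nonneg)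
  qed (use has_integral_Beta_real[of "2/3 + q" "1 - q"] assms in auto)
  finally show ?thesis by (simp add: ennreal_mult'[symmetric])
qed

text \<open>All that the moment computation takes from Brownian motion: an almost surely positive
  variable whose tail satisfies \<open>area_laplace_identity\<close>, with
  \<open>killed_exponent\<close> written out.\<close>

locale area_tail = prob_space N for N :: "'b measure" +
  fixes X :: "'b \<Rightarrow> real"
  assumes X [measurable]: "X \<in> borel_measurable N"
    and X_pos: "AE \<omega> in N. 0 < X \<omega>"
    and laplace: "\<And>l. 0 < l \<Longrightarrow>
      (\<integral>\<^sup>+t. ennreal (exp (- (l * t)) * measure N {\<omega> \<in> space N. t < X \<omega>}) * indicator {0..} t \<partial>lborel)
      + (\<integral>\<^sup>+a. ennreal (1 / (l + a)\<^sup>2 * exp (- (2 * sqrt 2 / 3 * ((l + a) powr (3/2) - l powr (3/2))))) * indicator {0<..} a \<partial>lborel)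
      = ennreal (1 / l)"
begin

definition tail :: "real \<Rightarrow> real" where
  "tail t = measure N {\<omega> \<in> space N. t < X \<omega>}"

text \<open>\<open>l * G l\<close> turns out to be the Laplace transform of the law of
  \<open>X\<close>, see \<open>laplace_transform\<close>.\<close>

definition G :: "real \<Rightarrow> ennreal" where
  "G l = (\<integral>\<^sup>+a. ennreal (1 / (l + a)\<^sup>2 * exp (- (2 * sqrt 2 / 3 * ((l + a) powr (3/2) - l powr (3/2))))) * indicator {0<..} a \<partial>lborel)"

lemma tail_antimono: "s \<le> t \<Longrightarrow> tail t \<le> tail s"
  unfolding tail_def by (intro finite_measure_mono) auto

lemma tail_measurable [measurable]: "tail \<in> borel_measurable borel"
proof -
  have "mono (\<lambda>t. - tail t)" by (intro monoI) (simp add: tail_antimono)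
  then have "(\<lambda>t. - tail t) \<in> borel_measurable borel" by (rule borel_measurable_mono)
  then have "(\<lambda>t. - (- tail t)) \<in> borel_measurable borel" by measurable
  then show ?thesis by simp
qed

lemma tail_bounds: "0 \<le> tail t" "tail t \<le> 1"
  by (simp_all add: tail_def)

lemma ennreal_tail: "ennreal (tail t) = (\<integral>\<^sup>+\<omega>. (if t < X \<omega> then 1 else 0) \<partial>N)"
proof -
  have "(\<integral>\<^sup>+\<omega>. (if t < X \<omega> then 1 else 0) \<partial>N) = (\<integral>\<^sup>+\<omega>. indicator {\<omega> \<in> space N. t < X \<omega>} \<omega> \<partial>N)"
    by (intro nn_integral_cong) (auto simp: indicator_def)
  then show ?thesis by (simp add: tail_def emeasure_eq_measure)
qed

lemma layer_cake:
  assumes [measurable]: "f \<in> borel_measurable borel"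
  shows "(\<integral>\<^sup>+\<omega>. (\<integral>\<^sup>+t. f t * (if t < X \<omega> then 1 else 0) \<partial>lborel) \<partial>N) = (\<integral>\<^sup>+t. f t * ennreal (tail t) \<partial>lborel)"
proof -
  interpret pair_sigma_finite lborel N ..
  have "(\<integral>\<^sup>+\<omega>. (\<integral>\<^sup>+t. f t * (if t < X \<omega> then 1 else 0) \<partial>lborel) \<partial>N)
    = (\<integral>\<^sup>+t. (\<integral>\<^sup>+\<omega>. f t * (if t < X \<omega> then 1 else 0) \<partial>N) \<partial>lborel)"
    by (rule Fubini') measurable
  also have "\<dots> = (\<integral>\<^sup>+t. f t * (\<integral>\<^sup>+\<omega>. (if t < X \<omega> then 1 else 0) \<partial>N) \<partial>lborel)"
    by (intro nn_integral_cong nn_integral_cmult) measurable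
  finally show ?thesis by (simp add: ennreal_tail)
qed

section \<open>Laplace transform of the law and moments of negative order\<close>

lemma laplace_finite:
  assumes "0 < l"
  shows "(\<integral>\<^sup>+t. ennreal (exp (- (l * t)) * tail t) * indicator {0..} t \<partial>lborel) \<noteq> \<infinity>"
  using laplace[OF assms] unfolding tail_def[symmetric] 
  by (metis ennreal_add_eq_top ennreal_neq_top infinity_ennreal_def)

text \<open>Integration by parts for each outcome: the integral of \<open>exp (- l * t)\<close> up
  to \<open>x\<close> plus \<open>exp (- l * x) / l\<close> is \<open>1 / l\<close>. After averaging
  and comparing with the Laplace identity, the finite integral of the tail cancels.\<close>

lemma laplace_transform:
  assumes l: "0 < l"
  shows "(\<integral>\<^sup>+\<omega>. ennreal (exp (- (l * X \<omega>))) \<partial>N) = ennreal l * G l"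
proof -
  let ?A = "\<integral>\<^sup>+t. ennreal (exp (- (l * t)) * tail t) * indicator {0..} t \<partial>lborel"
  let ?f = "\<lambda>t. ennreal (exp (- (l * t))) * indicator {0..} t"
  have path: "(\<integral>\<^sup>+t. ?f t * (if t < x then 1 else 0) \<partial>lborel) + ennreal (1 / l) * ennreal (exp (- (l * x))) = ennreal (1 / l)" if "0 < x" for x
  proof -
    have "(\<integral>\<^sup>+t. ?f t * (if t < x then 1 else 0) \<partial>lborel) = (\<integral>\<^sup>+t. ennreal (exp (- (l * t))) * indicator {0..x} t \<partial>lborel)"
      using AE_lborel_singleton[of x] by (intro nn_integral_cong_AE) (auto simp: indicator_def elim!: eventually_mono)
    also have "\<dots> = ennreal (- exp (- (l * x)) / l - (- exp (- (l * 0)) / l))"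
      by (rule nn_integral_FTC_Icc) (use l that in \<open>auto intro!: derivative_eq_intros\<close>)
    finally have "(\<integral>\<^sup>+t. ?f t * (if t < x then 1 else 0) \<partial>lborel) = ennreal (1 / l - exp (- (l * x)) / l)" by simp
    moreover have "ennreal (1 / l) * ennreal (exp (- (l * x))) = ennreal (exp (- (l * x)) / l)"
      using l by (simp add: ennreal_mult'[symmetric])
    moreover have "exp (- (l * x)) / l \<le> 1 / l" using l that by (intro divide_right_mono) auto
    ultimately show ?thesis using l by (simp add: ennreal_plus[symmetric] del: ennreal_plus)
  qed
  have "?A = (\<integral>\<^sup>+t. ?f t * ennreal (tail t) \<partial>lborel)"
    by (intro nn_integral_cong) (simp add: ennreal_mult' tail_bounds mult_ac)
  also have "\<dots> = (\<integral>\<^sup>+\<omega>. (\<integral>\<^sup>+t. ?f t * (if t < X \<omega> then 1 else 0) \<partial>lborel) \<partial>N)"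
    by (rule layer_cake[symmetric]) measurable
  finally have A: "?A = (\<integral>\<^sup>+\<omega>. (\<integral>\<^sup>+t. ?f t * (if t < X \<omega> then 1 else 0) \<partial>lborel) \<partial>N)" .
  have "?A + ennreal (1 / l) * (\<integral>\<^sup>+\<omega>. ennreal (exp (- (l * X \<omega>))) \<partial>N)
    = (\<integral>\<^sup>+\<omega>. (\<integral>\<^sup>+t. ?f t * (if t < X \<omega> then 1 else 0) \<partial>lborel) + ennreal (1 / l) * ennreal (exp (- (l * X \<omega>))) \<partial>N)"
    unfolding A by (subst nn_integral_add) (auto simp: nn_integral_cmult)
  also have "\<dots> = (\<integral>\<^sup>+\<omega>. ennreal (1 / l) \<partial>N)"
    by (rule nn_integral_cong_AE) (use X_pos in eventually_elim, rule path)
  also have "\<dots> = ?A + G l"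
    using laplace[OF l] by (simp add: emeasure_space_1 tail_def G_def)
  finally have "ennreal (1 / l) * (\<integral>\<^sup>+\<omega>. ennreal (exp (- (l * X \<omega>))) \<partial>N) = G l"
    using laplace_finite[OF l] by (simp add: ennreal_add_left_cancel)
  then have "ennreal l * G l = ennreal l * ennreal (1 / l) * (\<integral>\<^sup>+\<omega>. ennreal (exp (- (l * X \<omega>))) \<partial>N)"
    by (simp add: mult.assoc)
  also have "ennreal l * ennreal (1 / l) = 1" using l by (simp add: ennreal_mult'[symmetric])
  finally show ?thesis by simp
qed

text \<open>The substitution \<open>a = l * b\<close> collects all dependence on \<open>l\<close> in
  \<open>l powr (3/2)\<close>. The Laplace transform becomes a mixture over \<open>b\<close> of
  functions \<open>exp (- c * l powr (3/2))\<close>, and powers of \<open>l\<close> can be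
  integrated out by Gamma integrals.\<close>

lemma G_scaled:
  assumes l: "0 < l"
  shows "ennreal l * G l = (\<integral>\<^sup>+b. ennreal (1 / (1 + b)\<^sup>2 * exp (- ((2 * sqrt 2 / 3 * ((1 + b) powr (3/2) - 1)) * l powr (3/2)))) * indicator {0<..} b \<partial>lborel)"
proof -
  let ?f = "\<lambda>a. 1 / (l + a)\<^sup>2 * exp (- (2 * sqrt 2 / 3 * ((l + a) powr (3/2) - l powr (3/2))))"
  have img: "(*) l ` {0<..} = {0<..}"
  proof (intro equalityI subsetI)
    fix y :: real assume "y \<in> {0<..}"
    then show "y \<in> (*) l ` {0<..}" using l by (intro image_eqI[of _ _ "y / l"]) auto
  qed (use l in auto)
  have "G l = (\<integral>\<^sup>+b. ennreal (\<bar>l\<bar> * ?f (l * b)) * indicator {0<..} b \<partial>lborel)"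
    unfolding G_def
    by (rule nn_integral_change_of_variables[OF _ _ _ img, symmetric])
      (use l in \<open>auto intro!: derivative_eq_intros inj_onI\<close>)
  then have "ennreal l * G l = (\<integral>\<^sup>+b. ennreal l * (ennreal (\<bar>l\<bar> * ?f (l * b)) * indicator {0<..} b) \<partial>lborel)"
    by (simp add: nn_integral_cmult)
  also have "\<dots> = (\<integral>\<^sup>+b. ennreal (1 / (1 + b)\<^sup>2 * exp (- ((2 * sqrt 2 / 3 * ((1 + b) powr (3/2) - 1)) * l powr (3/2)))) * indicator {0<..} b \<partial>lborel)"
  proof (rule nn_integral_cong)
    fix b :: real
    show "ennreal l * (ennreal (\<bar>l\<bar> * ?f (l * b)) * indicator {0<..} b)
      = ennreal (1 / (1 + b)\<^sup>2 * exp (- ((2 * sqrt 2 / 3 * ((1 + b) powr (3/2) - 1)) * l powr (3/2)))) * indicator {0<..} b"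
    proof (cases "0 < b")
      case True
      have "l + l * b = l * (1 + b)" by (simp add: algebra_simps)
      then have "?f (l * b) = 1 / (l\<^sup>2 * (1 + b)\<^sup>2) * exp (- ((2 * sqrt 2 / 3 * ((1 + b) powr (3/2) - 1)) * l powr (3/2)))"
        using l True by (simp only: powr_mult power_mult_distrib) (simp add: algebra_simps)
      then have "l * (\<bar>l\<bar> * ?f (l * b)) = 1 / (1 + b)\<^sup>2 * exp (- ((2 * sqrt 2 / 3 * ((1 + b) powr (3/2) - 1)) * l powr (3/2)))"
        using l True by (simp add: power2_eq_square)
      then show ?thesis using True l by (simp add: ennreal_mult'[symmetric])
    qed simp
  qed
  finally show ?thesis .
qed

text \<open>\<open>Gamma r * x powr (- r)\<close> is the integral of
  \<open>l powr (r - 1) * exp (- l * x)\<close> over \<open>l\<close>. For the mixture of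
  \<open>G_scaled\<close> the integral over \<open>l\<close> is a Gamma integral and the remaining
  one over \<open>b\<close> a Beta integral; each contributes a factor 2/3, hence 4/9. The second
  Beta argument is positive exactly for \<open>r < 3/2\<close>.\<close>

theorem negative_moment:
  assumes r: "0 < r" "r < 3/2"
  shows "ennreal (Gamma r) * (\<integral>\<^sup>+\<omega>. ennreal (X \<omega> powr (- r)) \<partial>N)
    = ennreal (4/9 * Gamma (2 * r / 3) * (2 * sqrt 2 / 3) powr (- (2 * r / 3)) * Beta (2/3 + 2 * r / 3) (1 - 2 * r / 3))"
proof -
  let ?c = "2 * sqrt 2 / 3 :: real"
  interpret pair_sigma_finite lborel N ..
  have "ennreal (Gamma r) * (\<integral>\<^sup>+\<omega>. ennreal (X \<omega> powr (- r)) \<partial>N) = (\<integral>\<^sup>+\<omega>. ennreal (Gamma r) * ennreal (X \<omega> powr (- r)) \<partial>N)"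
    by (rule nn_integral_cmult[symmetric]) measurable
  also have "\<dots> = (\<integral>\<^sup>+\<omega>. (\<integral>\<^sup>+l. ennreal (l powr (r - 1) * exp (- (l * X \<omega>))) * indicator {0<..} l \<partial>lborel) \<partial>N)"
  proof (rule nn_integral_cong_AE, use X_pos in eventually_elim)
    case (elim \<omega>)
    have "(\<integral>\<^sup>+l. ennreal (l powr (r - 1) * exp (- (l * X \<omega>))) * indicator {0<..} l \<partial>lborel)
      = (\<integral>\<^sup>+l. ennreal (l powr (r - 1) * exp (- (X \<omega> * l powr 1))) * indicator {0<..} l \<partial>lborel)"
      by (intro nn_integral_cong) (auto simp: indicator_def mult.commute)
    also have "\<dots> = ennreal (Gamma (r / 1) / 1 * X \<omega> powr (- r / 1))"
      using r elim by (intro nn_integral_gamma_power) auto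
    finally show ?case using r by (simp add: ennreal_mult' Gamma_real_nonneg)
  qed
  also have "\<dots> = (\<integral>\<^sup>+l. (\<integral>\<^sup>+\<omega>. ennreal (l powr (r - 1) * exp (- (l * X \<omega>))) * indicator {0<..} l \<partial>N) \<partial>lborel)"
    by (rule Fubini') measurable
  also have "\<dots> = (\<integral>\<^sup>+l. (\<integral>\<^sup>+b. ennreal (1 / (1 + b)\<^sup>2) * indicator {0<..} b *
      (ennreal (l powr (r - 1) * exp (- ((?c * ((1 + b) powr (3/2) - 1)) * l powr (3/2)))) * indicator {0<..} l) \<partial>lborel) \<partial>lborel)"
  proof (rule nn_integral_cong)
    fix l :: real
    show "(\<integral>\<^sup>+\<omega>. ennreal (l powr (r - 1) * exp (- (l * X \<omega>))) * indicator {0<..} l \<partial>N)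
      = (\<integral>\<^sup>+b. ennreal (1 / (1 + b)\<^sup>2) * indicator {0<..} b *
      (ennreal (l powr (r - 1) * exp (- ((?c * ((1 + b) powr (3/2) - 1)) * l powr (3/2)))) * indicator {0<..} l) \<partial>lborel)"
    proof (cases "0 < l")
      case True
      have "(\<integral>\<^sup>+\<omega>. ennreal (l powr (r - 1) * exp (- (l * X \<omega>))) * indicator {0<..} l \<partial>N)
        = (\<integral>\<^sup>+\<omega>. ennreal (l powr (r - 1)) * ennreal (exp (- (l * X \<omega>))) \<partial>N)"
        using True by (simp add: ennreal_mult')
      also have "\<dots> = ennreal (l powr (r - 1)) * (ennreal l * G l)"
        by (simp add: nn_integral_cmult laplace_transform True)
      also have "\<dots> = (\<integral>\<^sup>+b. ennreal (l powr (r - 1)) * (ennreal (1 / (1 + b)\<^sup>2 * exp (- ((?c * ((1 + b) powr (3/2) - 1)) * l powr (3/2)))) * indicator {0<..} b) \<partial>lborel)"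
        unfolding G_scaled[OF True] by (rule nn_integral_cmult[symmetric]) measurable
      also have "\<dots> = (\<integral>\<^sup>+b. ennreal (1 / (1 + b)\<^sup>2) * indicator {0<..} b *
        (ennreal (l powr (r - 1) * exp (- ((?c * ((1 + b) powr (3/2) - 1)) * l powr (3/2)))) * indicator {0<..} l) \<partial>lborel)"
      proof (rule nn_integral_cong)
        fix b :: real
        have gen: "ennreal p * (ennreal (q * E) * indicator {0<..} b) = ennreal q * indicator {0<..} b * (ennreal (p * E) * indicator {0<..} l)"
          if "0 \<le> p" "0 \<le> q" for p q E :: real
        proof -
          have "ennreal (q * E) = ennreal q * ennreal E" "ennreal (p * E) = ennreal p * ennreal E"
            using that by (simp_all only: ennreal_mult')
          then show ?thesis using True by (simp only:) (simp add: mult_ac)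
        qed
        show "ennreal (l powr (r - 1)) * (ennreal (1 / (1 + b)\<^sup>2 * exp (- ((?c * ((1 + b) powr (3/2) - 1)) * l powr (3/2)))) * indicator {0<..} b)
          = ennreal (1 / (1 + b)\<^sup>2) * indicator {0<..} b *
        (ennreal (l powr (r - 1) * exp (- ((?c * ((1 + b) powr (3/2) - 1)) * l powr (3/2)))) * indicator {0<..} l)"
          by (rule gen) auto
      qed
      finally show ?thesis .
    qed simp
  qed
  also have "\<dots> = (\<integral>\<^sup>+b. (\<integral>\<^sup>+l. ennreal (1 / (1 + b)\<^sup>2) * indicator {0<..} b *
      (ennreal (l powr (r - 1) * exp (- ((?c * ((1 + b) powr (3/2) - 1)) * l powr (3/2)))) * indicator {0<..} l) \<partial>lborel) \<partial>lborel)"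
    by (rule lborel_pair.Fubini') measurable
  also have "\<dots> = (\<integral>\<^sup>+b. ennreal (2/3 * Gamma (2 * r / 3) * ?c powr (- (2 * r / 3))) * (ennreal (1 / (1 + b)\<^sup>2 * ((1 + b) powr (3/2) - 1) powr (- (2 * r / 3))) * indicator {0<..} b) \<partial>lborel)"
  proof (rule nn_integral_cong)
    fix b :: real
    show "(\<integral>\<^sup>+l. ennreal (1 / (1 + b)\<^sup>2) * indicator {0<..} b *
      (ennreal (l powr (r - 1) * exp (- ((?c * ((1 + b) powr (3/2) - 1)) * l powr (3/2)))) * indicator {0<..} l) \<partial>lborel)
      = ennreal (2/3 * Gamma (2 * r / 3) * ?c powr (- (2 * r / 3))) * (ennreal (1 / (1 + b)\<^sup>2 * ((1 + b) powr (3/2) - 1) powr (- (2 * r / 3))) * indicator {0<..} b)"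
    proof (cases "0 < b")
      case True
      define K where "K = (1 + b) powr (3/2) - 1"
      have "1 powr (3/2) < (1 + b) powr (3/2)" using True by (intro powr_less_mono2) auto
      then have K: "0 < K" by (simp add: K_def)
      have g: "0 \<le> Gamma (2 * r / 3)" using r by (simp add: Gamma_real_nonneg)
      have "(\<integral>\<^sup>+l. ennreal (1 / (1 + b)\<^sup>2) * indicator {0<..} b *
          (ennreal (l powr (r - 1) * exp (- ((?c * K) * l powr (3/2)))) * indicator {0<..} l) \<partial>lborel)
        = ennreal (1 / (1 + b)\<^sup>2) * (\<integral>\<^sup>+l. ennreal (l powr (r - 1) * exp (- ((?c * K) * l powr (3/2)))) * indicator {0<..} l \<partial>lborel)"
        using True by (simp add: nn_integral_cmult)
      also have "(\<integral>\<^sup>+l. ennreal (l powr (r - 1) * exp (- ((?c * K) * l powr (3/2)))) * indicator {0<..} l \<partial>lborel)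
        = ennreal (Gamma (r / (3/2)) / (3/2) * (?c * K) powr (- r / (3/2)))"
        using K r by (intro nn_integral_gamma_power) auto
      also have "Gamma (r / (3/2)) / (3/2) * (?c * K) powr (- r / (3/2)) = 2/3 * Gamma (2 * r / 3) * ?c powr (- (2 * r / 3)) * K powr (- (2 * r / 3))"
      proof -
        have "r / (3/2) = 2 * r / 3" "- r / (3/2) = - (2 * r / 3)" by simp_all
        then show ?thesis by (simp only: powr_mult) simp
      qed
      also have "ennreal (1 / (1 + b)\<^sup>2) * ennreal (2/3 * Gamma (2 * r / 3) * ?c powr (- (2 * r / 3)) * K powr (- (2 * r / 3)))
        = ennreal (1 / (1 + b)\<^sup>2 * (2/3 * Gamma (2 * r / 3) * ?c powr (- (2 * r / 3)) * K powr (- (2 * r / 3))))"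
        by (rule ennreal_mult'[symmetric]) simp
      also have "1 / (1 + b)\<^sup>2 * (2/3 * Gamma (2 * r / 3) * ?c powr (- (2 * r / 3)) * K powr (- (2 * r / 3)))
         = 2/3 * Gamma (2 * r / 3) * ?c powr (- (2 * r / 3)) * (1 / (1 + b)\<^sup>2 * K powr (- (2 * r / 3)))" by simp
      also have "ennreal (2/3 * Gamma (2 * r / 3) * ?c powr (- (2 * r / 3)) * (1 / (1 + b)\<^sup>2 * K powr (- (2 * r / 3))))
         = ennreal (2/3 * Gamma (2 * r / 3) * ?c powr (- (2 * r / 3))) * ennreal (1 / (1 + b)\<^sup>2 * K powr (- (2 * r / 3)))"
        using g by (intro ennreal_mult') auto
      finally show ?thesis using True by (simp add: K_def)
    qed simp
  qed
  also have "\<dots> = ennreal (2/3 * Gamma (2 * r / 3) * ?c powr (- (2 * r / 3))) * (\<integral>\<^sup>+b. ennreal (1 / (1 + b)\<^sup>2 * ((1 + b) powr (3/2) - 1) powr (- (2 * r / 3))) * indicator {0<..} b \<partial>lborel)"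
    by (rule nn_integral_cmult) measurable
  also have "(\<integral>\<^sup>+b. ennreal (1 / (1 + b)\<^sup>2 * ((1 + b) powr (3/2) - 1) powr (- (2 * r / 3))) * indicator {0<..} b \<partial>lborel)
    = ennreal (2/3 * Beta (2/3 + 2 * r / 3) (1 - 2 * r / 3))"
    using r by (intro nn_integral_beta_variant) auto
  also have "ennreal (2/3 * Gamma (2 * r / 3) * ?c powr (- (2 * r / 3))) * ennreal (2/3 * Beta (2/3 + 2 * r / 3) (1 - 2 * r / 3))
    = ennreal (2/3 * Gamma (2 * r / 3) * ?c powr (- (2 * r / 3)) * (2/3 * Beta (2/3 + 2 * r / 3) (1 - 2 * r / 3)))"
    using r by (intro ennreal_mult'[symmetric]) (auto simp: Gamma_real_nonneg)
  finally show ?thesis by (simp add: mult_ac)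
qed


section \<open>Decay of the tail and moments of positive order\<close>

text \<open>The terms of order \<open>1 / l\<close> cancel in the difference of the Laplace transforms of \<^const>\<open>tail\<close>
  at \<open>l\<close> and \<open>2 * l\<close>.\<close>

lemma laplace_difference:
  assumes l: "0 < l"
  shows "ennreal (1 / (2 * l)) + G (2 * l) \<le> G l + ennreal (2 * sqrt 2 / 3 * (2 * l) powr (3/2) / l)"
proof -
  let ?c = "2 * sqrt 2 / 3 :: real"
  define D where "D = ?c * (2 * l) powr (3/2)"
  have D: "0 \<le> D" by (simp add: D_def)
  have tail_integral: "(\<integral>\<^sup>+a. ennreal (1 / (l + a)\<^sup>2) * indicator {s<..} a \<partial>lborel) = ennreal (1 / (l + s))" if "0 \<le> s" for s
  proof -
    have "(\<integral>\<^sup>+a. ennreal (1 / (l + a)\<^sup>2) * indicator {s<..} a \<partial>lborel) = (\<integral>\<^sup>+a. ennreal (1 / (l + a)\<^sup>2) * indicator {s..} a \<partial>lborel)"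
      using AE_lborel_singleton[of s] by (intro nn_integral_cong_AE) (auto simp: indicator_def elim!: eventually_mono)
    also have "\<dots> = ennreal (0 - (- 1 / (l + s)))"
    proof (rule nn_integral_FTC_atLeast)
      fix x assume "s \<le> x"
      then have "l + x \<noteq> 0" using l that by auto
      then show "((\<lambda>a. - 1 / (l + a)) has_real_derivative 1 / (l + x)\<^sup>2) (at x)"
        by (auto intro!: derivative_eq_intros simp: power2_eq_square)
    next
      show "((\<lambda>a. - 1 / (l + a)) \<longlongrightarrow> 0) at_top" by real_asymp
    qed auto
    finally show ?thesis by simp
  qed
  \<comment> \<open>Shifting the level by \<open>l\<close> gives \<open>G (2 * l)\<close> the same
    weight \<open>1 / (l + a)^2\<close> as \<open>G l\<close>, on the half-line above
    \<open>l\<close>; the weight below \<open>l\<close> has mass \<open>1 / (2 * l)\<close>.\<close>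
  have G2: "G (2 * l) = (\<integral>\<^sup>+a. ennreal (1 / (l + a)\<^sup>2 * exp (- (?c * ((l + a) powr (3/2) - (2 * l) powr (3/2))))) * indicator {l<..} a \<partial>lborel)"
  proof -
    have img: "(\<lambda>a. a - l) ` {l<..} = {0<..}"
    proof (intro equalityI subsetI)
      fix y :: real assume "y \<in> {0<..}"
      then show "y \<in> (\<lambda>a. a - l) ` {l<..}" by (intro image_eqI[of _ _ "y + l"]) auto
    qed auto
    have "G (2 * l) = (\<integral>\<^sup>+a. ennreal (\<bar>1\<bar> * (1 / (2 * l + (a - l))\<^sup>2 * exp (- (?c * ((2 * l + (a - l)) powr (3/2) - (2 * l) powr (3/2)))))) * indicator {l<..} a \<partial>lborel)"
      unfolding G_def by (rule nn_integral_change_of_variables[OF _ _ _ img, symmetric]) (auto intro!: derivative_eq_intros inj_onI)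
    then show ?thesis by simp
  qed
  have half: "ennreal (1 / (2 * l)) = (\<integral>\<^sup>+a. ennreal (1 / (l + a)\<^sup>2) * indicator {0<..l} a \<partial>lborel)"
  proof -
    have "(\<integral>\<^sup>+a. ennreal (1 / (l + a)\<^sup>2) * indicator {0<..l} a \<partial>lborel)
      = (\<integral>\<^sup>+a. ennreal (1 / (l + a)\<^sup>2) * indicator {0<..} a * (if a \<le> l then 1 else 0) \<partial>lborel)"
      by (intro nn_integral_cong) (auto simp: indicator_def)
    also have "\<dots> = ennreal (1 / l - 1 / (l + l))" using l by (intro nn_integral_inverse_square) auto
    also have "1 / l - 1 / (l + l) = 1 / (2 * l)" using l by (simp add: field_simps)
    finally show ?thesis by simp
  qed
  \<comment> \<open>Replacing an exponential factor by 1 costs at most its exponent, and every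
    exponent to which this is applied is at most \<open>D\<close>.\<close>
  have exp_le: "1 \<le> exp (- y) + y" for y :: real using exp_ge_add_one_self[of "- y"] by simp
  have mono: "l powr (3/2) \<le> (l + a) powr (3/2)" if "0 < a" for a using that l by (intro powr_mono2) auto
  have "ennreal (1 / (2 * l)) + G (2 * l)
    = (\<integral>\<^sup>+a. ennreal (1 / (l + a)\<^sup>2) * indicator {0<..l} a + ennreal (1 / (l + a)\<^sup>2 * exp (- (?c * ((l + a) powr (3/2) - (2 * l) powr (3/2))))) * indicator {l<..} a \<partial>lborel)"
    unfolding half G2 by (rule nn_integral_add[symmetric]) measurable
  also have "\<dots> \<le> (\<integral>\<^sup>+a. ennreal (1 / (l + a)\<^sup>2 * exp (- (?c * ((l + a) powr (3/2) - l powr (3/2))))) * indicator {0<..} a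
      + ennreal D * (ennreal (1 / (l + a)\<^sup>2) * indicator {0<..} a) \<partial>lborel)"
  proof (rule nn_integral_mono)
    fix a :: real
    define q where "q = 1 / (l + a)\<^sup>2"
    define e where "e = exp (- (?c * ((l + a) powr (3/2) - l powr (3/2))))"
    have q: "0 \<le> q" by (simp add: q_def)
    have comb: "ennreal (q * e) + ennreal D * ennreal q = ennreal (q * (e + D))"
      using q D by (simp add: ennreal_mult'[symmetric] ennreal_plus[symmetric] e_def algebra_simps del: ennreal_plus)
    consider "a \<le> 0" | "0 < a" "a \<le> l" | "l < a" by linarith
    then show "ennreal (1 / (l + a)\<^sup>2) * indicator {0<..l} a + ennreal (1 / (l + a)\<^sup>2 * exp (- (?c * ((l + a) powr (3/2) - (2 * l) powr (3/2))))) * indicator {l<..} a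
      \<le> ennreal (1 / (l + a)\<^sup>2 * exp (- (?c * ((l + a) powr (3/2) - l powr (3/2))))) * indicator {0<..} a
      + ennreal D * (ennreal (1 / (l + a)\<^sup>2) * indicator {0<..} a)"
    proof cases
      case 1
      then show ?thesis using l by simp
    next
      case 2
      have "?c * ((l + a) powr (3/2) - l powr (3/2)) \<le> ?c * (2 * l) powr (3/2)"
      proof (rule mult_left_mono)
        have "(l + a) powr (3/2) \<le> (2 * l) powr (3/2)" using 2 l by (intro powr_mono2) auto
        then show "(l + a) powr (3/2) - l powr (3/2) \<le> (2 * l) powr (3/2)"
          using powr_ge_zero[of l "3/2"] by linarith
      qed simp
      then have "1 \<le> e + D" using exp_le[of "?c * ((l + a) powr (3/2) - l powr (3/2))"] unfolding e_def D_def by linarith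
      then have "q \<le> q * (e + D)" using mult_left_mono[of 1 "e + D" q] q by simp
      then have "ennreal q \<le> ennreal (q * e) + ennreal D * ennreal q" unfolding comb by (rule ennreal_leI)
      then show ?thesis using 2 by (simp add: q_def e_def)
    next
      case 3
      define z where "z = ?c * ((l + a) powr (3/2) - (2 * l) powr (3/2))"
      have "(2 * l) powr (3/2) \<le> (l + a) powr (3/2)" using 3 l by (intro powr_mono2) auto
      then have z: "0 \<le> z" unfolding z_def by (intro mult_nonneg_nonneg) auto
      have "?c * ((l + a) powr (3/2) - l powr (3/2)) = z + ?c * ((2 * l) powr (3/2) - l powr (3/2))"
        by (simp add: z_def algebra_simps)
      also have "\<dots> \<le> z + D" unfolding D_def by (simp add: mult_left_mono)
      finally have "e \<ge> exp (- (z + D))" by (simp add: e_def)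
      moreover have "exp (- z) * 1 \<le> exp (- z) * (exp (- D) + D)" by (intro mult_left_mono exp_le) simp
      moreover have "exp (- z) * D \<le> 1 * D" using z D by (intro mult_right_mono) auto
      moreover have "exp (- (z + D)) = exp (- z) * exp (- D)" by (simp add: exp_add[symmetric])
      ultimately have "exp (- z) \<le> e + D" by (simp add: algebra_simps)
      then have "q * exp (- z) \<le> q * (e + D)" using q by (rule mult_left_mono)
      then have "ennreal (q * exp (- z)) \<le> ennreal (q * e) + ennreal D * ennreal q" unfolding comb by (rule ennreal_leI)
      then show ?thesis using 3 l by (simp add: q_def e_def z_def)
    qed
  qed
  also have "\<dots> = G l + ennreal D * (\<integral>\<^sup>+a. ennreal (1 / (l + a)\<^sup>2) * indicator {0<..} a \<partial>lborel)"
    unfolding G_def by (subst nn_integral_add) (auto simp: nn_integral_cmult)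
  also have "\<dots> = G l + ennreal (D / l)"
    using tail_integral[of 0] l D by (simp add: ennreal_mult'[symmetric])
  finally show ?thesis by (simp add: D_def)
qed

text \<open>By \<open>laplace_difference\<close> the Laplace transforms of \<open>tail\<close> at
  \<open>1 / T\<close> and \<open>2 / T\<close> differ by at most the order
  \<open>T powr (- (1/2))\<close>. The integrand of the difference is nonnegative and, by
  monotonicity, at least a constant times \<open>tail T\<close> on \<open>[T/2, T]\<close>, which
  contributes the order \<open>T * tail T\<close>.\<close>

lemma tail_bound:
  obtains C where "0 < C" "\<And>t. 0 < t \<Longrightarrow> tail t \<le> C * t powr (- (3/2))"
proof -
  \<comment> \<open>Lower bound for \<open>exp (- u) * (1 - exp (- u))\<close> on
    \<open>1/2 \<le> u \<le> 1\<close>, the range of \<open>l * t\<close> on \<open>[T/2, T]\<close>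
    for \<open>l = 1 / T\<close>.\<close>
  define k where "k = exp (- 1) * (1 - exp (- (1/2 :: real)))"
  have k: "0 < k" by (simp add: k_def)
  \<comment> \<open>The constant of \<open>laplace_difference\<close> at \<open>l = 1 / T\<close>,
    without its factor \<open>T powr (- (1/2))\<close>.\<close>
  define K where "K = 2 * sqrt 2 / 3 * 2 powr (3/2 :: real)"
  have K: "0 < K" by (simp add: K_def)
  have "tail T \<le> 2 * K / k * T powr (- (3/2))" if T: "0 < T" for T
  proof -
    define l where "l = 1 / T"
    have l: "0 < l" using T by (simp add: l_def)
    let ?A = "\<lambda>l. \<integral>\<^sup>+t. ennreal (exp (- (l * t)) * tail t) * indicator {0..} t \<partial>lborel"
    have A: "?A l + G l = ennreal (1 / l)" "?A (2 * l) + G (2 * l) = ennreal (1 / (2 * l))"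
      using laplace[of l] laplace[of "2 * l"] l by (simp_all add: tail_def G_def)
    have fin: "G l \<noteq> \<infinity>" "G (2 * l) \<noteq> \<infinity>" "?A (2 * l) \<noteq> \<infinity>"
      using A by (metis ennreal_add_eq_top ennreal_neq_top infinity_ennreal_def)+
    have D: "2 * sqrt 2 / 3 * (2 * l) powr (3/2) / l = K * T powr (- (1/2))"
    proof -
      have "(2 * l) powr (3/2) = 2 powr (3/2) * T powr (- (3/2))"
        using T by (simp add: l_def powr_divide powr_minus_divide)
      moreover have "T powr (- (1/2)) = T powr (- (3/2)) * T powr 1" unfolding powr_add[symmetric] by simp
      ultimately show ?thesis using T by (simp add: K_def l_def)
    qed
    \<comment> \<open>The inequality between differences is derived in additive form: the finite
      terms \<open>G l\<close> and \<open>G (2 * l)\<close> are carried on both sides and cancelled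
      at the end.\<close>
    have "?A l + G l + G (2 * l) = (?A (2 * l) + G (2 * l)) + (ennreal (1 / (2 * l)) + G (2 * l))"
      unfolding A using l by (simp add: ennreal_plus[symmetric] add.assoc[symmetric] del: ennreal_plus)
    also have "\<dots> \<le> (?A (2 * l) + G (2 * l)) + (G l + ennreal (K * T powr (- (1/2))))"
      using laplace_difference[OF l] unfolding D by (intro add_left_mono)
    also have "\<dots> = (G l + G (2 * l)) + (?A (2 * l) + ennreal (K * T powr (- (1/2))))" by (simp add: ac_simps)
    finally have "(G l + G (2 * l)) + ?A l \<le> (G l + G (2 * l)) + (?A (2 * l) + ennreal (K * T powr (- (1/2))))" by (simp add: ac_simps)
    then have AA: "?A l \<le> ?A (2 * l) + ennreal (K * T powr (- (1/2)))"
      using fin by (simp add: ennreal_add_left_cancel_le)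
    have pos: "0 \<le> exp (- (l * t)) - exp (- (2 * l * t))" if "0 \<le> t" for t
      using that l by simp
    have "?A l = (\<integral>\<^sup>+t. ennreal (exp (- (2 * l * t)) * tail t) * indicator {0..} t
        + ennreal ((exp (- (l * t)) - exp (- (2 * l * t))) * tail t) * indicator {0..} t \<partial>lborel)"
    proof (rule nn_integral_cong)
      fix t :: real
      show "ennreal (exp (- (l * t)) * tail t) * indicator {0..} t = ennreal (exp (- (2 * l * t)) * tail t) * indicator {0..} t
        + ennreal ((exp (- (l * t)) - exp (- (2 * l * t))) * tail t) * indicator {0..} t"
      proof (cases "0 \<le> t")
        case True
        have "exp (- (l * t)) * tail t = exp (- (2 * l * t)) * tail t + (exp (- (l * t)) - exp (- (2 * l * t))) * tail t"
          by (simp add: left_diff_distrib)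
        also have "ennreal \<dots> = ennreal (exp (- (2 * l * t)) * tail t) + ennreal ((exp (- (l * t)) - exp (- (2 * l * t))) * tail t)"
          using pos[OF True] tail_bounds[of t] by (intro ennreal_plus mult_nonneg_nonneg) auto
        finally show ?thesis using True by simp
      qed simp
    qed
    also have "\<dots> = ?A (2 * l) + (\<integral>\<^sup>+t. ennreal ((exp (- (l * t)) - exp (- (2 * l * t))) * tail t) * indicator {0..} t \<partial>lborel)"
      by (rule nn_integral_add) measurable
    finally have ub: "(\<integral>\<^sup>+t. ennreal ((exp (- (l * t)) - exp (- (2 * l * t))) * tail t) * indicator {0..} t \<partial>lborel) \<le> ennreal (K * T powr (- (1/2)))"
      using AA fin(3) by (simp add: ennreal_add_left_cancel_le)
    have lb: "(\<integral>\<^sup>+t. ennreal (k * tail T) * indicator {T/2..T} t \<partial>lborel)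
      \<le> (\<integral>\<^sup>+t. ennreal ((exp (- (l * t)) - exp (- (2 * l * t))) * tail t) * indicator {0..} t \<partial>lborel)"
    proof (rule nn_integral_mono)
      fix t :: real
      have "k * tail T \<le> (exp (- (l * t)) - exp (- (2 * l * t))) * tail t" if t: "T / 2 \<le> t" "t \<le> T"
      proof -
        have u: "1/2 \<le> l * t" "l * t \<le> 1" using t T by (auto simp: l_def field_simps)
        have "k \<le> exp (- (l * t)) * (1 - exp (- (l * t)))"
          unfolding k_def using u by (intro mult_mono) auto
        also have "\<dots> = exp (- (l * t)) - exp (- (2 * l * t))"
          by (simp add: right_diff_distrib exp_add[symmetric])
        finally have "k \<le> exp (- (l * t)) - exp (- (2 * l * t))" .
        then show ?thesis using tail_antimono[OF t(2)] tail_bounds[of T] k by (intro mult_mono) linarith+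
      qed
      then show "ennreal (k * tail T) * indicator {T/2..T} t \<le> ennreal ((exp (- (l * t)) - exp (- (2 * l * t))) * tail t) * indicator {0..} t"
        using T by (auto simp: indicator_def intro!: ennreal_leI)
    qed
    have ev: "(\<integral>\<^sup>+t. ennreal (k * tail T) * indicator {T/2..T} t \<partial>lborel) = ennreal (k * tail T * (T / 2))"
    proof -
      have "emeasure lborel {T/2..T} = ennreal (T / 2)" using T by simp
      then have "(\<integral>\<^sup>+t. ennreal (k * tail T) * indicator {T/2..T} t \<partial>lborel) = ennreal (k * tail T) * ennreal (T / 2)"
        by (subst nn_integral_cmult_indicator) simp_all
      also have "\<dots> = ennreal (k * tail T * (T / 2))"
        by (rule ennreal_mult'[symmetric]) (use k tail_bounds(1)[of T] in simp)
      finally show ?thesis .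
    qed
    have "ennreal (k * tail T * (T / 2)) \<le> ennreal (K * T powr (- (1/2)))"
      using order_trans[OF lb ub] unfolding ev .
    moreover have "0 \<le> K * T powr (- (1/2))" using K by simp
    ultimately have le: "k * tail T * (T / 2) \<le> K * T powr (- (1/2))" by (simp only: ennreal_le_iff)
    define p where "p = T powr (- (1/2))"
    have "T powr (- (3/2)) = T powr (- (1/2) - 1)" by simp
    also have "\<dots> = p / T" using T unfolding p_def powr_diff by simp
    finally have p: "T powr (- (3/2)) = p / T" .
    have c: "0 \<le> 2 / (k * T)" using k T by simp
    have 1: "tail T = k * tail T * (T / 2) * (2 / (k * T))" using k T by simp
    have 2: "k * tail T * (T / 2) * (2 / (k * T)) \<le> K * p * (2 / (k * T))"
      unfolding p_def by (rule mult_right_mono[OF le c])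
    have 3: "K * p * (2 / (k * T)) = 2 * K / k * (p / T)" by simp
    show ?thesis unfolding p 3[symmetric] using 1 2 by linarith
  qed
  moreover have "0 < 2 * K / k" using k K by simp
  ultimately show ?thesis by (intro that)
qed

text \<open>Bounding \<open>x powr s\<close> by 1 plus the integral of its derivative over
  \<open>[1, x]\<close> involves the tail only from 1 on. There the decay of order
  \<open>t powr (- (3/2))\<close> leaves the exponent \<open>s - 5/2\<close>, integrable at infinity
  for \<open>s < 3/2\<close>.\<close>

lemma positive_moment_finite:
  assumes s: "0 < s" "s < 3/2"
  shows "(\<integral>\<^sup>+\<omega>. ennreal (X \<omega> powr s) \<partial>N) < \<infinity>"
proof -
  obtain C where C: "0 < C" "\<And>t. 0 < t \<Longrightarrow> tail t \<le> C * t powr (- (3/2))" using tail_bound by blast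
  let ?f = "\<lambda>t. ennreal (s * t powr (s - 1)) * indicator {1..} t"
  have path: "ennreal (x powr s) \<le> 1 + (\<integral>\<^sup>+t. ?f t * (if t < x then 1 else 0) \<partial>lborel)" if "0 < x" for x
  proof (cases "x \<le> 1")
    case True
    then have "x powr s \<le> 1" using that s powr_mono2[of s x 1] by simp
    then have "ennreal (x powr s) \<le> ennreal 1" by (rule ennreal_leI)
    also have "ennreal 1 \<le> 1 + (\<integral>\<^sup>+t. ?f t * (if t < x then 1 else 0) \<partial>lborel)" by (simp add: add_increasing2)
    finally show ?thesis .
  next
    case False
    have "(\<integral>\<^sup>+t. ?f t * (if t < x then 1 else 0) \<partial>lborel) = (\<integral>\<^sup>+t. ennreal (s * t powr (s - 1)) * indicator {1..x} t \<partial>lborel)"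
      using AE_lborel_singleton[of x] by (intro nn_integral_cong_AE) (auto simp: indicator_def elim!: eventually_mono)
    also have "\<dots> = ennreal (x powr s - 1 powr s)"
      by (rule nn_integral_FTC_Icc) (use False s in \<open>auto intro!: derivative_eq_intros\<close>)
    finally have "1 + (\<integral>\<^sup>+t. ?f t * (if t < x then 1 else 0) \<partial>lborel) = ennreal 1 + ennreal (x powr s - 1)" by simp
    also have "\<dots> = ennreal (1 + (x powr s - 1))" using False s by (intro ennreal_plus[symmetric]) (auto simp: ge_one_powr_ge_zero)
    finally show ?thesis by simp
  qed
  have "(\<integral>\<^sup>+t. ?f t * ennreal (tail t) \<partial>lborel) \<le> (\<integral>\<^sup>+t. ennreal (s * C * t powr (s - 5/2)) * indicator {1..} t \<partial>lborel)"
  proof (rule nn_integral_mono)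
    fix t :: real
    have "s * t powr (s - 1) * tail t \<le> s * C * t powr (s - 5/2)" if "1 \<le> t"
    proof -
      have "s * t powr (s - 1) * tail t \<le> s * t powr (s - 1) * (C * t powr (- (3/2)))"
        using that s C by (intro mult_left_mono) auto
      also have "\<dots> = s * C * (t powr (s - 1) * t powr (- (3/2)))" by simp
      finally show ?thesis unfolding powr_add[symmetric] by simp
    qed
    then show "?f t * ennreal (tail t) \<le> ennreal (s * C * t powr (s - 5/2)) * indicator {1..} t"
      using s by (auto simp: indicator_def ennreal_mult'[symmetric] intro!: ennreal_leI)
  qed
  also have "\<dots> = ennreal (0 - s * C / (s - 3/2) * 1 powr (s - 3/2))"
  proof (rule nn_integral_FTC_atLeast)
    show "((\<lambda>t. s * C / (s - 3/2) * t powr (s - 3/2)) has_real_derivative s * C * x powr (s - 5/2)) (at x)" if "1 \<le> x" for x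
      using that s by (auto intro!: derivative_eq_intros)
    have "((\<lambda>t. t powr (s - 3/2)) \<longlongrightarrow> 0) at_top" using s by (intro tendsto_neg_powr filterlim_ident) auto
    then show "((\<lambda>t. s * C / (s - 3/2) * t powr (s - 3/2)) \<longlongrightarrow> 0) at_top" by (rule tendsto_mult_right_zero)
  qed (use s C in auto)
  finally have fin: "(\<integral>\<^sup>+t. ?f t * ennreal (tail t) \<partial>lborel) < \<infinity>" by (rule le_less_trans) simp
  have "(\<integral>\<^sup>+\<omega>. ennreal (X \<omega> powr s) \<partial>N) \<le> (\<integral>\<^sup>+\<omega>. 1 + (\<integral>\<^sup>+t. ?f t * (if t < X \<omega> then 1 else 0) \<partial>lborel) \<partial>N)"
    by (rule nn_integral_mono_AE) (use X_pos in eventually_elim, rule path)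
  also have "\<dots> = 1 + (\<integral>\<^sup>+t. ?f t * ennreal (tail t) \<partial>lborel)"
  proof -
    have "(\<integral>\<^sup>+\<omega>. (\<integral>\<^sup>+t. ?f t * (if t < X \<omega> then 1 else 0) \<partial>lborel) \<partial>N) = (\<integral>\<^sup>+t. ?f t * ennreal (tail t) \<partial>lborel)"
      by (rule layer_cake) measurable
    moreover have "(\<integral>\<^sup>+\<omega>. 1 + (\<integral>\<^sup>+t. ?f t * (if t < X \<omega> then 1 else 0) \<partial>lborel) \<partial>N)
      = (\<integral>\<^sup>+\<omega>. 1 \<partial>N) + (\<integral>\<^sup>+\<omega>. (\<integral>\<^sup>+t. ?f t * (if t < X \<omega> then 1 else 0) \<partial>lborel) \<partial>N)"
      by (rule nn_integral_add) measurable
    ultimately show ?thesis by (simp only: nn_integral_const emeasure_space_1 mult_1)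
  qed
  finally have le: "(\<integral>\<^sup>+\<omega>. ennreal (X \<omega> powr s) \<partial>N) \<le> 1 + (\<integral>\<^sup>+t. ?f t * ennreal (tail t) \<partial>lborel)" .
  have "1 + (\<integral>\<^sup>+t. ?f t * ennreal (tail t) \<partial>lborel) < \<infinity>" using fin by simp
  with le show ?thesis by (rule le_less_trans)
qed

lemma negative_moment_finite:
  assumes r: "0 < r" "r < 3/2"
  shows "(\<integral>\<^sup>+\<omega>. ennreal (X \<omega> powr (- r)) \<partial>N) < \<infinity>"
proof -
  have g: "0 < Gamma r" using r(1) by (rule Gamma_real_pos)
  show ?thesis
  proof (rule ccontr)
    assume *: "\<not> ?thesis"
    have "(\<integral>\<^sup>+\<omega>. ennreal (X \<omega> powr (- r)) \<partial>N) = top"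
      using * unfolding infinity_ennreal_def less_top[symmetric] by (rule notnotD)
    then have "ennreal (Gamma r) * top
      = ennreal (4/9 * Gamma (2 * r / 3) * (2 * sqrt 2 / 3) powr (- (2 * r / 3)) * Beta (2/3 + 2 * r / 3) (1 - 2 * r / 3))"
      using negative_moment[OF r] by (simp only:)
    moreover have "ennreal (Gamma r) * top = top" using g by (simp add: ennreal_mult_eq_top_iff)
    ultimately show False using ennreal_neq_top by (metis (no_types))
  qed
qed

lemma integrable_moment:
  assumes "- 3/2 < s" "s < 3/2"
  shows "integrable N (\<lambda>\<omega>. X \<omega> powr s)"
proof -
  consider "s < 0" | "s = 0" | "0 < s" by linarith
  then have "(\<integral>\<^sup>+\<omega>. ennreal (X \<omega> powr s) \<partial>N) < \<infinity>"
  proof cases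
    case 1
    then show ?thesis using negative_moment_finite[of "- s"] assms by simp
  next
    case 2
    \<comment> \<open>\<open>x powr 0\<close> is 0 at \<open>x = 0\<close> and 1 otherwise, so
      pointwise only an inequality holds.\<close>
    have "(\<integral>\<^sup>+\<omega>. ennreal (X \<omega> powr s) \<partial>N) \<le> (\<integral>\<^sup>+\<omega>. 1 \<partial>N)"
      using 2 by (intro nn_integral_mono) (simp add: powr_def)
    also have "\<dots> < \<infinity>" by (simp add: emeasure_space_1)
    finally show ?thesis .
  next
    case 3
    then show ?thesis using assms by (intro positive_moment_finite) auto
  qed
  then show ?thesis by (intro integrableI_nonneg) auto
qed

end

lemma pos_notin_nonpos_Ints: "0 < x \<Longrightarrow> (x :: real) \<notin> \<int>\<^sub>\<le>\<^sub>0"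
  by (auto simp: nonpos_Ints_def)

section \<open>The four formulas\<close>

text \<open>Powers of 2 are written as exponentials here, as are powers of 3 in the triplication
  formula, so that exponents can simply be added when the formulas are compared.\<close>

lemma Gamma_duplication_real:
  fixes x :: real
  assumes "0 < x"
  shows "Gamma (2 * x) = 1 / (2 * sqrt pi) * exp (2 * x * ln 2) * (Gamma x * Gamma (x + 1/2))"
proof -
  let ?z = "complex_of_real x"
  have "?z \<notin> \<int>\<^sub>\<le>\<^sub>0" "?z + 1/2 \<notin> \<int>\<^sub>\<le>\<^sub>0"
    using assms by (auto simp: nonpos_Ints_def complex_eq_iff)
  from Gamma_legendre_duplication[OF this]
  have "complex_of_real (Gamma x * Gamma (x + 1/2)) = of_real (exp ((1 - 2 * x) * ln 2) * sqrt pi * Gamma (2 * x))"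
    by (simp flip: Gamma_complex_of_real exp_of_real)
  then have "Gamma x * Gamma (x + 1/2) = exp ((1 - 2 * x) * ln 2) * sqrt pi * Gamma (2 * x)"
    by (simp only: of_real_eq_iff)
  moreover have "exp ((1 - 2 * x) * ln 2) * exp (2 * x * ln 2) = (2 :: real)"
    by (simp add: exp_add[symmetric] algebra_simps)
  ultimately show ?thesis by (simp add: field_simps)
qed

text \<open>Bohr--Mollerup; the value of the constant is not needed, since the formulas to be compared
  agree at \<open>s = 0\<close>.\<close>

lemma Gamma_triplication_real:
  obtains t :: real where "0 < t"
    "\<And>x. 0 < x \<Longrightarrow> Gamma (3 * x) = t * exp (3 * x * ln 3) * (Gamma x * Gamma (x + 1/3) * Gamma (x + 2/3))"
proof -
  \<comment> \<open>Chosen for \<open>H 1 = 1\<close>, the normalisation in the characterisation of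
    \<open>Gamma\<close>; the 3 compensates \<open>exp (ln 3)\<close>.\<close>
  define K :: real where "K = 1 / (3 * Gamma (1/3) * Gamma (2/3))"
  define H where "H = (\<lambda>y. K * exp (y * ln 3) * (Gamma (y / 3) * Gamma (y / 3 + 1/3) * Gamma (y / 3 + 2/3)))"
  have pos: "0 < Gamma y" if "0 < y" for y :: real using that by (rule Gamma_real_pos)
  have K: "0 < K" by (simp add: K_def pos)
  have Hpos: "0 < H y" if "0 < y" for y using that K by (simp add: H_def pos)
  have eq: "H y = Gamma y" if "0 < y" for y
  proof (rule Gamma_pos_real_unique[OF _ _ _ _ that])
    show "H 1 = 1" using pos[of "1/3", THEN less_imp_neq] pos[of "2/3", THEN less_imp_neq] by (simp add: H_def K_def)
    show "H (x + 1) = x * H x" if "0 < x" for x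
    proof -
      have "Gamma (x / 3 + 1) = x / 3 * Gamma (x / 3)" using that by (intro Gamma_plus1 pos_notin_nonpos_Ints) simp
      moreover have "exp ((x + 1) * ln 3) = 3 * exp (x * ln (3::real))" by (simp add: distrib_right exp_add)
      moreover have "(x + 1) / 3 = x / 3 + 1/3" "(x + 1) / 3 + 1/3 = x / 3 + 2/3" "(x + 1) / 3 + 2/3 = x / 3 + 1" by (simp_all add: add_divide_distrib)
      ultimately show ?thesis unfolding H_def by (simp only:) simp
    qed
    show "0 < H x" if "0 < x" for x using that by (rule Hpos)
    have ln_H: "ln (H x) = ln K + x * ln 3 + (ln (Gamma (x / 3)) + ln (Gamma (x / 3 + 1/3)) + ln (Gamma (x / 3 + 2/3)))" if "0 < x" for x
    proof -
      have p: "0 < Gamma (x / 3)" "0 < Gamma (x / 3 + 1/3)" "0 < Gamma (x / 3 + 2/3)" using that by (auto intro!: pos)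
      show ?thesis unfolding H_def using p K by (simp add: ln_mult)
    qed
    \<comment> \<open>Log-convexity through a monotone derivative: each Gamma factor contributes a
      Digamma function, which is nondecreasing on the positive reals.\<close>
    show "convex_on {0<..} (ln \<circ> H)"
    proof (rule convex_on_realI)
      show "connected {0::real<..}" by simp
      fix x :: real assume x: "x \<in> {0<..}"
      have "((\<lambda>x. ln K + x * ln 3 + (ln (Gamma (x / 3)) + ln (Gamma (x / 3 + 1/3)) + ln (Gamma (x / 3 + 2/3)))) has_real_derivative
        ln 3 + (Digamma (x / 3) + Digamma (x / 3 + 1/3) + Digamma (x / 3 + 2/3)) / 3) (at x)"
      proof -
        have p: "0 < Gamma (x / 3)" "0 < Gamma (x / 3 + 1/3)" "0 < Gamma (x / 3 + 2/3)" using x by (auto intro!: pos)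
        have n: "x / 3 \<notin> \<int>\<^sub>\<le>\<^sub>0" "x / 3 + 1/3 \<notin> \<int>\<^sub>\<le>\<^sub>0" "x / 3 + 2/3 \<notin> \<int>\<^sub>\<le>\<^sub>0" using x by (auto intro!: pos_notin_nonpos_Ints)
        show ?thesis using p n by (auto intro!: derivative_eq_intros simp: field_simps)
      qed
      then show "(ln \<circ> H has_real_derivative
        ln 3 + (Digamma (x / 3) + Digamma (x / 3 + 1/3) + Digamma (x / 3 + 2/3)) / 3) (at x)"
        by (rule has_field_derivative_transform_within_open[where S="{0<..}"]) (use x ln_H in auto)
    next
      fix x y :: real assume "x \<in> {0<..}" "y \<in> {0<..}" "x \<le> y"
      then show "ln 3 + (Digamma (x / 3) + Digamma (x / 3 + 1/3) + Digamma (x / 3 + 2/3)) / 3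
        \<le> ln 3 + (Digamma (y / 3) + Digamma (y / 3 + 1/3) + Digamma (y / 3 + 2/3)) / 3"
        by (intro add_left_mono divide_right_mono add_mono Polygamma_real_mono) auto
    qed
  qed
  have "Gamma (3 * x) = K * exp (3 * x * ln 3) * (Gamma x * Gamma (x + 1/3) * Gamma (x + 2/3))" if "0 < x" for x
    using eq[of "3 * x"] that by (simp add: H_def)
  then show ?thesis using K by (intro that)
qed

section \<open>Real versions of the formulas, compared on an interval around 0\<close>

definition real_moment1 :: "real \<Rightarrow> real" where
  "real_moment1 x = Gamma (1 + 2 * x / 3) * Gamma (2 / 3 - 2 * x / 3) * Gamma (1 - 2 * x / 3)
       / (Gamma (2 / 3) * Gamma (1 - x)) * (2 / 3 powr (2 / 3)) powr x"

definition real_moment2 :: "real \<Rightarrow> real" where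
  "real_moment2 x = 2 * Gamma (1 / 3) / (3 * sqrt pi)
       * (Gamma (1 + 2 * x / 3) * Gamma (3 / 2 - x) / Gamma (4 / 3 - 2 * x / 3))
       * (3 powr (4 / 3) / 2) powr x"

definition real_moment3 :: "real \<Rightarrow> real" where
  "real_moment3 x = Gamma (1 / 3) / (2 powr (1 / 3) * pi)
       * (Gamma (1 + 2 * x / 3) * Gamma (1 / 2 - x / 3) * Gamma (5 / 6 - x / 3)
            / Gamma (2 / 3 - x / 3))
       * (3 / 2) powr (x / 3)"

definition real_moment4 :: "real \<Rightarrow> real" where
  "real_moment4 x = Gamma (1 / 3) / (2 powr (1 / 3) * pi powr (3 / 2))
       * (Gamma (1 / 2 + x / 3) * Gamma (1 + x / 3) * Gamma (1 / 2 - x / 3) * Gamma (5 / 6 - x / 3)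
            / Gamma (2 / 3 - x / 3))
       * 6 powr (x / 3)"

text \<open>These values fix the constants of proportionality between the formulas. The third and
  fourth need duplication at \<open>1/3\<close>, which expresses \<open>Gamma (2/3)\<close> by
  \<open>Gamma (1/3)\<close> and \<open>Gamma (5/6)\<close>.\<close>

lemma real_moment_at_0: "real_moment1 0 = 1" "real_moment2 0 = 1" "real_moment3 0 = 1" "real_moment4 0 = 1"
proof -
  have pos: "Gamma (1/3 :: real) \<noteq> 0" "Gamma (2/3 :: real) \<noteq> 0" "Gamma (5/6 :: real) \<noteq> 0"
    using Gamma_real_pos[of "1/3"] Gamma_real_pos[of "2/3"] Gamma_real_pos[of "5/6"] by linarith+
  show "real_moment1 0 = 1" using pos by (simp add: real_moment1_def)
  have "Gamma (1/3 + 1 :: real) = 1/3 * Gamma (1/3)" "Gamma (1/2 + 1 :: real) = 1/2 * Gamma (1/2)"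
    by (rule Gamma_plus1, rule pos_notin_nonpos_Ints, simp)+
  then have *: "Gamma (4/3 :: real) = Gamma (1/3) / 3" "Gamma (3/2 :: real) = sqrt pi / 2"
    by (simp_all add: Gamma_one_half_real)
  show "real_moment2 0 = 1" using pos unfolding real_moment2_def by (simp add: *)
  have "exp (2/3 * ln 2) = 2 powr (2/3 :: real)" by (simp add: powr_def)
  then have dup: "Gamma (2/3 :: real) = 1 / (2 * sqrt pi) * 2 powr (2/3) * (Gamma (1/3) * Gamma (5/6))"
    using Gamma_duplication_real[of "1/3"] by simp
  have "2 powr (2/3) * 2 powr (1/3) = (2 :: real)" by (simp add: powr_add[symmetric])
  then have *: "Gamma (1/3) * Gamma (5/6) / (2 powr (1/3) * Gamma (2/3)) = sqrt pi"
    using pos unfolding dup by (simp add: field_simps)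
  have "real_moment3 0 = (Gamma (1/3) * Gamma (5/6) / (2 powr (1/3) * Gamma (2/3))) * sqrt pi / pi"
    by (simp add: real_moment3_def Gamma_one_half_real mult_ac)
  then show "real_moment3 0 = 1" unfolding * by simp
  have "real_moment4 0 = (Gamma (1/3) * Gamma (5/6) / (2 powr (1/3) * Gamma (2/3))) * (sqrt pi * sqrt pi) / pi powr (3/2)"
    by (simp add: real_moment4_def Gamma_one_half_real mult_ac)
  also have "pi powr (3/2) = pi powr (1 + 1/2)" by simp
  also have "\<dots> = pi * sqrt pi" unfolding powr_add by (simp add: powr_half_sqrt)
  finally show "real_moment4 0 = 1" unfolding * by simp
qed

lemma real_moment_base_exp:
  "(2 / 3 powr (2 / 3)) powr x = exp (x * (ln 2 - 2 / 3 * ln 3))"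
  "(3 powr (4 / 3) / 2) powr x = exp (x * (4 / 3 * ln 3 - ln 2))"
  "(3 / 2) powr (x / 3) = exp (x * (ln 3 / 3 - ln 2 / 3))"
  "6 powr (x / 3) = exp (x * (ln 3 / 3 + ln 2 / 3))" for x :: real
proof -
  have "ln (6::real) = ln 2 + ln 3" using ln_mult[of "2::real" 3] by simp
  then show "6 powr (x / 3) = exp (x * (ln 3 / 3 + ln 2 / 3))" by (simp add: powr_def algebra_simps)
qed (simp_all add: powr_def ln_div algebra_simps)

text \<open>Below 1 all Gamma arguments that occur are positive, so duplication and triplication
  apply. They show that consecutive formulas are proportional, and the common value 1 at 0 makes
  them equal.\<close>

lemma real_moments_eq:
  assumes "- 3/2 < x" "x < 1"
  shows "real_moment1 x = real_moment2 x" "real_moment2 x = real_moment3 x" "real_moment3 x = real_moment4 x"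
proof -
  obtain t :: real where t: "0 < t" and trip:
    "\<And>x. 0 < x \<Longrightarrow> Gamma (3 * x) = t * exp (3 * x * ln 3) * (Gamma x * Gamma (x + 1/3) * Gamma (x + 2/3))"
    using Gamma_triplication_real by metis
  define d where "d = 1 / (2 * sqrt pi)"
  have d: "0 < d" by (simp add: d_def)
  have dup: "Gamma (2 * x) = d * exp (2 * x * ln 2) * (Gamma x * Gamma (x + 1/2))" if "0 < x" for x :: real
    unfolding d_def using that by (rule Gamma_duplication_real)
  have pos: "0 < Gamma y" if "0 < y" for y :: real using that by (rule Gamma_real_pos)
  have pc: "Gamma (1/3 :: real) \<noteq> 0" "Gamma (2/3 :: real) \<noteq> 0"
    using pos[of "1/3"] pos[of "2/3"] by linarith+
  \<comment> \<open>The factor \<open>k\<close> may be any expression free of \<open>y\<close>;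
    evaluation at 0 gives \<open>k = 1\<close>.\<close>
  have const: "f x = g x" if "f 0 = 1" "g 0 = 1" "\<And>y. - 3/2 < y \<Longrightarrow> y < 1 \<Longrightarrow> f y = k * g y" for f g :: "real \<Rightarrow> real" and k
    using that(1,2) that(3)[of 0] that(3)[of x] assms by simp
  show "real_moment1 x = real_moment2 x"
  proof (rule const[where f=real_moment1 and g=real_moment2])
    fix y :: real assume y: "- 3/2 < y" "y < 1"
    define a g1 g2 g3 h k where "a = Gamma (1 + 2 * y / 3)" and "g1 = Gamma (2/3 - 2 * y / 3)" and "g2 = Gamma (1 - 2 * y / 3)"
      and "g3 = Gamma (4/3 - 2 * y / 3)" and "h = Gamma (1 - y)" and "k = Gamma (3/2 - y)"
    have p: "0 < g3" "0 < h" using y by (auto simp: g3_def h_def intro!: pos)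
    \<comment> \<open>\<open>2 - 2 * y\<close> is both twice \<open>1 - y\<close> and three times
      \<open>2/3 - 2 * y / 3\<close>, so duplication and triplication expand the same Gamma
      value.\<close>
    have "Gamma (2 * (1 - y)) = Gamma (3 * (2/3 - 2 * y / 3))" by simp
    then have "d * exp (2 * (1 - y) * ln 2) * (h * k) = t * exp (3 * (2/3 - 2 * y / 3) * ln 3) * (g1 * g2 * g3)"
      using y by (subst (asm) dup, simp, subst (asm) trip, simp) (simp add: g1_def g2_def g3_def h_def k_def)
    then have "g1 * g2 / h = d / t * (exp (2 * (1 - y) * ln 2) / exp (3 * (2/3 - 2 * y / 3) * ln 3)) * (k / g3)"
    proof -
      have "g1 * g2 / h = d / t * (u / v) * (k / g3)" if "d * u * (h * k) = t * v * (g1 * g2 * g3)" "0 < v" for u v :: real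
        using that p t by (simp add: field_simps)
      then show ?thesis using \<open>d * _ * (h * k) = _\<close> by simp
    qed
    then have "g1 * g2 / h = d / t * exp (2 * (1 - y) * ln 2 - 3 * (2/3 - 2 * y / 3) * ln 3) * (k / g3)"
      by (simp only: exp_diff)
    also have "2 * (1 - y) * ln 2 - 3 * (2/3 - 2 * y / 3) * ln 3 = (2 * ln 2 - 2 * ln 3) + y * (2 * ln 3 - 2 * ln 2 :: real)"
      by (simp add: algebra_simps)
    finally have key: "g1 * g2 / h = d / t * exp (2 * ln 2 - 2 * ln 3) * exp (y * (2 * ln 3 - 2 * ln 2)) * (k / g3)"
      by (simp add: exp_add)
    have "real_moment1 y = a * (g1 * g2 / h) / Gamma (2/3) * exp (y * (ln 2 - 2 / 3 * ln 3))"
      by (simp add: real_moment1_def real_moment_base_exp a_def g1_def g2_def h_def mult_ac)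
    also have "\<dots> = d / t * exp (2 * ln 2 - 2 * ln 3) / Gamma (2/3) * (a * k / g3)
       * (exp (y * (2 * ln 3 - 2 * ln 2)) * exp (y * (ln 2 - 2 / 3 * ln 3)))"
      unfolding key by (simp add: mult_ac)
    also have "exp (y * (2 * ln 3 - 2 * ln 2)) * exp (y * (ln 2 - 2 / 3 * ln 3)) = exp (y * (4 / 3 * ln 3 - ln 2))"
      unfolding exp_add[symmetric] by (simp add: algebra_simps)
    also have "d / t * exp (2 * ln 2 - 2 * ln 3) / Gamma (2/3) * (a * k / g3) * exp (y * (4 / 3 * ln 3 - ln 2))
      = (d / t * exp (2 * ln 2 - 2 * ln 3) / Gamma (2/3) / (2 * Gamma (1 / 3) / (3 * sqrt pi))) * real_moment2 y"
      using pc by (simp add: real_moment2_def real_moment_base_exp a_def g3_def k_def mult_ac)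
    finally show "real_moment1 y = (d / t * exp (2 * ln 2 - 2 * ln 3) / Gamma (2/3) / (2 * Gamma (1 / 3) / (3 * sqrt pi))) * real_moment2 y" .
  qed (fact real_moment_at_0)+
  show "real_moment2 x = real_moment3 x"
  proof (rule const[where f=real_moment2 and g=real_moment3])
    fix y :: real assume y: "- 3/2 < y" "y < 1"
    define a g1 g2 g3 h where "a = Gamma (1 + 2 * y / 3)" and "g1 = Gamma (1/2 - y / 3)" and "g2 = Gamma (5/6 - y / 3)"
      and "g3 = Gamma (7/6 - y / 3)" and "h = Gamma (2/3 - y / 3)"
    have p: "0 < g3" "0 < h" using y by (auto simp: g3_def h_def intro!: pos)
    \<comment> \<open>Triplication of the numerator and duplication of the denominator share the
      factor \<open>Gamma (7/6 - y / 3)\<close>, which cancels in the quotient.\<close>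
    have 1: "Gamma (3/2 - y) = t * exp (3 * (1/2 - y / 3) * ln 3) * (g1 * g2 * g3)"
      using trip[of "1/2 - y / 3"] y by (simp add: g1_def g2_def g3_def)
    have 2: "Gamma (4/3 - 2 * y / 3) = d * exp (2 * (2/3 - y / 3) * ln 2) * (h * g3)"
      using dup[of "2/3 - y / 3"] y by (simp add: h_def g3_def)
    have "Gamma (3/2 - y) / Gamma (4/3 - 2 * y / 3) = t / d * exp (3 * (1/2 - y / 3) * ln 3 - 2 * (2/3 - y / 3) * ln 2) * (g1 * g2 / h)"
      unfolding 1 2 using p d by (simp add: exp_diff)
    also have "3 * (1/2 - y / 3) * ln 3 - 2 * (2/3 - y / 3) * ln 2 = (3/2 * ln 3 - 4/3 * ln 2) + y * (2/3 * ln 2 - ln 3 :: real)"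
      by (simp add: algebra_simps)
    finally have key: "Gamma (3/2 - y) / Gamma (4/3 - 2 * y / 3) = t / d * exp (3/2 * ln 3 - 4/3 * ln 2) * exp (y * (2/3 * ln 2 - ln 3)) * (g1 * g2 / h)"
      by (simp add: exp_add)
    have "real_moment2 y = 2 * Gamma (1 / 3) / (3 * sqrt pi) * (a * (Gamma (3/2 - y) / Gamma (4/3 - 2 * y / 3))) * exp (y * (4 / 3 * ln 3 - ln 2))"
      by (simp add: real_moment2_def real_moment_base_exp a_def)
    also have "\<dots> = 2 * Gamma (1 / 3) / (3 * sqrt pi) * (t / d * exp (3/2 * ln 3 - 4/3 * ln 2)) * (a * g1 * g2 / h)
       * (exp (y * (2/3 * ln 2 - ln 3)) * exp (y * (4 / 3 * ln 3 - ln 2)))"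
      unfolding key by (simp add: mult_ac)
    also have "exp (y * (2/3 * ln 2 - ln 3)) * exp (y * (4 / 3 * ln 3 - ln 2)) = exp (y * (ln 3 / 3 - ln 2 / 3))"
      unfolding exp_add[symmetric] by (simp add: algebra_simps)
    also have "2 * Gamma (1 / 3) / (3 * sqrt pi) * (t / d * exp (3/2 * ln 3 - 4/3 * ln 2)) * (a * g1 * g2 / h) * exp (y * (ln 3 / 3 - ln 2 / 3))
      = (2 * Gamma (1 / 3) / (3 * sqrt pi) * (t / d * exp (3/2 * ln 3 - 4/3 * ln 2)) / (Gamma (1 / 3) / (2 powr (1 / 3) * pi))) * real_moment3 y"
      using pc by (simp add: real_moment3_def real_moment_base_exp a_def g1_def g2_def h_def mult_ac)
    finally show "real_moment2 y = (2 * Gamma (1 / 3) / (3 * sqrt pi) * (t / d * exp (3/2 * ln 3 - 4/3 * ln 2)) / (Gamma (1 / 3) / (2 powr (1 / 3) * pi))) * real_moment3 y" .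
  qed (fact real_moment_at_0)+
  show "real_moment3 x = real_moment4 x"
  proof (rule const[where f=real_moment3 and g=real_moment4])
    fix y :: real assume y: "- 3/2 < y" "y < 1"
    define b where "b = Gamma (1/2 - y / 3) * Gamma (5/6 - y / 3) / Gamma (2/3 - y / 3)"
    define c where "c = Gamma (1/2 + y / 3) * Gamma (1 + y / 3)"
    \<comment> \<open>Duplication splits this value into the two factors that replace it in the
      fourth formula.\<close>
    have key: "Gamma (1 + 2 * y / 3) = d * exp (ln 2) * exp (y * (2/3 * ln 2)) * c"
    proof -
      have "Gamma (2 * (1/2 + y / 3)) = d * exp (2 * (1/2 + y / 3) * ln 2) * (Gamma (1/2 + y / 3) * Gamma (1/2 + y / 3 + 1/2))"
        using y by (intro dup) simp
      moreover have "2 * (1/2 + y / 3) = 1 + 2 * y / 3" "1/2 + y / 3 + 1/2 = 1 + y / 3" by simp_all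
      moreover have "exp ((1 + 2 * y / 3) * ln 2) = exp (ln 2) * exp (y * (2/3 * ln 2 :: real))"
        unfolding exp_add[symmetric] by (simp add: algebra_simps)
      ultimately show ?thesis by (simp only: c_def mult.assoc)
    qed
    have "real_moment3 y = Gamma (1 / 3) / (2 powr (1 / 3) * pi) * (Gamma (1 + 2 * y / 3) * b) * exp (y * (ln 3 / 3 - ln 2 / 3))"
      by (simp add: real_moment3_def real_moment_base_exp b_def)
    also have "\<dots> = Gamma (1 / 3) / (2 powr (1 / 3) * pi) * (d * exp (ln 2)) * (c * b) * (exp (y * (2/3 * ln 2)) * exp (y * (ln 3 / 3 - ln 2 / 3)))"
      unfolding key by (simp only: mult_ac)
    also have "exp (y * (2/3 * ln 2)) * exp (y * (ln 3 / 3 - ln 2 / 3)) = exp (y * (ln 3 / 3 + ln 2 / 3))"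
      unfolding exp_add[symmetric] by (simp add: algebra_simps)
    also have "Gamma (1 / 3) / (2 powr (1 / 3) * pi) * (d * exp (ln 2)) * (c * b) * exp (y * (ln 3 / 3 + ln 2 / 3))
      = (Gamma (1 / 3) / (2 powr (1 / 3) * pi) * (d * exp (ln 2)) / (Gamma (1 / 3) / (2 powr (1 / 3) * pi powr (3 / 2)))) * real_moment4 y"
      using pc by (simp add: real_moment4_def real_moment_base_exp b_def c_def mult_ac)
    finally show "real_moment3 y = (Gamma (1 / 3) / (2 powr (1 / 3) * pi) * (d * exp (ln 2)) / (Gamma (1 / 3) / (2 powr (1 / 3) * pi powr (3 / 2)))) * real_moment4 y" .
  qed (fact real_moment_at_0)+
qed

section \<open>Analytic continuation\<close>

definition moment_strip :: "complex set" where
  "moment_strip = {s. - 3/2 < Re s \<and> Re s < 3/2}"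

lemma open_moment_strip: "open moment_strip"
  unfolding moment_strip_def by (intro open_Collect_conj open_Collect_less continuous_intros)

lemma convex_moment_strip: "convex moment_strip"
proof -
  have eq: "moment_strip = {s. Re s < 3/2} \<inter> {s. Re s > - 3/2}" by (auto simp: moment_strip_def)
  show ?thesis unfolding eq by (intro convex_Int convex_halfspace_Re_lt convex_halfspace_Re_gt)
qed

lemma complex_of_real_powr:
  assumes "0 < x" shows "complex_of_real x powr s = exp (s * of_real (ln x))"
  using assms by (simp add: powr_def Ln_of_real)

lemma norm_complex_of_real_powr:
  assumes "0 < x" shows "norm (complex_of_real x powr s) = x powr Re s"
  using assms by (simp add: complex_of_real_powr powr_def)

text \<open>\<open>X\<close> is positive only almost everywhere, so measurability has to cover
  negative values, where the logarithm has imaginary part \<open>pi\<close>, and 0, where the power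
  is 0.\<close>

lemma borel_measurable_complex_powr [measurable (raw)]:
  assumes [measurable]: "f \<in> borel_measurable M"
  shows "(\<lambda>x. complex_of_real (f x) powr s) \<in> borel_measurable M"
proof -
  have "(\<lambda>x. complex_of_real (f x) powr s) = (\<lambda>x. if f x = 0 then 0
      else exp (s * (of_real (ln \<bar>f x\<bar>) + (if f x < 0 then \<i> * of_real pi else 0))))"
    by (auto simp: powr_def Ln_of_real' fun_eq_iff mult.commute)
  then show ?thesis by simp
qed

text \<open>This turns the exponential majorant of a power series in \<open>ln x\<close> into two
  real powers of \<open>x\<close>, hence into two real moments.\<close>

lemma exp_abs_le:
  fixes x \<rho> :: real
  assumes "0 < x" "0 \<le> \<rho>"
  shows "x powr a * exp (\<rho> * \<bar>ln x\<bar>) \<le> x powr (a + \<rho>) + x powr (a - \<rho>)"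
proof -
  have "x powr (a + \<rho>) = x powr a * exp (\<rho> * ln x)" "x powr (a - \<rho>) = x powr a * exp (- (\<rho> * ln x))"
    using assms by (simp_all add: powr_def exp_add[symmetric] algebra_simps)
  moreover have "exp (\<rho> * \<bar>ln x\<bar>) \<le> exp (\<rho> * ln x) + exp (- (\<rho> * ln x))"
    by (cases "0 \<le> ln x") auto
  then have "x powr a * exp (\<rho> * \<bar>ln x\<bar>) \<le> x powr a * (exp (\<rho> * ln x) + exp (- (\<rho> * ln x)))"
    by (rule mult_left_mono) simp
  ultimately show ?thesis by (simp add: distrib_left)
qed

section \<open>Holomorphy of the moment function and the identity theorem\<close>

context area_tail
begin

definition mellin :: "complex \<Rightarrow> complex" where
  "mellin s = (\<integral>\<omega>. complex_of_real (X \<omega>) powr s \<partial>N)"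

lemma integrable_complex_moment:
  assumes "s \<in> moment_strip"
  shows "integrable N (\<lambda>\<omega>. complex_of_real (X \<omega>) powr s)"
proof (rule Bochner_Integration.integrable_bound)
  show "integrable N (\<lambda>\<omega>. X \<omega> powr Re s)"
    using assms by (intro integrable_moment) (auto simp: moment_strip_def)
  show "AE \<omega> in N. norm (complex_of_real (X \<omega>) powr s) \<le> norm (X \<omega> powr Re s)"
    using X_pos by eventually_elim (simp add: norm_complex_of_real_powr)
qed measurable

lemma mellin_of_real: "mellin (of_real x) = of_real (expectation (\<lambda>\<omega>. X \<omega> powr x))"
proof -
  have "mellin (of_real x) = (\<integral>\<omega>. complex_of_real (X \<omega> powr x) \<partial>N)"
    unfolding mellin_def
    by (rule integral_cong_AE) (use X_pos in \<open>auto elim!: eventually_mono simp: powr_of_real\<close>)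
  then show ?thesis by simp
qed

text \<open>\<open>X powr (w - s0)\<close> is expanded as an exponential series in
  \<open>ln X\<close>. All partial sums are dominated by the sum of the powers of \<open>X\<close>
  of orders \<open>Re s0 + norm (w - s0)\<close> and \<open>Re s0 - norm (w - s0)\<close>; both
  orders lie in the strip because \<open>w\<close> is closer to \<open>s0\<close> than the boundary
  is.\<close>

lemma mellin_power_series:
  assumes s0: "s0 \<in> moment_strip" and w: "norm (w - s0) < min (3/2 - Re s0) (3/2 + Re s0)"
  shows "(\<lambda>n. (\<integral>\<omega>. complex_of_real (X \<omega>) powr s0 * of_real (ln (X \<omega>)) ^ n \<partial>N) / fact n * (w - s0) ^ n) sums mellin w"
proof -
  define z where "z = w - s0"
  define g where "g = (\<lambda>\<omega>. X \<omega> powr (Re s0 + norm z) + X \<omega> powr (Re s0 - norm z))"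
  define f where "f = (\<lambda>n \<omega>. complex_of_real (X \<omega>) powr s0 * ((z * of_real (ln (X \<omega>))) ^ n / fact n))"
  have g: "integrable N g"
  proof -
    have "- 3/2 < Re s0" "Re s0 < 3/2" using s0 by (simp_all add: moment_strip_def)
    then have "- 3/2 < Re s0 + norm z" "Re s0 + norm z < 3/2" "- 3/2 < Re s0 - norm z" "Re s0 - norm z < 3/2"
      using w norm_ge_zero[of z] unfolding z_def by linarith+
    then show ?thesis unfolding g_def by (intro Bochner_Integration.integrable_add integrable_moment)
  qed
  have [measurable]: "f n \<in> borel_measurable N" for n unfolding f_def by measurable
  have sum_bound: "(\<Sum>n<m. norm (f n \<omega>)) \<le> g \<omega>" if x: "0 < X \<omega>" for m \<omega>
  proof -
    have e: "exp (norm z * \<bar>ln (X \<omega>)\<bar>) = (\<Sum>n. (norm z * \<bar>ln (X \<omega>)\<bar>) ^ n / fact n)"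
      using exp_converges[of "norm z * \<bar>ln (X \<omega>)\<bar>"] by (simp add: sums_iff divide_inverse mult.commute)
    have "(\<Sum>n<m. norm (f n \<omega>)) = X \<omega> powr Re s0 * (\<Sum>n<m. (norm z * \<bar>ln (X \<omega>)\<bar>) ^ n / fact n)"
      unfolding f_def sum_distrib_left
      by (intro sum.cong) (simp_all add: norm_mult norm_divide norm_power norm_complex_of_real_powr x)
    also have "\<dots> \<le> X \<omega> powr Re s0 * exp (norm z * \<bar>ln (X \<omega>)\<bar>)"
    proof (rule mult_left_mono)
      have "summable (\<lambda>n. (norm z * \<bar>ln (X \<omega>)\<bar>) ^ n / fact n)"
        using summable_exp[of "norm z * \<bar>ln (X \<omega>)\<bar>"] by (simp add: divide_inverse mult.commute)
      then show "(\<Sum>n<m. (norm z * \<bar>ln (X \<omega>)\<bar>) ^ n / fact n) \<le> exp (norm z * \<bar>ln (X \<omega>)\<bar>)"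
        unfolding e by (intro sum_le_suminf) auto
    qed simp
    also have "\<dots> \<le> g \<omega>" unfolding g_def using x by (intro exp_abs_le) auto
    finally show ?thesis .
  qed
  have int_f: "integrable N (f n)" for n
  proof (rule Bochner_Integration.integrable_bound[OF g])
    show "AE \<omega> in N. norm (f n \<omega>) \<le> norm (g \<omega>)"
      using X_pos
    proof eventually_elim
      case (elim \<omega>)
      have "norm (f n \<omega>) \<le> (\<Sum>n<Suc n. norm (f n \<omega>))" by (simp add: sum_nonneg)
      then show ?case using sum_bound[OF elim, of "Suc n"] unfolding real_norm_def by linarith
    qed
  qed simp
  have "(\<lambda>m. \<integral>\<omega>. (\<Sum>n<m. f n \<omega>) \<partial>N) \<longlonglongrightarrow> mellin w"
    unfolding mellin_def
  proof (rule integral_dominated_convergence[OF _ _ g])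
    show "AE \<omega> in N. (\<lambda>m. \<Sum>n<m. f n \<omega>) \<longlonglongrightarrow> complex_of_real (X \<omega>) powr w"
      using X_pos
    proof eventually_elim
      case (elim \<omega>)
      have "(\<lambda>n. (z * of_real (ln (X \<omega>))) ^ n / fact n) sums exp (z * of_real (ln (X \<omega>)))"
        using exp_converges[of "z * of_real (ln (X \<omega>))"] by (simp add: scaleR_conv_of_real divide_inverse mult.commute)
      then have "(\<lambda>n. f n \<omega>) sums (complex_of_real (X \<omega>) powr s0 * exp (z * of_real (ln (X \<omega>))))"
        unfolding f_def by (rule sums_mult)
      moreover have "complex_of_real (X \<omega>) powr s0 * exp (z * of_real (ln (X \<omega>))) = complex_of_real (X \<omega>) powr w"
        unfolding complex_of_real_powr[OF elim] exp_add[symmetric] z_def by (simp add: algebra_simps)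
      ultimately show ?case by (simp add: sums_def)
    qed
    show "AE \<omega> in N. norm (\<Sum>n<m. f n \<omega>) \<le> g \<omega>" for m
      using X_pos by eventually_elim (rule order_trans[OF norm_sum sum_bound])
  qed measurable
  moreover have "(\<integral>\<omega>. (\<Sum>n<m. f n \<omega>) \<partial>N) = (\<Sum>n<m. \<integral>\<omega>. f n \<omega> \<partial>N)" for m
    by (rule Bochner_Integration.integral_sum) (rule int_f)
  moreover have "(\<integral>\<omega>. f n \<omega> \<partial>N) = (\<integral>\<omega>. complex_of_real (X \<omega>) powr s0 * of_real (ln (X \<omega>)) ^ n \<partial>N) / fact n * z ^ n" for n
  proof -
    have "f n = (\<lambda>\<omega>. (complex_of_real (X \<omega>) powr s0 * of_real (ln (X \<omega>)) ^ n) * (z ^ n / fact n))"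
      by (auto simp: f_def power_mult_distrib)
    then show ?thesis by simp
  qed
  ultimately show ?thesis by (simp add: sums_def z_def)
qed

lemma mellin_holomorphic: "mellin holomorphic_on moment_strip"
proof -
  have "mellin field_differentiable at s0" if s0: "s0 \<in> moment_strip" for s0
  proof -
    define r where "r = min (3/2 - Re s0) (3/2 + Re s0)"
    have r: "r > 0" using s0 by (auto simp: r_def moment_strip_def)
    have "mellin holomorphic_on ball s0 r"
      by (rule power_series_holomorphic[OF mellin_power_series[OF s0]])
        (simp add: r_def dist_norm norm_minus_commute)
    then show ?thesis using r by (intro holomorphic_on_imp_differentiable_at[of _ "ball s0 r"]) auto
  qed
  then show ?thesis by (simp add: holomorphic_on_def field_differentiable_at_within)
qed

text \<open>The identity theorem on the punctured strip, which is open and connected. The point 1 is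
  left out because, with \<open>Gamma\<close> set to 0 at its poles, the first formula takes the
  value 0 there; the limit taken by \<open>remove_sings\<close> restores the right value, since
  \<open>mellin\<close> is continuous.\<close>

lemma mellin_eq_on_negative_reals:
  assumes f: "f holomorphic_on moment_strip - {1}"
    and eq: "\<And>x. - 3/2 < x \<Longrightarrow> x < 0 \<Longrightarrow> f (of_real x) = mellin (of_real x)"
    and s: "s \<in> moment_strip"
  shows "s \<noteq> 1 \<Longrightarrow> f s = mellin s" and "remove_sings f s = mellin s"
proof -
  let ?S = "moment_strip - {1}"
  have eq': "f z = mellin z" if z: "z \<in> ?S" for z
  proof -
    define I where "I = complex_of_real ` {- 3/2<..<0}"
    have conn: "connected ?S"
      using convex_moment_strip open_moment_strip
      by (intro connected_open_delete convex_connected) auto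
    have op: "open ?S" using open_moment_strip by (simp add: open_delete)
    have sub: "I \<subseteq> ?S" by (auto simp: I_def moment_strip_def complex_eq_iff)
    \<comment> \<open>Any point of the interval of negative orders can serve as the accumulation
      point.\<close>
    have mem: "complex_of_real (- 1) \<in> ?S" by (auto simp: moment_strip_def complex_eq_iff)
    have lim: "complex_of_real (- 1) islimpt I"
    proof (rule islimpt_approachable[THEN iffD2], intro allI impI)
      fix e :: real assume "e > 0"
      define t where "t = - 1 + min (e / 2) (1/2)"
      have t: "- 3/2 < t" "t < 0" "t \<noteq> - 1" "\<bar>t - (- 1)\<bar> < e" using \<open>e > 0\<close> by (auto simp: t_def min_def)
      then have "complex_of_real t \<in> I" unfolding I_def by (intro imageI) simp
      moreover have "complex_of_real t \<noteq> of_real (- 1)" using t(3) unfolding of_real_eq_iff .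
      moreover have "dist (complex_of_real t) (of_real (- 1)) < e" using t(4) unfolding dist_of_real dist_real_def .
      ultimately show "\<exists>x'\<in>I. x' \<noteq> complex_of_real (- 1) \<and> dist x' (complex_of_real (- 1)) < e" by blast
    qed
    have hol: "(\<lambda>z. f z - mellin z) holomorphic_on ?S"
      using f mellin_holomorphic by (intro holomorphic_intros) (auto intro: holomorphic_on_subset)
    have zero: "f z - mellin z = 0" if "z \<in> I" for z
    proof -
      from that obtain x where "z = of_real x" "- 3/2 < x" "x < 0" unfolding I_def by auto
      with eq[of x] show ?thesis by simp
    qed
    have "f z - mellin z = 0"
      by (rule analytic_continuation[OF hol op conn sub mem lim zero z])
    then show ?thesis by simp
  qed
  show "f s = mellin s" if "s \<noteq> 1" by (rule eq') (use s that in blast)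
  have "isCont mellin s"
    using holomorphic_on_imp_continuous_on[OF mellin_holomorphic] s open_moment_strip
    by (simp add: continuous_on_eq_continuous_at)
  then have "(mellin \<longlongrightarrow> mellin s) (at s)" by (simp add: isCont_def)
  \<comment> \<open>Only values of \<open>f\<close> near \<open>s\<close>, not at \<open>s\<close>,
    enter the limit, so the case \<open>s = 1\<close> is covered as well.\<close>
  moreover have "\<forall>\<^sub>F z in at s. mellin z = f z"
  proof -
    have "\<forall>\<^sub>F z in at s. z \<in> moment_strip" by (rule eventually_at_in_open'[OF open_moment_strip s])
    moreover have "\<forall>\<^sub>F z in at s. z \<noteq> 1"
      by (rule eventually_neq_at_within)
    ultimately show ?thesis
    proof eventually_elim
      case (elim z)
      then show ?case using eq'[of z] by simp
    qed
  qed
  ultimately have "(f \<longlongrightarrow> mellin s) (at s)" by (rule Lim_transform_eventually)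
  then show "remove_sings f s = mellin s" by (rule remove_sings_eqI)
qed

text \<open>This is \<open>negative_moment\<close> divided by \<open>Gamma r\<close>, with
  \<open>r = - x\<close>. The numerical factors are absorbed by the functional equation of
  \<open>Gamma\<close> at \<open>2 * r / 3\<close>, \<open>r\<close> and \<open>2/3\<close>, and
  \<open>(2 * sqrt 2 / 3) powr (2/3)\<close> equals \<open>2 / 3 powr (2/3)\<close>.\<close>

lemma expectation_eq_real_moment1:
  assumes "- 3/2 < x" "x < 0"
  shows "expectation (\<lambda>\<omega>. X \<omega> powr x) = real_moment1 x"
proof -
  define r where "r = - x"
  have r: "0 < r" "r < 3/2" using assms by (auto simp: r_def)
  have pos: "0 < Gamma y" if "0 < y" for y :: real using that by (rule Gamma_real_pos)
  have int: "integrable N (\<lambda>\<omega>. X \<omega> powr (- r))" using r by (intro integrable_moment) auto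
  let ?R = "4/9 * Gamma (2 * r / 3) * (2 * sqrt 2 / 3) powr (- (2 * r / 3)) * Beta (2/3 + 2 * r / 3) (1 - 2 * r / 3)"
  have R: "0 \<le> ?R" using r by (simp add: Beta_def Gamma_real_nonneg)
  have "ennreal (Gamma r * expectation (\<lambda>\<omega>. X \<omega> powr (- r))) = ennreal ?R"
    using negative_moment[OF r] pos[OF r(1)] by (simp add: ennreal_mult' nn_integral_eq_integral[OF int])
  then have eq: "Gamma r * expectation (\<lambda>\<omega>. X \<omega> powr (- r)) = ?R"
    using pos[OF r(1)] R by (subst (asm) ennreal_inj) (auto intro!: mult_nonneg_nonneg)
  have G1: "Gamma (2 * r / 3 + 1) = 2 * r / 3 * Gamma (2 * r / 3)" "Gamma (r + 1) = r * Gamma r"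
    "Gamma (2/3 + 1 :: real) = 2/3 * Gamma (2/3)"
    by (rule Gamma_plus1, rule pos_notin_nonpos_Ints, use r in simp)+
  have "ln (sqrt 2) = ln (2::real) / 2" by (simp add: ln_sqrt)
  then have l: "ln (2 * sqrt 2 / 3) = 3/2 * ln 2 - ln (3::real)" by (simp add: ln_div ln_mult)
  have pw: "(2 * sqrt 2 / 3) powr y = exp (y * ln (2 * sqrt 2 / 3))" for y :: real by (simp add: powr_def)
  have c: "(2 * sqrt 2 / 3) powr (- (2 * r / 3)) = (2 / 3 powr (2 / 3)) powr (- r)"
    unfolding real_moment_base_exp pw l by (simp add: algebra_simps)
  have nz: "Gamma r \<noteq> 0" "Gamma (2/3 :: real) \<noteq> 0" "r \<noteq> 0" using pos[OF r(1)] pos[of "2/3"] r by linarith+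
  have B: "Beta (2/3 + 2 * r / 3) (1 - 2 * r / 3) = Gamma (2/3 + 2 * r / 3) * Gamma (1 - 2 * r / 3) / (2/3 * Gamma (2/3))"
    unfolding Beta_def G1(3)[symmetric] by simp
  have "expectation (\<lambda>\<omega>. X \<omega> powr (- r)) = ?R / Gamma r"
    unfolding eq[symmetric] using nz by simp
  also have "\<dots> = Gamma (1 - 2 * r / 3) * Gamma (2/3 + 2 * r / 3) * (2 * r / 3 * Gamma (2 * r / 3)) / (Gamma (2/3) * (r * Gamma r)) * (2 / 3 powr (2 / 3)) powr (- r)"
    unfolding B c using nz by (simp add: mult_ac)
  also have "\<dots> = real_moment1 (- r)"
  proof -
    have "1 + 2 * (- r) / 3 = 1 - 2 * r / 3" "2/3 - 2 * (- r) / 3 = 2/3 + 2 * r / 3" "1 - 2 * (- r) / 3 = 2 * r / 3 + 1" "1 - (- r) = r + 1"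
      by simp_all
    then show ?thesis unfolding real_moment1_def by (simp only: G1)
  qed
  finally show ?thesis by (simp add: r_def)
qed

end

text \<open>To the right of real part -1 the only pole of \<open>Gamma\<close> is 0. This suits the
  arguments \<open>1 - s\<close> and \<open>2/3 - 2 * s / 3\<close>, whose real parts may be
  negative in the strip but which vanish only at \<open>s = 1\<close>.\<close>

lemma complex_notin_nonpos_Ints:
  assumes "- 1 < Re z" "z \<noteq> 0" shows "z \<notin> \<int>\<^sub>\<le>\<^sub>0"
proof
  assume "z \<in> \<int>\<^sub>\<le>\<^sub>0"
  then obtain n where n: "z = of_int n" "n \<le> 0" by (auto simp: nonpos_Ints_def)
  with assms(1) have "n = 0" by simp
  with n assms(2) show False by simp
qed

text \<open>The expressions under \<open>remove_sings\<close> in \<open>moment1\<close> to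
  \<open>moment4\<close> get names of their own, so that holomorphy can be stated for the totalised
  formulas away from 1.\<close>

definition complex_moment1 :: "complex \<Rightarrow> complex" where
  "complex_moment1 s = Gamma (1 + 2 * s / 3) * Gamma (2 / 3 - 2 * s / 3) * Gamma (1 - 2 * s / 3)
       / (Gamma (2 / 3) * Gamma (1 - s)) * (2 / 3 powr (2 / 3)) powr s"

definition complex_moment2 :: "complex \<Rightarrow> complex" where
  "complex_moment2 s = 2 * Gamma (1 / 3) / (3 * of_real (sqrt pi))
       * (Gamma (1 + 2 * s / 3) * Gamma (3 / 2 - s) / Gamma (4 / 3 - 2 * s / 3))
       * (3 powr (4 / 3) / 2) powr s"

definition complex_moment3 :: "complex \<Rightarrow> complex" where
  "complex_moment3 s = Gamma (1 / 3) / (2 powr (1 / 3) * of_real pi)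
       * (Gamma (1 + 2 * s / 3) * Gamma (1 / 2 - s / 3) * Gamma (5 / 6 - s / 3)
            / Gamma (2 / 3 - s / 3))
       * (3 / 2) powr (s / 3)"

definition complex_moment4 :: "complex \<Rightarrow> complex" where
  "complex_moment4 s = Gamma (1 / 3) / (2 powr (1 / 3) * of_real pi powr (3 / 2))
       * (Gamma (1 / 2 + s / 3) * Gamma (1 + s / 3) * Gamma (1 / 2 - s / 3) * Gamma (5 / 6 - s / 3)
            / Gamma (2 / 3 - s / 3))
       * 6 powr (s / 3)"

lemma moment_eq_remove_sings:
  "moment1 = remove_sings complex_moment1" "moment2 = remove_sings complex_moment2"
  "moment3 = remove_sings complex_moment3" "moment4 = remove_sings complex_moment4"
  by (simp_all add: moment1_def moment2_def moment3_def moment4_def complex_moment1_def[abs_def]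
      complex_moment2_def[abs_def] complex_moment3_def[abs_def] complex_moment4_def[abs_def])

lemma complex_moment_of_real:
  "complex_moment1 (of_real x) = of_real (real_moment1 x)"
  "complex_moment2 (of_real x) = of_real (real_moment2 x)"
  "complex_moment3 (of_real x) = of_real (real_moment3 x)"
  "complex_moment4 (of_real x) = of_real (real_moment4 x)"
proof -
  have num: "complex_of_real (2/3 powr (2/3)) = 2/3 powr (2/3)" "complex_of_real (3 powr (4/3) / 2) = 3 powr (4/3) / 2"
    "complex_of_real (2 powr (1/3)) = 2 powr (1/3)" "complex_of_real (pi powr (3/2)) = of_real pi powr (3/2)"
    using powr_of_real[of 3 "2/3"] powr_of_real[of 3 "4/3"] powr_of_real[of 2 "1/3"] powr_of_real[of pi "3/2"] by simp_all
  have pw: "complex_of_real ((2 / 3 powr (2 / 3)) powr x) = (2/3 powr (2/3)) powr of_real x"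
    "complex_of_real ((3 powr (4 / 3) / 2) powr x) = (3 powr (4 / 3) / 2) powr of_real x"
    "complex_of_real ((3 / 2) powr (x / 3)) = (3 / 2) powr (of_real x / 3)"
    "complex_of_real (6 powr (x / 3)) = 6 powr (of_real x / 3)"
    using powr_of_real[of "2/3 powr (2/3)" x] powr_of_real[of "3 powr (4/3) / 2" x] powr_of_real[of "3/2" "x/3"] powr_of_real[of 6 "x/3"]
    unfolding num by simp_all
  show "complex_moment1 (of_real x) = of_real (real_moment1 x)"
    unfolding complex_moment1_def real_moment1_def of_real_mult of_real_divide pw
    by (simp flip: Gamma_complex_of_real)
  show "complex_moment2 (of_real x) = of_real (real_moment2 x)"
    unfolding complex_moment2_def real_moment2_def of_real_mult of_real_divide pw
    by (simp flip: Gamma_complex_of_real)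
  show "complex_moment3 (of_real x) = of_real (real_moment3 x)"
    unfolding complex_moment3_def real_moment3_def of_real_mult of_real_divide pw num
    by (simp flip: Gamma_complex_of_real)
  show "complex_moment4 (of_real x) = of_real (real_moment4 x)"
    unfolding complex_moment4_def real_moment4_def of_real_mult of_real_divide pw num
    by (simp flip: Gamma_complex_of_real)
qed

text \<open>The only pole met by a Gamma factor in the strip is at \<open>s = 1\<close> in the first
  formula, common to numerator and denominator. All other arguments have positive real part.\<close>

lemma complex_moment_holomorphic:
  "complex_moment1 holomorphic_on moment_strip - {1}"
  "complex_moment2 holomorphic_on moment_strip - {1}"
  "complex_moment3 holomorphic_on moment_strip - {1}"
  "complex_moment4 holomorphic_on moment_strip - {1}"
proof -
  have G: "1 + 2 * s / 3 \<notin> \<int>\<^sub>\<le>\<^sub>0" "1 - 2 * s / 3 \<notin> \<int>\<^sub>\<le>\<^sub>0" "3 / 2 - s \<notin> \<int>\<^sub>\<le>\<^sub>0" "4 / 3 - 2 * s / 3 \<notin> \<int>\<^sub>\<le>\<^sub>0"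
    "1 / 2 - s / 3 \<notin> \<int>\<^sub>\<le>\<^sub>0" "5 / 6 - s / 3 \<notin> \<int>\<^sub>\<le>\<^sub>0" "2 / 3 - s / 3 \<notin> \<int>\<^sub>\<le>\<^sub>0" "1 / 2 + s / 3 \<notin> \<int>\<^sub>\<le>\<^sub>0" "1 + s / 3 \<notin> \<int>\<^sub>\<le>\<^sub>0"
    if "s \<in> moment_strip - {1}" for s
  proof -
    have pos: "z \<notin> \<int>\<^sub>\<le>\<^sub>0" if "0 < Re z" for z
      using complex_notin_nonpos_Ints[of z] that by force
    have s: "- 3 / 2 < Re s" "Re s < 3 / 2" using that by (simp_all add: moment_strip_def)
    show "1 + 2 * s / 3 \<notin> \<int>\<^sub>\<le>\<^sub>0" "1 - 2 * s / 3 \<notin> \<int>\<^sub>\<le>\<^sub>0" "3 / 2 - s \<notin> \<int>\<^sub>\<le>\<^sub>0" "4 / 3 - 2 * s / 3 \<notin> \<int>\<^sub>\<le>\<^sub>0"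
      "1 / 2 - s / 3 \<notin> \<int>\<^sub>\<le>\<^sub>0" "5 / 6 - s / 3 \<notin> \<int>\<^sub>\<le>\<^sub>0" "2 / 3 - s / 3 \<notin> \<int>\<^sub>\<le>\<^sub>0" "1 / 2 + s / 3 \<notin> \<int>\<^sub>\<le>\<^sub>0" "1 + s / 3 \<notin> \<int>\<^sub>\<le>\<^sub>0"
      by (rule pos; use s in simp)+
  qed
  have G1: "2 / 3 - 2 * s / 3 \<notin> \<int>\<^sub>\<le>\<^sub>0" "1 - s \<notin> \<int>\<^sub>\<le>\<^sub>0" if "s \<in> moment_strip - {1}" for s
  proof -
    have s: "- 3 / 2 < Re s" "Re s < 3 / 2" "s \<noteq> 1" using that by (simp_all add: moment_strip_def)
    show "2 / 3 - 2 * s / 3 \<notin> \<int>\<^sub>\<le>\<^sub>0" "1 - s \<notin> \<int>\<^sub>\<le>\<^sub>0"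
      by (rule complex_notin_nonpos_Ints; use s in simp)+
  qed
  have G0: "Gamma (2 / 3) \<noteq> (0 :: complex)"
    unfolding Gamma_eq_zero_iff by (rule complex_notin_nonpos_Ints) simp_all
  show "complex_moment1 holomorphic_on moment_strip - {1}"
    unfolding complex_moment1_def[abs_def]
    by (intro holomorphic_intros G G1) (use G0 G1(2) in \<open>auto simp: Gamma_eq_zero_iff\<close>)
  show "complex_moment2 holomorphic_on moment_strip - {1}"
    unfolding complex_moment2_def[abs_def]
    by (intro holomorphic_intros G G1) (use G(4) in \<open>auto simp: Gamma_eq_zero_iff\<close>)
  show "complex_moment3 holomorphic_on moment_strip - {1}"
    unfolding complex_moment3_def[abs_def]
    by (intro holomorphic_intros G G1) (use G(7) in \<open>auto simp: Gamma_eq_zero_iff\<close>)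
  show "complex_moment4 holomorphic_on moment_strip - {1}"
    unfolding complex_moment4_def[abs_def]
    by (intro holomorphic_intros G G1) (use G(7) in \<open>auto simp: Gamma_eq_zero_iff\<close>)
qed

context area_tail
begin

text \<open>On negative reals the first formula has been computed and the other three follow from
  \<open>real_moments_eq\<close>; the identity theorem does the rest.\<close>

lemma mellin_eq_moments:
  assumes s: "s \<in> moment_strip"
  shows "mellin s = moment1 s" "mellin s = moment2 s" "mellin s = moment3 s" "mellin s = moment4 s"
    and "s \<noteq> 1 \<Longrightarrow> complex_moment1 s = mellin s" "s \<noteq> 1 \<Longrightarrow> complex_moment2 s = mellin s"
proof -
  have E: "complex_moment1 (of_real x) = mellin (of_real x)" "complex_moment2 (of_real x) = mellin (of_real x)"
    "complex_moment3 (of_real x) = mellin (of_real x)" "complex_moment4 (of_real x) = mellin (of_real x)"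
    if x: "- 3/2 < x" "x < 0" for x
  proof -
    have "x < 1" using x by simp
    note eqs = real_moments_eq[OF x(1) this]
    have "mellin (of_real x) = of_real (real_moment1 x)"
      unfolding mellin_of_real expectation_eq_real_moment1[OF x] ..
    then show "complex_moment1 (of_real x) = mellin (of_real x)" "complex_moment2 (of_real x) = mellin (of_real x)"
      "complex_moment3 (of_real x) = mellin (of_real x)" "complex_moment4 (of_real x) = mellin (of_real x)"
      unfolding complex_moment_of_real by (simp_all add: eqs)
  qed
  show "mellin s = moment1 s" "mellin s = moment2 s" "mellin s = moment3 s" "mellin s = moment4 s"
    unfolding moment_eq_remove_sings
    using mellin_eq_on_negative_reals(2)[OF complex_moment_holomorphic(1) E(1) s]
      mellin_eq_on_negative_reals(2)[OF complex_moment_holomorphic(2) E(2) s]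
      mellin_eq_on_negative_reals(2)[OF complex_moment_holomorphic(3) E(3) s]
      mellin_eq_on_negative_reals(2)[OF complex_moment_holomorphic(4) E(4) s] by simp_all
  show "s \<noteq> 1 \<Longrightarrow> complex_moment1 s = mellin s" "s \<noteq> 1 \<Longrightarrow> complex_moment2 s = mellin s"
    using mellin_eq_on_negative_reals(1)[OF complex_moment_holomorphic(1) E(1) s]
      mellin_eq_on_negative_reals(1)[OF complex_moment_holomorphic(2) E(2) s] by blast+
qed

section \<open>Divergence of the moments at the boundary of the strip\<close>

lemma expectation_eq_real_moment2:
  assumes "- 3/2 < x" "x < 3/2" "x \<noteq> 1"
  shows "expectation (\<lambda>\<omega>. X \<omega> powr x) = real_moment2 x"
proof -
  have "complex_of_real x \<in> moment_strip" "complex_of_real x \<noteq> 1" using assms by (auto simp: moment_strip_def)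
  from mellin_eq_moments(6)[OF this] have "complex_of_real (real_moment2 x) = of_real (expectation (\<lambda>\<omega>. X \<omega> powr x))"
    unfolding complex_moment_of_real mellin_of_real .
  then show ?thesis unfolding of_real_eq_iff by simp
qed

text \<open>For an order between 0 and \<open>s\<close> the power is at most 1 or at most the power
  of order \<open>s\<close>, depending on whether \<open>X\<close> is above or below 1. The point is
  that the bound is uniform in \<open>x\<close>.\<close>

lemma expectation_powr_le:
  assumes int: "integrable N (\<lambda>\<omega>. X \<omega> powr s)" and x: "x \<in> {- 3/2<..<3/2}" and btw: "0 \<le> x \<and> x \<le> s \<or> s \<le> x \<and> x \<le> 0"
  shows "expectation (\<lambda>\<omega>. X \<omega> powr x) \<le> 1 + expectation (\<lambda>\<omega>. X \<omega> powr s)"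
proof -
  have "expectation (\<lambda>\<omega>. X \<omega> powr x) \<le> expectation (\<lambda>\<omega>. 1 + X \<omega> powr s)"
  proof (rule integral_mono_AE)
    show "integrable N (\<lambda>\<omega>. X \<omega> powr x)" using x by (intro integrable_moment) auto
    show "integrable N (\<lambda>\<omega>. 1 + X \<omega> powr s)" using int by simp
    show "AE \<omega> in N. X \<omega> powr x \<le> 1 + X \<omega> powr s"
      using X_pos
    proof eventually_elim
      case (elim \<omega>)
      consider "X \<omega> powr x \<le> 1" | "X \<omega> powr x \<le> X \<omega> powr s"
      proof (cases "1 \<le> X \<omega>")
        case True
        show ?thesis
        proof (cases "0 \<le> x \<and> x \<le> s")
          case t: True
          then have "X \<omega> powr x \<le> X \<omega> powr s" using True by (intro powr_mono) auto
          then show ?thesis by (rule that(2))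
        next
          case False
          then have "X \<omega> powr x \<le> X \<omega> powr 0" using True btw by (intro powr_mono) auto
          then show ?thesis using elim by (intro that(1)) simp
        qed
      next
        case False
        show ?thesis
        proof (cases "0 \<le> x \<and> x \<le> s")
          case True
          then have "X \<omega> powr x \<le> X \<omega> powr 0" using False elim by (intro powr_mono') auto
          then show ?thesis using elim by (intro that(1)) simp
        next
          case f: False
          then have "X \<omega> powr x \<le> X \<omega> powr s" using False elim btw by (intro powr_mono') auto
          then show ?thesis by (rule that(2))
        qed
      qed
      then show ?case
        using powr_ge_zero[of "X \<omega>" s] by cases linarith+
    qed
  qed
  then show ?thesis using int by (simp add: prob_space)
qed

text \<open>A finite moment of order \<open>s\<close> would bound all moments in the strip between
  orders 0 and \<open>s\<close> uniformly. But near 3/2 the second formula contains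
  \<open>Gamma (3/2 - x)\<close>, and near -3/2 the first contains
  \<open>Gamma (1 + 2 * x / 3)\<close>. Multiplied by these vanishing arguments the formulas have
  positive limits, while the bound so multiplied tends to 0.\<close>

lemma infinite_moment:
  assumes "s \<le> - 3/2 \<or> 3/2 \<le> s"
  shows "(\<integral>\<^sup>+\<omega>. ennreal (X \<omega> powr s) \<partial>N) = \<infinity>"
proof (rule ccontr)
  assume fin: "(\<integral>\<^sup>+\<omega>. ennreal (X \<omega> powr s) \<partial>N) \<noteq> \<infinity>"
  then have int: "integrable N (\<lambda>\<omega>. X \<omega> powr s)"
    by (intro integrableI_nonneg) (auto simp: less_top)
  define K where "K = 1 + expectation (\<lambda>\<omega>. X \<omega> powr s)"
  have le: "expectation (\<lambda>\<omega>. X \<omega> powr x) \<le> K" if "x \<in> {- 3/2<..<3/2}" "0 \<le> x \<and> x \<le> s \<or> s \<le> x \<and> x \<le> 0" for x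
    unfolding K_def using int that by (rule expectation_powr_le)
  have pos: "0 < Gamma y" if "0 < y" for y :: real using that by (rule Gamma_real_pos)
  have g0: "Gamma y \<noteq> 0" if "0 < y" for y :: real using pos[OF that] by linarith
  have n: "y \<notin> \<int>\<^sub>\<le>\<^sub>0" if "0 < y" for y :: real using that by (rule pos_notin_nonpos_Ints)
  show False
  proof (cases "3/2 \<le> s")
    case True
    \<comment> \<open>This is \<open>(3/2 - x) * real_moment2 x\<close> with the linear factor
      absorbed into the Gamma function, which makes the expression continuous at 3/2.\<close>
    let ?c = "\<lambda>x. 2 * Gamma (1 / 3) / (3 * sqrt pi) * (Gamma (1 + 2 * x / 3) * Gamma (5 / 2 - x) / Gamma (4 / 3 - 2 * x / 3))
       * (3 powr (4 / 3) / 2) powr x :: real"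
    have A: "(?c \<longlongrightarrow> ?c (3/2)) (at_left (3/2))"
      by (intro tendsto_intros) (auto intro!: n simp: g0)
    have B: "((\<lambda>x. (3/2 - x) * K) \<longlongrightarrow> (3/2 - 3/2) * K) (at_left (3/2 :: real))"
      by (intro tendsto_intros)
    have ev: "\<forall>\<^sub>F x in at_left (3/2). ?c x \<le> (3/2 - x) * K"
    proof -
      \<comment> \<open>The order 1 is excluded in \<open>expectation_eq_real_moment2\<close>, hence
        the lower end 1.\<close>
      have "\<forall>\<^sub>F x in at_left (3/2). x \<in> {1<..<3/2 :: real}" by (rule eventually_at_left_real) simp
      then show ?thesis
      proof eventually_elim
        case (elim x)
        then have x: "1 < x" "x < 3/2" by auto
        have "Gamma (3/2 - x + 1) = (3/2 - x) * Gamma (3/2 - x)" using x by (intro Gamma_plus1 n) simp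
        then have "Gamma (5/2 - x) = (3/2 - x) * Gamma (3/2 - x)" by (simp add: algebra_simps)
        then have "?c x = (3/2 - x) * real_moment2 x" unfolding real_moment2_def by simp
        also have "real_moment2 x = expectation (\<lambda>\<omega>. X \<omega> powr x)"
          using x by (intro expectation_eq_real_moment2[symmetric]) auto
        also have "(3/2 - x) * expectation (\<lambda>\<omega>. X \<omega> powr x) \<le> (3/2 - x) * K"
          using x True by (intro mult_left_mono le) auto
        finally show ?case .
      qed
    qed
    have "?c (3/2) \<le> (3/2 - 3/2) * K"
      by (rule tendsto_le[OF trivial_limit_at_left_real B A ev])
    also have "(3/2 - 3/2) * K = 0" by simp
    finally have "?c (3/2) \<le> 0" .
    moreover have "0 < ?c (3/2)"
      by (intro mult_pos_pos divide_pos_pos pos) auto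
    ultimately show False by (rule leD[THEN notE])
  next
    case False
    then have s: "s \<le> - 3/2" using assms by simp
    let ?c = "\<lambda>x. Gamma (2 + 2 * x / 3) * Gamma (2 / 3 - 2 * x / 3) * Gamma (1 - 2 * x / 3)
       / (Gamma (2 / 3) * Gamma (1 - x)) * (2 / 3 powr (2 / 3)) powr x :: real"
    have A: "(?c \<longlongrightarrow> ?c (- 3/2)) (at_right (- 3/2))"
      by (intro tendsto_intros) (auto intro!: n simp: g0)
    have B: "((\<lambda>x. (1 + 2 * x / 3) * K) \<longlongrightarrow> (1 + 2 * (- 3/2) / 3) * K) (at_right (- 3/2 :: real))"
      by (intro tendsto_intros) simp_all
    have ev: "\<forall>\<^sub>F x in at_right (- 3/2). ?c x \<le> (1 + 2 * x / 3) * K"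
    proof -
      have "\<forall>\<^sub>F x in at_right (- 3/2). x \<in> {- 3/2<..<0 :: real}" by (rule eventually_at_right_real) simp
      then show ?thesis
      proof eventually_elim
        case (elim x)
        then have x: "- 3/2 < x" "x < 0" by auto
        have "Gamma (1 + 2 * x / 3 + 1) = (1 + 2 * x / 3) * Gamma (1 + 2 * x / 3)" using x by (intro Gamma_plus1 n) simp
        then have "Gamma (2 + 2 * x / 3) = (1 + 2 * x / 3) * Gamma (1 + 2 * x / 3)" by (simp add: algebra_simps)
        then have "?c x = (1 + 2 * x / 3) * real_moment1 x" unfolding real_moment1_def by simp
        also have "real_moment1 x = expectation (\<lambda>\<omega>. X \<omega> powr x)"
          using x by (intro expectation_eq_real_moment1[symmetric]) auto
        also have "(1 + 2 * x / 3) * expectation (\<lambda>\<omega>. X \<omega> powr x) \<le> (1 + 2 * x / 3) * K"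
          using x s by (intro mult_left_mono le) auto
        finally show ?case .
      qed
    qed
    have "?c (- 3/2) \<le> (1 + 2 * (- 3/2) / 3) * K"
      by (rule tendsto_le[OF trivial_limit_at_right_real B A ev])
    also have "(1 + 2 * (- 3/2) / 3) * K = 0" by simp
    finally have "?c (- 3/2) \<le> 0" .
    moreover have "0 < ?c (- 3/2)"
      by (intro mult_pos_pos divide_pos_pos pos) auto
    ultimately show False by (rule leD[THEN notE])
  qed
qed

end

section \<open>Passage from the given process to everywhere continuous paths\<close>

context prob_space
begin

text \<open>Independence of finitely many variables is a statement about their joint and marginal
  laws, which do not change under almost sure modification. This characterisation asks for a
  nonempty index set, so the empty family is treated apart.\<close>

lemma indep_vars_cong_AE:
  assumes I: "finite I" and ae: "\<And>i. i \<in> I \<Longrightarrow> AE x in M. X i x = Y i x"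
    and X: "\<And>i. i \<in> I \<Longrightarrow> random_variable (M' i) (X i)" and Y: "\<And>i. i \<in> I \<Longrightarrow> random_variable (M' i) (Y i)"
    and indep: "indep_vars M' X I"
  shows "indep_vars M' Y I"
proof (cases "I = {}")
  case True
  then show ?thesis using indep indep_vars_cong[of I I X Y M' M'] by simp
next
  case False
  have "AE x in M. \<forall>i\<in>I. X i x = Y i x" using I ae by (simp add: AE_finite_all)
  then have "distr M (\<Pi>\<^sub>M i\<in>I. M' i) (\<lambda>x. \<lambda>i\<in>I. X i x) = distr M (\<Pi>\<^sub>M i\<in>I. M' i) (\<lambda>x. \<lambda>i\<in>I. Y i x)"
    by (intro distr_cong_AE) (auto elim!: eventually_mono intro!: measurable_restrict X Y restrict_ext)
  moreover have "distr M (M' i) (X i) = distr M (M' i) (Y i)" if "i \<in> I" for i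
    using that ae X Y by (intro distr_cong_AE) auto
  then have "(\<Pi>\<^sub>M i\<in>I. distr M (M' i) (X i)) = (\<Pi>\<^sub>M i\<in>I. distr M (M' i) (Y i))"
    by (intro PiM_cong) auto
  ultimately show ?thesis
    using indep indep_vars_iff_distr_eq_PiM'[OF False X] indep_vars_iff_distr_eq_PiM'[OF False Y] by simp
qed

end

text \<open>The process is kept on a set of full measure on which paths are continuous and start at
  0, and is set to 0 elsewhere; negative times are mapped to 0.\<close>

lemma (in standard_brownian_motion) continuous_modification:
  obtains W where "continuous_brownian_motion M W"
    and "AE \<omega> in M. \<forall>t\<ge>0. W t \<omega> = B t \<omega>"
proof -
  have "AE \<omega> in M. B 0 \<omega> = 0 \<and> continuous_on {0..} (\<lambda>t. B t \<omega>)"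
    using start_zero continuous_paths by eventually_elim simp
  \<comment> \<open>The set of good outcomes need not be measurable, so its complement is covered by
    a measurable null set.\<close>
  then obtain N0 where N0: "{\<omega> \<in> space M. \<not> (B 0 \<omega> = 0 \<and> continuous_on {0..} (\<lambda>t. B t \<omega>))} \<subseteq> N0"
    "emeasure M N0 = 0" "N0 \<in> sets M" by (rule AE_E)
  define A where "A = space M - N0"
  have A [measurable]: "A \<in> sets M" using N0(3) by (simp add: A_def)
  have A_AE: "AE \<omega> in M. \<omega> \<in> A"
    using N0(2,3) by (intro AE_I[where N=N0]) (auto simp: A_def)
  define W where "W = (\<lambda>t \<omega>. if \<omega> \<in> A then B (max 0 t) \<omega> else 0)"
  have W_eq: "AE \<omega> in M. \<forall>t\<ge>0. W t \<omega> = B t \<omega>"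
    using A_AE by eventually_elim (simp add: W_def)
  have W_meas: "W t \<in> borel_measurable M" for t
  proof -
    have [measurable]: "B (max 0 t) \<in> borel_measurable M" by (rule random_variable_B) simp
    show ?thesis unfolding W_def by measurable
  qed
  have paths: "continuous_path (\<lambda>t. W t \<omega>)" for \<omega>
  proof (cases "\<omega> \<in> A")
    case True
    then have *: "B 0 \<omega> = 0" "continuous_on {0..} (\<lambda>t. B t \<omega>)" using N0(1) by (auto simp: A_def)
    have "continuous_on UNIV (\<lambda>t. B (max 0 t) \<omega>)"
      by (rule continuous_on_compose2[OF *(2)]) (auto intro!: continuous_intros)
    then show ?thesis using True * by (simp add: continuous_path_def W_def)
  next
    case False
    then show ?thesis by (simp add: continuous_path_def W_def)
  qed
  have incr: "AE \<omega> in M. B t \<omega> - B s \<omega> = W t \<omega> - W s \<omega>" if "0 \<le> s" "0 \<le> t" for s t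
    using W_eq by eventually_elim (simp add: that)
  have "continuous_brownian_motion M W"
  proof (intro continuous_brownian_motion.intro standard_brownian_motion.intro continuous_brownian_motion_axioms.intro
      standard_brownian_motion_axioms.intro prob_space_axioms W_meas paths)
    show "AE \<omega> in M. W 0 \<omega> = 0"
      by (rule AE_I2) (rule continuous_path.zero[OF paths])
    show "AE \<omega> in M. continuous_on {0..} (\<lambda>t. W t \<omega>)"
      by (rule AE_I2) (rule continuous_on_subset[OF continuous_path.cont[OF paths] subset_UNIV])
    show "distributed M lborel (\<lambda>\<omega>. W t \<omega> - W s \<omega>) (normal_density 0 (sqrt (t - s)))" if "0 \<le> s" "s < t" for s t
    proof -
      have [measurable]: "B s \<in> borel_measurable M" "B t \<in> borel_measurable M" "W s \<in> borel_measurable M" "W t \<in> borel_measurable M"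
        using that by (auto intro!: random_variable_B W_meas)
      have "distr M lborel (\<lambda>\<omega>. B t \<omega> - B s \<omega>) = distr M lborel (\<lambda>\<omega>. W t \<omega> - W s \<omega>)"
        using that by (intro distr_cong_AE incr) auto
      then show ?thesis using normal_increments[OF that] by (simp add: distributed_def)
    qed
    show "indep_vars (\<lambda>_. borel) (\<lambda>i \<omega>. W (t (Suc i)) \<omega> - W (t i) \<omega>) {..<n}"
      if "0 \<le> t 0" "\<And>i. i < n \<Longrightarrow> t i \<le> t (Suc i)" for n and t :: "nat \<Rightarrow> real"
    proof (rule indep_vars_cong_AE)
      have nonneg: "0 \<le> t i" if "i \<le> n" for i
        using that
      proof (induction i)
        case (Suc i)
        then have "0 \<le> t i" "t i \<le> t (Suc i)" using \<open>\<And>i. i < n \<Longrightarrow> t i \<le> t (Suc i)\<close>[of i] by auto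
        then show ?case by simp
      qed (rule \<open>0 \<le> t 0\<close>)
      show "indep_vars (\<lambda>_. borel) (\<lambda>i \<omega>. B (t (Suc i)) \<omega> - B (t i) \<omega>) {..<n}"
        using that by (rule indep_increments)
      fix i assume i: "i \<in> {..<n}"
      then have t: "0 \<le> t i" "0 \<le> t (Suc i)" using nonneg by auto
      show "AE \<omega> in M. B (t (Suc i)) \<omega> - B (t i) \<omega> = W (t (Suc i)) \<omega> - W (t i) \<omega>" using t by (intro incr)
      show "random_variable borel (\<lambda>\<omega>. B (t (Suc i)) \<omega> - B (t i) \<omega>)"
        using t by (intro borel_measurable_diff random_variable_B)
      show "random_variable borel (\<lambda>\<omega>. W (t (Suc i)) \<omega> - W (t i) \<omega>)"
        by (intro borel_measurable_diff W_meas)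
    qed simp
  qed
  then show ?thesis using W_eq by (rule that)
qed

lemma running_max_area_eq_area:
  assumes "continuous_path w" and "\<And>t. 0 \<le> t \<Longrightarrow> w t = B t \<omega>"
  shows "running_max_area B \<omega> = area w 1"
proof -
  interpret continuous_path w by fact
  have eq: "running_max B t \<omega> = smax w t" if "0 \<le> t" for t
    unfolding running_max_def smax_def using that assms(2) by (intro SUP_cong) auto
  have "running_max_area B \<omega> = (LBINT t:{0..1}. smax w t)"
    unfolding running_max_area_def by (rule set_lebesgue_integral_cong) (auto simp: eq)
  also have "\<dots> = integral {0..1} (smax w)"
    by (rule set_borel_integral_eq_integral(2)) (intro borel_integrable_atLeastAtMost' smax_continuous)
  finally show ?thesis by (simp add: integral_smax_0)
qed

text \<open>Were the area not measurable, every integral in the hypothesis would be the junk value \<open>0\<close>,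
  which contradicts the positivity of \<open>X\<close>.\<close>

lemma running_max_area_measurable:
  fixes A :: "'a \<Rightarrow> real"
  assumes "prob_space N" and [measurable]: "X \<in> borel_measurable N" and "AE \<omega> in N. 0 < X \<omega>"
    and law: "\<And>x::real. 0 < x \<Longrightarrow> measure N {\<omega> \<in> space N. x < X \<omega>} = (\<integral>\<omega>. exp (- (x powr (3 / 2)) * A \<omega>) \<partial>P)"
  shows "A \<in> borel_measurable P"
proof (rule ccontr)
  assume *: "A \<notin> borel_measurable P"
  interpret N: prob_space N by fact
  have "measure N {\<omega> \<in> space N. x < X \<omega>} = 0" if x: "0 < x" for x
  proof -
    let ?c = "x powr (3/2)"
    \<comment> \<open>\<open>A\<close> is a Borel function of this exponential, so measurability
      would carry over to \<open>A\<close>.\<close>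
    have "(\<lambda>\<omega>. exp (- ?c * A \<omega>)) \<notin> borel_measurable P"
    proof
      assume "(\<lambda>\<omega>. exp (- ?c * A \<omega>)) \<in> borel_measurable P"
      moreover have "(\<lambda>y. - ln y / ?c) \<in> borel_measurable borel" by measurable
      ultimately have "(\<lambda>\<omega>. - ln (exp (- ?c * A \<omega>)) / ?c) \<in> borel_measurable P" by (rule measurable_compose)
      moreover have "- ln (exp (- ?c * A \<omega>)) / ?c = A \<omega>" for \<omega>
        unfolding ln_exp using x by simp
      ultimately have "A \<in> borel_measurable P" by (simp only:)
      with * show False ..
    qed
    then have "\<not> integrable P (\<lambda>\<omega>. exp (- ?c * A \<omega>))"
      by (rule contrapos_nn) (rule borel_measurable_integrable)
    then show ?thesis unfolding law[OF x] by (rule not_integrable_integral_eq)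
  qed
  then have "AE \<omega> in N. \<not> x < X \<omega>" if "0 < x" for x
    using that by (subst AE_iff_measurable[OF _ refl]) (auto simp: N.emeasure_eq_measure)
  then have "AE \<omega> in N. \<forall>n. \<not> 1 / real (Suc n) < X \<omega>" by (subst AE_all_countable) simp
  with assms(3) have "AE \<omega> in N. False"
  proof eventually_elim
    case (elim \<omega>)
    then obtain n where "inverse (real (Suc n)) < X \<omega>" using reals_Archimedean by blast
    with elim(2) show ?case by (simp add: inverse_eq_divide)
  qed
  then show False by simp
qed

text \<open>The law gives the tail of \<open>X\<close> in terms of the area at time 1. Scaling moves
  the factor \<open>x powr (3/2)\<close> into the time, so the tail at \<open>t\<close> is the
  expectation of \<open>exp (- A t)\<close>, whose Laplace transform is known.\<close>

lemma area_tail_of_brownian_motion: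
  assumes BM: "standard_brownian_motion P B" and N: "prob_space N"
    and X: "X \<in> borel_measurable N" and X_pos: "AE \<omega> in N. 0 < X \<omega>"
    and law: "\<And>x::real. 0 < x \<Longrightarrow> measure N {\<omega> \<in> space N. x < X \<omega>}
             = (\<integral>\<omega>. exp (- (x powr (3 / 2)) * running_max_area B \<omega>) \<partial>P)"
  shows "area_tail N X"
proof -
  interpret B: standard_brownian_motion P B by fact
  interpret N: prob_space N by fact
  note [measurable] = X
  obtain W where W: "continuous_brownian_motion P W" "AE \<omega> in P. \<forall>t\<ge>0. W t \<omega> = B t \<omega>"
    by (rule B.continuous_modification)
  interpret W: continuous_brownian_motion P W by fact
  have [measurable]: "running_max_area B \<in> borel_measurable P"
    by (rule running_max_area_measurable[OF N X X_pos law])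
  have [measurable]: "(\<lambda>\<omega>. area (\<lambda>t. W t \<omega>) 1) \<in> borel_measurable P" by (rule W.area_measurable)
  have area: "AE \<omega> in P. running_max_area B \<omega> = area (\<lambda>t. W t \<omega>) 1"
    using W(2) by eventually_elim (rule running_max_area_eq_area[OF W.paths], simp)
  have tail: "measure N {\<omega> \<in> space N. t < X \<omega>} = (\<integral>\<omega>. exp (- area (\<lambda>u. W u \<omega>) t) \<partial>P)" if "0 < t" for t
  proof -
    have "(\<integral>\<omega>. exp (- (t powr (3 / 2)) * running_max_area B \<omega>) \<partial>P) = (\<integral>\<omega>. exp (- (t powr (3 / 2)) * area (\<lambda>u. W u \<omega>) 1) \<partial>P)"
      by (rule integral_cong_AE) (use area in \<open>auto elim!: eventually_mono\<close>)
    then show ?thesis unfolding law[OF that] by (simp only: W.area_scaling[OF that])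
  qed
  show ?thesis
  proof (intro area_tail.intro area_tail_axioms.intro N X X_pos)
    fix l :: real assume l: "0 < l"
    \<comment> \<open>The law is assumed for positive arguments only; the single time 0 is a null
      set.\<close>
    have "(\<integral>\<^sup>+t. ennreal (exp (- (l * t)) * measure N {\<omega> \<in> space N. t < X \<omega>}) * indicator {0..} t \<partial>lborel)
      = (\<integral>\<^sup>+t. ennreal (exp (- (l * t)) * (\<integral>\<omega>. exp (- area (\<lambda>u. W u \<omega>) t) \<partial>P)) * indicator {0..} t \<partial>lborel)"
      using AE_lborel_singleton[of "0::real"]
      by (intro nn_integral_cong_AE) (auto elim!: eventually_mono simp: indicator_def tail)
    moreover have "(\<integral>\<^sup>+a. ennreal (1 / (l + a)\<^sup>2 * exp (- (2 * sqrt 2 / 3 * ((l + a) powr (3/2) - l powr (3/2))))) * indicator {0<..} a \<partial>lborel)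
      = (\<integral>\<^sup>+a. ennreal (1 / (l + a)\<^sup>2 * exp (- killed_exponent l a)) * indicator {0<..} a \<partial>lborel)"
      by (intro nn_integral_cong) (auto simp: indicator_def killed_exponent_eq[OF l])
    ultimately show "(\<integral>\<^sup>+t. ennreal (exp (- (l * t)) * measure N {\<omega> \<in> space N. t < X \<omega>}) * indicator {0..} t \<partial>lborel)
      + (\<integral>\<^sup>+a. ennreal (1 / (l + a)\<^sup>2 * exp (- (2 * sqrt 2 / 3 * ((l + a) powr (3/2) - l powr (3/2))))) * indicator {0<..} a \<partial>lborel)
      = ennreal (1 / l)"
      by (simp only: W.area_laplace_identity[OF l])
  qed
qed

theorem theorem1p12:
  fixes P :: "'a measure" and B :: "real \<Rightarrow> 'a \<Rightarrow> real"
    and N :: "'b measure" and X :: "'b \<Rightarrow> real"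
  assumes "standard_brownian_motion P B"
    and "prob_space N"
    and "X \<in> borel_measurable N"
    and "AE \<omega> in N. 0 < X \<omega>"
    and "\<And>x::real. 0 < x \<Longrightarrow>
           measure N {\<omega> \<in> space N. x < X \<omega>}
             = (\<integral>\<omega>. exp (- (x powr (3 / 2)) * running_max_area B \<omega>) \<partial>P)"
  shows "(\<forall>s::complex. - 3 / 2 < Re s \<and> Re s < 3 / 2 \<longrightarrow>
            integrable N (\<lambda>\<omega>. complex_of_real (X \<omega>) powr s)
            \<and> (\<integral>\<omega>. complex_of_real (X \<omega>) powr s \<partial>N) = moment1 s
            \<and> (\<integral>\<omega>. complex_of_real (X \<omega>) powr s \<partial>N) = moment2 s
            \<and> (\<integral>\<omega>. complex_of_real (X \<omega>) powr s \<partial>N) = moment3 s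
            \<and> (\<integral>\<omega>. complex_of_real (X \<omega>) powr s \<partial>N) = moment4 s)
       \<and> (\<forall>s::real. s \<le> - 3 / 2 \<or> 3 / 2 \<le> s \<longrightarrow>
            (\<integral>\<^sup>+\<omega>. ennreal (X \<omega> powr s) \<partial>N) = \<infinity>)"
proof -
  interpret area_tail N X by (rule area_tail_of_brownian_motion[OF assms])
  show ?thesis
  proof (rule conjI; intro allI impI)
    fix s :: complex assume "- 3 / 2 < Re s \<and> Re s < 3 / 2"
    then have "s \<in> moment_strip" by (simp add: moment_strip_def)
    note moments = integrable_complex_moment[OF this] mellin_eq_moments(1-4)[OF this, unfolded mellin_def]
    show "integrable N (\<lambda>\<omega>. complex_of_real (X \<omega>) powr s)
            \<and> (\<integral>\<omega>. complex_of_real (X \<omega>) powr s \<partial>N) = moment1 s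
            \<and> (\<integral>\<omega>. complex_of_real (X \<omega>) powr s \<partial>N) = moment2 s
            \<and> (\<integral>\<omega>. complex_of_real (X \<omega>) powr s \<partial>N) = moment3 s
            \<and> (\<integral>\<omega>. complex_of_real (X \<omega>) powr s \<partial>N) = moment4 s"
      by (intro conjI) (fact moments)+
  qed (rule infinite_moment)
qed

end
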